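(* In the high-dimensional linear model and with the notation of the context, suppose that (A1)--(A5) hold, that $$\max_{1\le j\le p} K_0^2 s_j^2(\log(pn))^3(\log n)^2/n=o(1),\qquad K_0^4 s_0^2(\log p)^3/n=o(1),$$ and that the tuning parameters are suitably chosen such that $$\lambda\asymp K_0\sqrt{\log(p)/n},\qquad \lambda_j\asymp K_0\sqrt{\log(p)/n}\ \text{ uniformly for } j$$ (that is, there is a choice of tuning parameters of these orders for which the following holds). Let $G=G_n\subseteq\{1,\ldots,p\}$ with $|G|\to\infty$ as $n\to\infty$, let $\widetilde\beta_j$, $j\in G$, be pre-specified real numbers, and let $\alpha\in(0,1)$. Then for any $\varepsilon_0>0$, $$\inf_{\beta^0\in\mathcal U_G(\sqrt2+\varepsilon_0)}P\Big(\max_{j\in G}\sqrt n|\breve\beta_j-\widetilde\beta_j|/\sqrt{\widehat\omega_{jj}}>\bar c_G^*(\alpha)\Big)\to1,$$ where, for $c_0>0$, $\mathcal U_G(c_0)=\{\beta=(\beta_1,\ldots,\beta_p)^T:\max_{j\in G}|\beta_j-\widetilde\beta_j|/\sqrt{\omega_{jj}}>c_0\sqrt{\log(|G|)/n}\}$, $\omega_{jj}=\sigma_\epsilon^2\theta_{jj}$, and the infimum is restricted to those $\beta^0$ in this set having at most $s_0$ nonzero entries.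
   Context: **Asymptotics.** All limits are as $n\to\infty$; $p=p_n$ and all model quantities may depend on $n$, while constants named $c,c',C,C',c_1,C_1,c_2,C_2$ are positive and do not depend on $n$ or $p$. $a_n\asymp b_n$ means the ratio is bounded above and away from $0$. $\|a\|_q$ is the $\ell_q$ norm and $\|a\|_\infty$ the maximum norm. **Model.** $Y=\mathbf X\beta^0+\epsilon$ with response $Y=(Y_1,\dots,Y_n)^T$, random $n\times p$ design $\mathbf X=[X_1,\ldots,X_p]=(X_{ij})$, error $\epsilon=(\epsilon_1,\ldots,\epsilon_n)^T$ independent of $\mathbf X$ with i.i.d. mean-zero entries of variance $\sigma_\epsilon^2$, and unknown $\beta^0=(\beta^0_1,\dots,\beta^0_p)^T$. The rows of $\mathbf X$ are i.i.d. with mean zero and covariance $\Sigma=(\sigma_{ij})$; $\Theta=\Sigma^{-1}=(\theta_{ij})$. $\widetilde X_i=(X_{i1},\ldots,X_{ip})^T$ is the $i$th row of $\mathbf X$ and $\mathbf X_{-j}$ is $\mathbf X$ without its $j$th column. $s_0=s_{0,n}$ is the sparsity level (a bound on the number of nonzero entries of $\beta^0$); for $1\le j\le p$, $s_j=|\{k\neq j:\theta_{jk}\ne0\}|$. $\gamma_j=\arg\min_{\gamma\in\mathbb R^{p-1}}\mathbb E\|X_j-\mathbf X_{-j}\gamma\|_2^2$ and $\eta_j=X_j-\mathbf X_{-j}\gamma_j=(\eta_{1,j},\ldots,\eta_{n,j})^T$. **Estimators.** Lasso: $\widehat\beta=\arg\min_{\beta\in\mathbb R^p}(\|Y-\mathbf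 X\beta\|_2^2/n+2\lambda\|\beta\|_1)$. Nodewise Lasso: $\widehat\gamma_j=\arg\min_{\gamma\in\mathbb R^{p-1}}(\|X_j-\mathbf X_{-j}\gamma\|_2^2/n+2\lambda_j\|\gamma\|_1)$ with components $\widehat\gamma_{j,k}$, $k\ne j$; $\widehat\tau_j^2=\|X_j-\mathbf X_{-j}\widehat\gamma_j\|_2^2/n+\lambda_j\|\widehat\gamma_j\|_1$; $\widehat C=(\widehat c_{i,j})$ with $\widehat c_{i,i}=1$, $\widehat c_{i,j}=-\widehat\gamma_{i,j}$ for $i\neq j$; $\widehat\Theta=\mathrm{diag}(\widehat\tau_1^{2},\ldots,\widehat\tau_p^{2})^{-1}\widehat C$. $\widehat\Theta_j$ is the $j$th row of $\widehat\Theta$, viewed as a column vector. De-sparsifying Lasso estimator: $\breve\beta=\widehat\beta+\widehat\Theta\mathbf X^T(Y-\mathbf X\widehat\beta)/n$. $\widehat\sigma_\epsilon^2$ is an estimator of $\sigma_\epsilon^2$ computed from $(Y,\mathbf X)$. $\widehat\Sigma=\mathbf X^T\mathbf X/n$ and $(\widehat\omega_{ij})_{i,j=1}^p=\widehat\Theta\widehat\Sigma\widehat\Theta^T\widehat\sigma_\epsilon^2$. **Bootstrap.** $e_1,\ldots,e_n$ are i.i.d. $N(0,1)$ independent of the data, $\bar W_G^*=\max_{j\in G}\big|\sum_{i=1}^n\widehat\Theta_j^T\widetilde X_i\widehat\sigma_\epsilon e_i/\sqrt{n\widehat\omega_{jj}}\big|$, and $\bar c_G^*(\alpha)=\inf\{t\in\mathbb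 R:P(\bar W_G^*\le t\mid(Y,\mathbf X))\ge1-\alpha\}$. **Assumptions.** (A1) Either (sub-Gaussian case) $\mathbf X$ has i.i.d. sub-Gaussian rows: $\sup_{\|a\|_2\le1}\mathbb E\exp\{|\sum_{j=1}^pa_jX_{ij}|^2/C\}\le2$ for some large enough constant $C$; or (strongly bounded case) the rows are i.i.d. and, for some $K_n\ge1$ (allowed to grow with $n$), $\max_{i,j}|X_{ij}|\le K_n$, $\max_j\|\mathbf X_{-j}\gamma_j\|_\infty\le K_n$ and $\max_j\mathbb E\eta_{1,j}^4\le K_n^4$. Put $K_0=1$ in the sub-Gaussian case and $K_0=K_n$ in the strongly bounded case. (A2) The smallest eigenvalue $\Lambda_{\min}^2$ of $\Sigma$ satisfies $c<\Lambda_{\min}^2$, and $\max_j\Sigma_{j,j}\le C$. (A3) In the sub-Gaussian case: $(\log(pn))^7/n\le C_1n^{-c_1}$, and $\{\epsilon_i\}$ are i.i.d. sub-Gaussian with $c'<\sigma_\epsilon^2<c$. In the strongly bounded case: $\max_{1\le j\le p}s_jK_n^2(\log(pn))^7/n\le C_2n^{-c_2}$, and $\{\epsilon_i\}$ are i.i.d. sub-exponential, i.e. $\mathbb E\exp(|\epsilon_i|/C')\le2$, with $c'<\sigma_\epsilon^2<c$. (A4) There is a sequence $\alpha_n\to+\infty$ of positive numbers with $\alpha_n/p=o(1)$, $\alpha_n(\log p)^2\max_j\lambda_j\sqrt{s_j}=o(1)$ and $P(\alpha_n(\log p)^2|\widehat\sigma_\epsilon^2-\sigma_\epsilon^2|>1)\to0$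 (uniformly over the $\beta^0$ under consideration). (A5) With $\widetilde\theta_{ij}=\theta_{ij}/\sqrt{\theta_{ii}\theta_{jj}}$, $\max_{1\le i\ne j\le p}|\widetilde\theta_{ij}|\le c<1$ for some constant $c$. *)

theory Defs
  imports "HOL-Probability.Probability"
    "Jordan_Normal_Form.Gauss_Jordan_Elimination"
    "Jordan_Normal_Form.Spectral_Radius"
begin

hide_const (open) Finite_Cartesian_Product.mat

section \<open>Spaces of vectors and matrices\<close>

text \<open>Indices start at 0. A vector in \<open>\<real>\<^sup>I\<close> is an element of \<open>extensional I\<close>, which is the carrier
  of the product space \<open>vecs I\<close>; an \<open>n \<times> p\<close> data matrix \<open>A\<close> has entries \<open>A i j\<close> and rows \<open>A i\<close>.\<close>

abbreviation vecs :: "nat set \<Rightarrow> (nat \<Rightarrow> real) measure" where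
  "vecs I \<equiv> PiM I (\<lambda>_. borel)"

abbreviation designs :: "nat \<Rightarrow> nat \<Rightarrow> (nat \<Rightarrow> nat \<Rightarrow> real) measure" where
  "designs n p \<equiv> PiM {..<n} (\<lambda>_. vecs {..<p})"

abbreviation samples :: "nat \<Rightarrow> nat \<Rightarrow> ((nat \<Rightarrow> real) \<times> (nat \<Rightarrow> nat \<Rightarrow> real)) measure" where
  "samples n p \<equiv> vecs {..<n} \<Otimes>\<^sub>M designs n p"

section \<open>The model\<close>

text \<open>Independence of \<open>X\<close> and \<open>eps\<close> is that of the generated \<open>\<sigma>\<close>-algebras, since \<open>indep_var\<close>
  would require the two random elements to have the same type.\<close>

definition linear_model ::
  "'a measure \<Rightarrow> nat \<Rightarrow> nat \<Rightarrow> ('a \<Rightarrow> nat \<Rightarrow> nat \<Rightarrow> real) \<Rightarrow> ('a \<Rightarrow> nat \<Rightarrow> real) \<Rightarrow> real \<Rightarrow> bool" where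
  "linear_model M n p X eps sig2 \<longleftrightarrow>
     prob_space M \<and>
     X \<in> M \<rightarrow>\<^sub>M designs n p \<and>
     eps \<in> M \<rightarrow>\<^sub>M vecs {..<n} \<and>
     prob_space.indep_set M (sets (vimage_algebra (space M) X (designs n p)))
       (sets (vimage_algebra (space M) eps (vecs {..<n}))) \<and>
     prob_space.indep_vars M (\<lambda>_. vecs {..<p}) (\<lambda>i \<omega>. X \<omega> i) {..<n} \<and>
     (\<forall>i<n. distr M (vecs {..<p}) (\<lambda>\<omega>. X \<omega> i) = distr M (vecs {..<p}) (\<lambda>\<omega>. X \<omega> 0)) \<and>
     (\<forall>i<n. \<forall>j<p. integrable M (\<lambda>\<omega>. (X \<omega> i j)\<^sup>2) \<and> (\<integral>\<omega>. X \<omega> i j \<partial>M) = 0) \<and>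
     prob_space.indep_vars M (\<lambda>_. borel) (\<lambda>i \<omega>. eps \<omega> i) {..<n} \<and>
     (\<forall>i<n. distr M borel (\<lambda>\<omega>. eps \<omega> i) = distr M borel (\<lambda>\<omega>. eps \<omega> 0)) \<and>
     (\<forall>i<n. integrable M (\<lambda>\<omega>. (eps \<omega> i)\<^sup>2) \<and> (\<integral>\<omega>. eps \<omega> i \<partial>M) = 0 \<and>
            (\<integral>\<omega>. (eps \<omega> i)\<^sup>2 \<partial>M) = sig2)"

definition response ::
  "nat \<Rightarrow> nat \<Rightarrow> (nat \<Rightarrow> nat \<Rightarrow> real) \<Rightarrow> (nat \<Rightarrow> real) \<Rightarrow> (nat \<Rightarrow> real) \<Rightarrow> nat \<Rightarrow> real" where
  "response n p A \<beta> e = (\<lambda>i\<in>{..<n}. (\<Sum>j<p. A i j * \<beta> j) + e i)"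

text \<open>The observed data \<open>(Y, X)\<close> when the true regression vector is \<open>\<beta>\<close>.\<close>

definition data ::
  "nat \<Rightarrow> nat \<Rightarrow> ('a \<Rightarrow> nat \<Rightarrow> nat \<Rightarrow> real) \<Rightarrow> ('a \<Rightarrow> nat \<Rightarrow> real) \<Rightarrow> (nat \<Rightarrow> real) \<Rightarrow> 'a
     \<Rightarrow> (nat \<Rightarrow> real) \<times> (nat \<Rightarrow> nat \<Rightarrow> real)" where
  "data n p X eps \<beta> \<omega> = (response n p (X \<omega>) \<beta> (eps \<omega>), X \<omega>)"

text \<open>Covariance of a row; the rows are centred and identically distributed.\<close>

definition covariance ::
  "'a measure \<Rightarrow> nat \<Rightarrow> ('a \<Rightarrow> nat \<Rightarrow> nat \<Rightarrow> real) \<Rightarrow> real mat" where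
  "covariance M p X = Matrix.mat p p (\<lambda>(j, k). \<integral>\<omega>. X \<omega> 0 j * X \<omega> 0 k \<partial>M)"

definition precision ::
  "'a measure \<Rightarrow> nat \<Rightarrow> ('a \<Rightarrow> nat \<Rightarrow> nat \<Rightarrow> real) \<Rightarrow> real mat" where
  "precision M p X = the (mat_inverse (covariance M p X))"

definition row_sparsity ::
  "'a measure \<Rightarrow> nat \<Rightarrow> ('a \<Rightarrow> nat \<Rightarrow> nat \<Rightarrow> real) \<Rightarrow> nat \<Rightarrow> nat" where
  "row_sparsity M p X j = card {k. k < p \<and> k \<noteq> j \<and> precision M p X $$ (j, k) \<noteq> 0}"

definition pop_gamma ::
  "'a measure \<Rightarrow> nat \<Rightarrow> nat \<Rightarrow> ('a \<Rightarrow> nat \<Rightarrow> nat \<Rightarrow> real) \<Rightarrow> nat \<Rightarrow> nat \<Rightarrow> real" where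
  "pop_gamma M n p X j =
     arg_min (\<lambda>g. \<integral>\<omega>. (\<Sum>i<n. (X \<omega> i j - (\<Sum>k\<in>{..<p} - {j}. X \<omega> i k * g k))\<^sup>2) \<partial>M)
             (\<lambda>g. g \<in> extensional ({..<p} - {j}))"

definition pop_fit ::
  "'a measure \<Rightarrow> nat \<Rightarrow> nat \<Rightarrow> ('a \<Rightarrow> nat \<Rightarrow> nat \<Rightarrow> real) \<Rightarrow> nat \<Rightarrow> 'a \<Rightarrow> nat \<Rightarrow> real" where
  "pop_fit M n p X j \<omega> i = (\<Sum>k\<in>{..<p} - {j}. X \<omega> i k * pop_gamma M n p X j k)"

definition pop_resid ::
  "'a measure \<Rightarrow> nat \<Rightarrow> nat \<Rightarrow> ('a \<Rightarrow> nat \<Rightarrow> nat \<Rightarrow> real) \<Rightarrow> nat \<Rightarrow> 'a \<Rightarrow> nat \<Rightarrow> real" where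
  "pop_resid M n p X j \<omega> i = X \<omega> i j - pop_fit M n p X j \<omega> i"

section \<open>Estimators\<close>

definition lasso_objective ::
  "nat \<Rightarrow> nat set \<Rightarrow> real \<Rightarrow> (nat \<Rightarrow> real) \<Rightarrow> (nat \<Rightarrow> nat \<Rightarrow> real) \<Rightarrow> (nat \<Rightarrow> real) \<Rightarrow> real" where
  "lasso_objective n I l y A b =
     (\<Sum>i<n. (y i - (\<Sum>k\<in>I. A i k * b k))\<^sup>2) / real n + 2 * l * (\<Sum>k\<in>I. \<bar>b k\<bar>)"

text \<open>The minimizer need not be unique: the Lasso and the nodewise Lasso are given by a measurable
  selection from the set of minimizers.\<close>

definition lasso_estimator ::
  "nat \<Rightarrow> nat \<Rightarrow> real \<Rightarrow> ((nat \<Rightarrow> real) \<times> (nat \<Rightarrow> nat \<Rightarrow> real) \<Rightarrow> nat \<Rightarrow> real) \<Rightarrow> bool" where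
  "lasso_estimator n p l bhat \<longleftrightarrow>
     bhat \<in> samples n p \<rightarrow>\<^sub>M vecs {..<p} \<and>
     (\<forall>(y, A) \<in> space (samples n p).
        is_arg_min (lasso_objective n {..<p} l y A) (\<lambda>b. b \<in> extensional {..<p}) (bhat (y, A)))"

definition nodewise_lasso ::
  "nat \<Rightarrow> nat \<Rightarrow> (nat \<Rightarrow> real) \<Rightarrow> (nat \<Rightarrow> (nat \<Rightarrow> nat \<Rightarrow> real) \<Rightarrow> nat \<Rightarrow> real) \<Rightarrow> bool" where
  "nodewise_lasso n p l ghat \<longleftrightarrow>
     (\<forall>j<p. ghat j \<in> designs n p \<rightarrow>\<^sub>M vecs ({..<p} - {j}) \<and>
       (\<forall>A \<in> space (designs n p).
          is_arg_min (lasso_objective n ({..<p} - {j}) (l j) (\<lambda>i. A i j) A)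
            (\<lambda>g. g \<in> extensional ({..<p} - {j})) (ghat j A)))"

definition variance_estimator ::
  "nat \<Rightarrow> nat \<Rightarrow> ((nat \<Rightarrow> real) \<times> (nat \<Rightarrow> nat \<Rightarrow> real) \<Rightarrow> real) \<Rightarrow> bool" where
  "variance_estimator n p vhat \<longleftrightarrow>
     vhat \<in> borel_measurable (samples n p) \<and> (\<forall>d \<in> space (samples n p). 0 \<le> vhat d)"

text \<open>Below, \<open>A\<close> and \<open>y\<close> are the observed design and response, \<open>l j\<close> and \<open>g j\<close> the tuning
  parameter and the solution of the \<open>j\<close>-th nodewise Lasso, \<open>b\<close> the Lasso estimate and \<open>v\<close> the
  estimate of the error variance.\<close>

definition tau2_hat ::
  "nat \<Rightarrow> nat \<Rightarrow> (nat \<Rightarrow> real) \<Rightarrow> (nat \<Rightarrow> nat \<Rightarrow> real) \<Rightarrow> (nat \<Rightarrow> nat \<Rightarrow> real) \<Rightarrow> nat \<Rightarrow> real" where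
  "tau2_hat n p l A g j =
     (\<Sum>i<n. (A i j - (\<Sum>k\<in>{..<p} - {j}. A i k * g j k))\<^sup>2) / real n
       + l j * (\<Sum>k\<in>{..<p} - {j}. \<bar>g j k\<bar>)"

definition C_hat :: "(nat \<Rightarrow> nat \<Rightarrow> real) \<Rightarrow> nat \<Rightarrow> nat \<Rightarrow> real" where
  "C_hat g j k = (if j = k then 1 else - g j k)"

definition Theta_hat ::
  "nat \<Rightarrow> nat \<Rightarrow> (nat \<Rightarrow> real) \<Rightarrow> (nat \<Rightarrow> nat \<Rightarrow> real) \<Rightarrow> (nat \<Rightarrow> nat \<Rightarrow> real) \<Rightarrow> nat \<Rightarrow> nat \<Rightarrow> real" where
  "Theta_hat n p l A g j k = C_hat g j k / tau2_hat n p l A g j"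

definition Sigma_hat :: "nat \<Rightarrow> (nat \<Rightarrow> nat \<Rightarrow> real) \<Rightarrow> nat \<Rightarrow> nat \<Rightarrow> real" where
  "Sigma_hat n A j k = (\<Sum>i<n. A i j * A i k) / real n"

definition omega_hat ::
  "nat \<Rightarrow> nat \<Rightarrow> (nat \<Rightarrow> real) \<Rightarrow> (nat \<Rightarrow> nat \<Rightarrow> real) \<Rightarrow> (nat \<Rightarrow> nat \<Rightarrow> real) \<Rightarrow> real
     \<Rightarrow> nat \<Rightarrow> nat \<Rightarrow> real" where
  "omega_hat n p l A g v j k =
     (\<Sum>a<p. \<Sum>b<p. Theta_hat n p l A g j a * Sigma_hat n A a b * Theta_hat n p l A g k b) * v"

definition desparsified_lasso ::
  "nat \<Rightarrow> nat \<Rightarrow> (nat \<Rightarrow> real) \<Rightarrow> (nat \<Rightarrow> real) \<Rightarrow> (nat \<Rightarrow> nat \<Rightarrow> real) \<Rightarrow> (nat \<Rightarrow> real)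
     \<Rightarrow> (nat \<Rightarrow> nat \<Rightarrow> real) \<Rightarrow> nat \<Rightarrow> real" where
  "desparsified_lasso n p l y A b g j =
     b j + (\<Sum>k<p. Theta_hat n p l A g j k * (\<Sum>i<n. A i k * (y i - (\<Sum>m<p. A i m * b m)))) / real n"

section \<open>Bootstrap test\<close>

definition boot_stat ::
  "nat \<Rightarrow> nat \<Rightarrow> (nat \<Rightarrow> real) \<Rightarrow> nat set \<Rightarrow> (nat \<Rightarrow> nat \<Rightarrow> real) \<Rightarrow> (nat \<Rightarrow> nat \<Rightarrow> real) \<Rightarrow> real
     \<Rightarrow> (nat \<Rightarrow> real) \<Rightarrow> real" where
  "boot_stat n p l G A g v e =
     (MAX j\<in>G. \<bar>\<Sum>i<n. (\<Sum>k<p. Theta_hat n p l A g j k * A i k) * sqrt v * e i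
                     / sqrt (real n * omega_hat n p l A g v j j)\<bar>)"

text \<open>Joint law of the multipliers \<open>e\<^sub>1, \<dots>, e\<^sub>n\<close>. Since they are independent of the data, the
  conditional law of the bootstrap statistic given the data is obtained by fixing the data and
  integrating over the multipliers alone.\<close>

definition multipliers :: "nat \<Rightarrow> (nat \<Rightarrow> real) measure" where
  "multipliers n = PiM {..<n} (\<lambda>_. density lborel std_normal_density)"

definition boot_crit ::
  "nat \<Rightarrow> nat \<Rightarrow> (nat \<Rightarrow> real) \<Rightarrow> nat set \<Rightarrow> (nat \<Rightarrow> nat \<Rightarrow> real) \<Rightarrow> (nat \<Rightarrow> nat \<Rightarrow> real) \<Rightarrow> real
     \<Rightarrow> real \<Rightarrow> real" where
  "boot_crit n p l G A g v a =
     Inf {t. measure (multipliers n)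
               {e \<in> space (multipliers n). boot_stat n p l G A g v e \<le> t} \<ge> 1 - a}"

definition test_stat ::
  "nat \<Rightarrow> nat \<Rightarrow> (nat \<Rightarrow> real) \<Rightarrow> nat set \<Rightarrow> (nat \<Rightarrow> real) \<Rightarrow> (nat \<Rightarrow> real) \<Rightarrow> (nat \<Rightarrow> nat \<Rightarrow> real)
     \<Rightarrow> (nat \<Rightarrow> real) \<Rightarrow> (nat \<Rightarrow> nat \<Rightarrow> real) \<Rightarrow> real \<Rightarrow> real" where
  "test_stat n p l G bt y A b g v =
     (MAX j\<in>G. sqrt (real n) * \<bar>desparsified_lasso n p l y A b g j - bt j\<bar>
                / sqrt (omega_hat n p l A g v j j))"

definition rejects ::
  "nat \<Rightarrow> nat \<Rightarrow> (nat \<Rightarrow> real) \<Rightarrow> nat set \<Rightarrow> (nat \<Rightarrow> real) \<Rightarrow> real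
     \<Rightarrow> ((nat \<Rightarrow> real) \<times> (nat \<Rightarrow> nat \<Rightarrow> real) \<Rightarrow> nat \<Rightarrow> real)
     \<Rightarrow> (nat \<Rightarrow> (nat \<Rightarrow> nat \<Rightarrow> real) \<Rightarrow> nat \<Rightarrow> real)
     \<Rightarrow> ((nat \<Rightarrow> real) \<times> (nat \<Rightarrow> nat \<Rightarrow> real) \<Rightarrow> real)
     \<Rightarrow> (nat \<Rightarrow> real) \<times> (nat \<Rightarrow> nat \<Rightarrow> real) \<Rightarrow> bool" where
  "rejects n p l G bt a bhat ghat vhat d \<longleftrightarrow>
     (let y = fst d; A = snd d; b = bhat d; g = (\<lambda>j. ghat j A); v = vhat d
      in test_stat n p l G bt y A b g v > boot_crit n p l G A g v a)"

text \<open>\<open>w j\<close> stands for the asymptotic variance \<open>\<omega>\<^sub>j\<^sub>j\<close>.\<close>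

definition alternatives ::
  "nat \<Rightarrow> nat \<Rightarrow> (nat \<Rightarrow> real) \<Rightarrow> nat set \<Rightarrow> (nat \<Rightarrow> real) \<Rightarrow> real \<Rightarrow> (nat \<Rightarrow> real) set" where
  "alternatives n p w G bt c =
     {\<beta> \<in> extensional {..<p}.
        (MAX j\<in>G. \<bar>\<beta> j - bt j\<bar> / sqrt (w j)) > c * sqrt (ln (real (card G)) / real n)}"

definition sparse_vectors :: "nat \<Rightarrow> nat \<Rightarrow> (nat \<Rightarrow> real) set" where
  "sparse_vectors p s = {\<beta> \<in> extensional {..<p}. card {j. j < p \<and> \<beta> j \<noteq> 0} \<le> s}"

section \<open>Assumptions\<close>

text \<open>Sequences of models are indexed by the sample size \<open>n \<ge> 1\<close>. Exponential moments are taken as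
  nonnegative integrals, so that the bounds include their finiteness.\<close>

datatype regime = Sub_Gaussian | Strongly_Bounded "nat \<Rightarrow> real"

primrec K0 :: "regime \<Rightarrow> nat \<Rightarrow> real" where
  "K0 Sub_Gaussian n = 1"
| "K0 (Strongly_Bounded K) n = K n"

primrec A1 ::
  "regime \<Rightarrow> (nat \<Rightarrow> 'a measure) \<Rightarrow> (nat \<Rightarrow> nat) \<Rightarrow> (nat \<Rightarrow> 'a \<Rightarrow> nat \<Rightarrow> nat \<Rightarrow> real) \<Rightarrow> bool" where
  "A1 Sub_Gaussian M p X \<longleftrightarrow>
     (\<exists>C>0. \<forall>n\<ge>1. \<forall>i<n. \<forall>a. L2_set a {..<p n} \<le> 1 \<longrightarrow>
        (\<integral>\<^sup>+\<omega>. ennreal (exp (\<bar>\<Sum>j<p n. a j * X n \<omega> i j\<bar>\<^sup>2 / C)) \<partial>M n) \<le> 2)"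
| "A1 (Strongly_Bounded K) M p X \<longleftrightarrow>
     (\<forall>n\<ge>1. K n \<ge> 1 \<and>
        (\<forall>j<p n.
           (\<forall>i<n. AE \<omega> in M n. \<bar>X n \<omega> i j\<bar> \<le> K n) \<and>
           (\<forall>i<n. AE \<omega> in M n. \<bar>pop_fit (M n) n (p n) (X n) j \<omega> i\<bar> \<le> K n) \<and>
           (\<integral>\<omega>. (pop_resid (M n) n (p n) (X n) j \<omega> 0) ^ 4 \<partial>M n) \<le> K n ^ 4))"

definition A2 ::
  "(nat \<Rightarrow> 'a measure) \<Rightarrow> (nat \<Rightarrow> nat) \<Rightarrow> (nat \<Rightarrow> 'a \<Rightarrow> nat \<Rightarrow> nat \<Rightarrow> real) \<Rightarrow> bool" where
  "A2 M p X \<longleftrightarrow>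
     (\<exists>c>0. \<exists>C>0. \<forall>n\<ge>1.
        c < Min (spectrum (covariance (M n) (p n) (X n))) \<and>
        (\<forall>j<p n. covariance (M n) (p n) (X n) $$ (j, j) \<le> C))"

primrec A3 ::
  "regime \<Rightarrow> (nat \<Rightarrow> 'a measure) \<Rightarrow> (nat \<Rightarrow> nat) \<Rightarrow> (nat \<Rightarrow> 'a \<Rightarrow> nat \<Rightarrow> nat \<Rightarrow> real)
     \<Rightarrow> (nat \<Rightarrow> 'a \<Rightarrow> nat \<Rightarrow> real) \<Rightarrow> (nat \<Rightarrow> real) \<Rightarrow> bool" where
  "A3 Sub_Gaussian M p X eps sig2 \<longleftrightarrow>
     (\<exists>C\<^sub>1>0. \<exists>c\<^sub>1>0. \<forall>n\<ge>1. ln (real (p n) * real n) ^ 7 / real n \<le> C\<^sub>1 * real n powr (- c\<^sub>1)) \<and>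
     (\<exists>C>0. \<forall>n\<ge>1. \<forall>i<n. (\<integral>\<^sup>+\<omega>. ennreal (exp ((eps n \<omega> i)\<^sup>2 / C)) \<partial>M n) \<le> 2) \<and>
     (\<exists>c'>0. \<exists>c>0. \<forall>n\<ge>1. c' < sig2 n \<and> sig2 n < c)"
| "A3 (Strongly_Bounded K) M p X eps sig2 \<longleftrightarrow>
     (\<exists>C\<^sub>2>0. \<exists>c\<^sub>2>0. \<forall>n\<ge>1.
        (MAX j\<in>{..<p n}. real (row_sparsity (M n) (p n) (X n) j) * (K n)\<^sup>2
            * ln (real (p n) * real n) ^ 7 / real n)
          \<le> C\<^sub>2 * real n powr (- c\<^sub>2)) \<and>
     (\<exists>C'>0. \<forall>n\<ge>1. \<forall>i<n. (\<integral>\<^sup>+\<omega>. ennreal (exp (\<bar>eps n \<omega> i\<bar> / C')) \<partial>M n) \<le> 2) \<and>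
     (\<exists>c'>0. \<exists>c>0. \<forall>n\<ge>1. c' < sig2 n \<and> sig2 n < c)"

text \<open>\<open>B n\<close> is the set of regression vectors under consideration.\<close>

definition A4 ::
  "(nat \<Rightarrow> 'a measure) \<Rightarrow> (nat \<Rightarrow> nat) \<Rightarrow> (nat \<Rightarrow> 'a \<Rightarrow> nat \<Rightarrow> nat \<Rightarrow> real)
     \<Rightarrow> (nat \<Rightarrow> 'a \<Rightarrow> nat \<Rightarrow> real) \<Rightarrow> (nat \<Rightarrow> real)
     \<Rightarrow> (nat \<Rightarrow> nat \<Rightarrow> real)
     \<Rightarrow> (nat \<Rightarrow> (nat \<Rightarrow> real) \<times> (nat \<Rightarrow> nat \<Rightarrow> real) \<Rightarrow> real)
     \<Rightarrow> (nat \<Rightarrow> (nat \<Rightarrow> real) set) \<Rightarrow> bool" where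
  "A4 M p X eps sig2 lj vhat B \<longleftrightarrow>
     (\<exists>\<alpha>. (\<forall>n\<ge>1. \<alpha> n > 0) \<and> filterlim \<alpha> at_top sequentially \<and>
        (\<lambda>n. \<alpha> n / real (p n)) \<longlonglongrightarrow> 0 \<and>
        (\<lambda>n. \<alpha> n * (ln (real (p n)))\<^sup>2
               * (MAX j\<in>{..<p n}. lj n j * sqrt (real (row_sparsity (M n) (p n) (X n) j)))) \<longlonglongrightarrow> 0 \<and>
        (\<lambda>n. SUP \<beta>\<in>B n. measure (M n)
               {\<omega> \<in> space (M n).
                  \<alpha> n * (ln (real (p n)))\<^sup>2
                    * \<bar>vhat n (data n (p n) (X n) (eps n) \<beta> \<omega>) - sig2 n\<bar> > 1}) \<longlonglongrightarrow> 0)"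

definition A5 ::
  "(nat \<Rightarrow> 'a measure) \<Rightarrow> (nat \<Rightarrow> nat) \<Rightarrow> (nat \<Rightarrow> 'a \<Rightarrow> nat \<Rightarrow> nat \<Rightarrow> real) \<Rightarrow> bool" where
  "A5 M p X \<longleftrightarrow>
     (\<exists>c>0. c < 1 \<and> (\<forall>n\<ge>1. \<forall>i<p n. \<forall>j<p n. i \<noteq> j \<longrightarrow>
        (let \<Theta> = precision (M n) (p n) (X n)
         in \<bar>\<Theta> $$ (i, j) / sqrt (\<Theta> $$ (i, i) * \<Theta> $$ (j, j))\<bar> \<le> c)))"

text \<open>\<open>a\<^sub>n\<^sub>,\<^sub>j \<asymp> r\<^sub>n\<close> uniformly in \<open>j \<in> J n\<close>, with multiplicative bounds so that \<open>r\<^sub>n = 0\<close> is meaningful.\<close>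

definition same_order :: "(nat \<Rightarrow> nat set) \<Rightarrow> (nat \<Rightarrow> nat \<Rightarrow> real) \<Rightarrow> (nat \<Rightarrow> real) \<Rightarrow> bool" where
  "same_order J a r \<longleftrightarrow>
     (\<exists>c>0. \<exists>C>0. \<forall>n\<ge>1. \<forall>j\<in>J n. c * r n \<le> a n j \<and> a n j \<le> C * r n)"

end

theory Submission
  imports Defs
begin

text \<open>
  Conditionally on the data every coordinate of the bootstrap statistic is a centred normal variable
  of variance at most 1, so a union bound gives \<open>c*(\<alpha>) \<le> sqrt (2 ln (2|G| / \<alpha>))\<close>
  for all data; no Gaussian approximation is needed. It therefore suffices that the single
  coordinate \<open>j\<close> at which the alternative attains its maximum exceeds this level.
  There the signal is at least \<open>(sqrt 2 + \<epsilon>\<^sub>0) sqrt (ln |G|)\<close>, and it dominates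
  because: the noise of the de-sparsified estimator has bounded variance given the design, so
  Chebyshev's inequality makes it \<open>o (sqrt (ln |G|))\<close>; its bias is at most
  \<open>\<lambda>\<^sub>j / \<tau>\<^sub>j\<^sup>2\<close> times the \<open>\<ell>\<^sub>1\<close> error of the Lasso, which the
  compatibility condition bounds by a multiple of \<open>\<lambda> s\<^sub>0\<close>; and
  \<open>\<omega>\<^sub>j\<^sub>j\<close> is not overestimated since, by the slow rate for the nodewise Lasso,
  \<open>\<tau>\<^sub>j\<^sup>2\<close> is asymptotically at least \<open>1 / \<theta>\<^sub>j\<^sub>j\<close>. All other concentration
  comes from Bernstein's inequality for products of two entries of a row, or of a row and its error.
\<close>

section \<open>Quadratic forms\<close>

text \<open>The factor sqrt 2 in the alternative is the growth rate of the union-bound quantile: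
  sqrt (2 ln (2|G| / a)) is sqrt 2 sqrt (ln |G|) up to a bounded term. So the surplus
  \<open>\<epsilon>\<^sub>0\<close> alone pays for noise, bias and estimation of the scale; being
  multiplied by a diverging sequence, it tolerates crude constants. Only an upper bound on the
  estimated scale matters, hence only a lower bound on tau_j^2. The slow rate gives it from lambda_j
  sqrt s_j -> 0, which (A4) contains, without a compatibility condition for the nodewise
  regressions. The decisive coordinate j varies with n and beta^0, so all estimates are made for an
  arbitrary j, with constants independent of it. One threshold t serves all averages, and all tuning
  parameters equal 2t, so that noise stays below half the penalty level. For bounded designs the
  Bernstein parameters scale as h0 / K^2 and V0 K^2; their product is free of K, and t proportional
  to K sqrt (ln p / n) makes the exponent free of K as well. The rejection probability is bounded
  below by inclusion of events, so the rejection region has to be measurable.\<close>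

definition quad_form :: "nat \<Rightarrow> (nat \<Rightarrow> nat \<Rightarrow> real) \<Rightarrow> (nat \<Rightarrow> real) \<Rightarrow> real" where
  "quad_form p S x = (\<Sum>j<p. \<Sum>k<p. x j * S j k * x k)"

lemma sum_delta_mult:
  fixes f :: "nat \<Rightarrow> real"
  assumes "i < p"
  shows "(\<Sum>j<p. (if j = i then 1 else 0) * f j) = f i"
    and "(\<Sum>j<p. f j * (if j = i then 1 else 0)) = f i"
proof -
  have "(if j = i then 1 else 0) * f j = (if j = i then f j else 0)"
    "f j * (if j = i then 1 else 0) = (if j = i then f j else 0)" for j by auto
  then show "(\<Sum>j<p. (if j = i then 1 else 0) * f j) = f i"
    and "(\<Sum>j<p. f j * (if j = i then 1 else 0)) = f i"
    using assms by simp_all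
qed

lemma quad_form_add:
  assumes "\<And>j k. j < p \<Longrightarrow> k < p \<Longrightarrow> S j k = S k j"
  shows "quad_form p S (\<lambda>k. x k + t * y k) =
    quad_form p S x + 2 * t * (\<Sum>j<p. y j * (\<Sum>k<p. S j k * x k)) + t\<^sup>2 * quad_form p S y"
proof -
  have *: "(\<Sum>j<p. \<Sum>k<p. x j * S j k * y k) = (\<Sum>j<p. \<Sum>k<p. y j * S j k * x k)"
    by (subst sum.swap) (auto intro!: sum.cong simp: assms mult_ac)
  have "quad_form p S (\<lambda>k. x k + t * y k) = quad_form p S x
     + t * (\<Sum>j<p. \<Sum>k<p. x j * S j k * y k) + t * (\<Sum>j<p. \<Sum>k<p. y j * S j k * x k)
     + t\<^sup>2 * quad_form p S y"
    unfolding quad_form_def sum_distrib_left sum.distrib[symmetric]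
    by (intro sum.cong refl) (simp add: algebra_simps power2_eq_square)
  then show ?thesis
    unfolding * by (simp add: sum_distrib_left mult_ac)
qed

text \<open>First-order condition at an interior minimum: for small t of sign opposite to b the
  linear term outweighs the quadratic one.\<close>

lemma quadratic_nonneg_imp_linear_zero:
  fixes b c :: real
  assumes "\<And>t. 0 \<le> 2 * t * b + t\<^sup>2 * c"
  shows "b = 0"
proof (rule ccontr)
  assume b: "b \<noteq> 0"
  define t where "t = - b / (\<bar>c\<bar> + 1)"
  have "2 * t * b + t\<^sup>2 * c \<le> 2 * t * b + t\<^sup>2 * (\<bar>c\<bar> + 1)"
    by (intro add_left_mono mult_left_mono) auto
  also have "\<dots> = - b\<^sup>2 / (\<bar>c\<bar> + 1)"
  proof -
    have "\<bar>c\<bar> + 1 \<noteq> 0" by simp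
    then show ?thesis unfolding t_def by (simp add: divide_simps) (simp add: algebra_simps power2_eq_square)
  qed
  also have "\<dots> < 0"
    using b by (intro divide_neg_pos) auto
  finally show False using assms[of t] by simp
qed

text \<open>A zero of a nonnegative form is a minimum, so its derivative 2 (S x)_i in every
  coordinate direction vanishes.\<close>

lemma quad_form_zero_imp_kernel:
  assumes sym: "\<And>j k. j < p \<Longrightarrow> k < p \<Longrightarrow> S j k = S k j"
    and nonneg: "\<And>y. 0 \<le> quad_form p S y"
    and zero: "quad_form p S x = 0" and i: "i < p"
  shows "(\<Sum>k<p. S i k * x k) = 0"
proof (rule quadratic_nonneg_imp_linear_zero)
  fix t
  let ?e = "\<lambda>k. if k = i then 1 else (0::real)"
  have "0 \<le> quad_form p S (\<lambda>k. x k + t * ?e k)" by (rule nonneg)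
  also have "\<dots> = 2 * t * (\<Sum>k<p. S i k * x k) + t\<^sup>2 * quad_form p S ?e"
    by (subst quad_form_add[OF sym]) (simp_all only: zero sum_delta_mult(1)[OF i] add_0_left)
  finally show "0 \<le> 2 * t * (\<Sum>k<p. S i k * x k) + t\<^sup>2 * quad_form p S ?e" .
qed

lemma sphere_quad_form_attains_min:
  assumes p: "p \<ge> 1"
  shows "\<exists>x. (\<Sum>k<p. (x k)\<^sup>2) = 1 \<and>
    (\<forall>y. (\<Sum>k<p. (y k)\<^sup>2) = 1 \<longrightarrow> quad_form p S x \<le> quad_form p S y)"
proof -
  \<comment> \<open>Vectors are functions on all natural numbers; freezing the coordinates from p on
    at 0 makes the box compact in the product topology by Tychonoff's theorem.\<close>
  define B where "B = PiE UNIV (\<lambda>i::nat. if i < p then {-1..1} else {0::real})"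
  define K where "K = B \<inter> {x. (\<Sum>k<p. (x k)\<^sup>2) = 1}"
  have "compact B"
  proof -
    have "compactin (product_topology (\<lambda>i::nat. euclidean :: real topology) UNIV) B"
      unfolding B_def compactin_PiE by auto
    then show ?thesis by (simp add: euclidean_product_topology)
  qed
  moreover have "closed {x::nat \<Rightarrow> real. (\<Sum>k<p. (x k)\<^sup>2) = 1}"
    by (intro closed_Collect_eq continuous_intros) (auto simp: continuous_on_product_coordinates)
  ultimately have "compact K"
    unfolding K_def by (rule compact_Int_closed)
  moreover have "(\<lambda>k. if k = 0 then 1 else 0) \<in> K"
    using p sum_delta_mult(1)[of 0 p "\<lambda>_. 1"] by (auto simp: K_def B_def if_distrib[of "\<lambda>x. x\<^sup>2"] cong: if_cong)
  moreover have "continuous_on K (quad_form p S)"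
    unfolding quad_form_def by (intro continuous_intros continuous_on_product_coordinates
        continuous_on_subset[OF continuous_on_product_coordinates]) auto
  ultimately obtain x where x: "x \<in> K" "\<And>y. y \<in> K \<Longrightarrow> quad_form p S x \<le> quad_form p S y"
    using continuous_attains_inf[of K "quad_form p S"] by blast
  have "quad_form p S x \<le> quad_form p S y" if y: "(\<Sum>k<p. (y k)\<^sup>2) = 1" for y
  proof -
    let ?y = "\<lambda>k. if k < p then y k else 0"
    have "\<bar>y k\<bar> \<le> 1" if "k < p" for k
    proof -
      have "(y k)\<^sup>2 \<le> (\<Sum>k<p. (y k)\<^sup>2)"
        using that by (intro member_le_sum) auto
      then show ?thesis using y by (simp add: abs_square_le_1)
    qed
    then have "?y \<in> K"
      using y by (auto simp: K_def B_def abs_le_iff minus_le_iff)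
    then have "quad_form p S x \<le> quad_form p S ?y" by (rule x)
    also have "\<dots> = quad_form p S y" unfolding quad_form_def by (intro sum.cong) auto
    finally show ?thesis .
  qed
  with x(1) show ?thesis by (auto simp: K_def)
qed

lemma quad_form_diff_diag:
  "quad_form p (\<lambda>j k. S j k - (if j = k then m else 0)) x = quad_form p S x - m * (\<Sum>k<p. (x k)\<^sup>2)"
proof -
  have "quad_form p (\<lambda>j k. S j k - (if j = k then m else 0)) x =
      (\<Sum>j<p. \<Sum>k<p. x j * S j k * x k - (if j = k then m * (x k)\<^sup>2 else 0))"
    unfolding quad_form_def by (intro sum.cong refl) (simp add: algebra_simps power2_eq_square)
  then show ?thesis
    by (simp add: quad_form_def sum_subtractf sum_distrib_left)
qed

lemma quad_form_scale: "quad_form p S (\<lambda>k. a * x k) = a\<^sup>2 * quad_form p S x"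
  by (simp add: quad_form_def sum_distrib_left power2_eq_square mult_ac)

text \<open>The minimum of the Rayleigh quotient is an eigenvalue.\<close>

lemma Min_spectrum_le_quad_form:
  fixes A :: "real mat"
  assumes A: "A \<in> carrier_mat p p" and p: "p \<ge> 1"
    and sym: "\<And>j k. j < p \<Longrightarrow> k < p \<Longrightarrow> A $$ (j, k) = A $$ (k, j)"
  shows "Min (spectrum A) * (\<Sum>k<p. (x k)\<^sup>2) \<le> quad_form p (\<lambda>j k. A $$ (j, k)) x"
proof -
  let ?S = "\<lambda>j k. A $$ (j, k)"
  obtain v where v1: "(\<Sum>k<p. (v k)\<^sup>2) = 1"
    and vmin: "\<And>y. (\<Sum>k<p. (y k)\<^sup>2) = 1 \<Longrightarrow> quad_form p ?S v \<le> quad_form p ?S y"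
    using sphere_quad_form_attains_min[OF p] by blast
  define m where "m = quad_form p ?S v"
  let ?T = "\<lambda>j k. A $$ (j, k) - (if j = k then m else 0)"
  have *: "m * (\<Sum>k<p. (y k)\<^sup>2) \<le> quad_form p ?S y" for y
  proof (cases "(\<Sum>k<p. (y k)\<^sup>2) = 0")
    case True
    then have "\<forall>k<p. y k = 0" by (auto simp: sum_nonneg_eq_0_iff)
    then have "quad_form p ?S y = 0" by (simp add: quad_form_def)
    then show ?thesis using True by simp
  next
    case False
    define r where "r = (\<Sum>k<p. (y k)\<^sup>2)"
    have r: "r > 0" using False by (simp add: r_def sum_nonneg less_le)
    have "(\<Sum>k<p. (1 / sqrt r * y k)\<^sup>2) = (1 / sqrt r)\<^sup>2 * r"
      unfolding power_mult_distrib sum_distrib_left[symmetric] r_def ..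
    also have "\<dots> = 1" using r by (simp add: power_divide)
    finally have "m \<le> quad_form p ?S (\<lambda>k. 1 / sqrt r * y k)"
      unfolding m_def by (rule vmin)
    also have "\<dots> = quad_form p ?S y / r"
      unfolding quad_form_scale using r by (simp add: power_divide)
    finally show ?thesis using r by (simp add: field_simps r_def[symmetric])
  qed
  \<comment> \<open>The form of A - m I is nonnegative and vanishes at the minimiser v, so v lies in
    its kernel and is an eigenvector for m.\<close>
  have ker: "(\<Sum>k<p. ?T i k * v k) = 0" if "i < p" for i
  proof (rule quad_form_zero_imp_kernel[where p = p])
    show "0 \<le> quad_form p ?T y" for y
      unfolding quad_form_diff_diag using *[of y] by simp
    show "quad_form p ?T v = 0" unfolding quad_form_diff_diag v1 by (simp add: m_def)
  qed (use sym that in auto)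
  have Av: "(\<Sum>k<p. A $$ (i, k) * v k) = m * v i" if "i < p" for i
  proof -
    have "(\<Sum>k<p. ?T i k * v k) = (\<Sum>k<p. A $$ (i, k) * v k - (if i = k then m * v k else 0))"
      by (intro sum.cong) (auto simp: algebra_simps)
    then show ?thesis using ker[OF that] that by (simp add: sum_subtractf)
  qed
  have "eigenvector A (Matrix.vec p v) m"
    unfolding eigenvector_def
  proof (intro conjI)
    show "Matrix.vec p v \<in> carrier_vec (dim_row A)" using A by auto
    show "Matrix.vec p v \<noteq> 0\<^sub>v (dim_row A)"
    proof
      assume "Matrix.vec p v = 0\<^sub>v (dim_row A)"
      then have "\<forall>k<p. v k = 0" using A
        by (metis carrier_matD(1) index_vec index_zero_vec(1))
      then show False using v1 by simp
    qed
    show "A *\<^sub>v Matrix.vec p v = m \<cdot>\<^sub>v Matrix.vec p v"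
      using A Av by (intro eq_vecI) (auto simp: scalar_prod_def row_def atLeast0LessThan)
  qed
  then have "m \<in> spectrum A" by (auto simp: spectrum_def eigenvalue_def)
  then have "Min (spectrum A) \<le> m"
    using card_finite_spectrum[OF A] by (intro Min_le) auto
  then have "Min (spectrum A) * (\<Sum>k<p. (x k)\<^sup>2) \<le> m * (\<Sum>k<p. (x k)\<^sup>2)"
    by (intro mult_right_mono sum_nonneg) auto
  with *[of x] show ?thesis by simp
qed

text \<open>A definite matrix has trivial kernel, hence nonzero determinant, so
  \<open>mat_inverse\<close> does return a matrix and \<open>the\<close> is meaningful.\<close>

lemma mat_inverse_of_definite:
  fixes A :: "real mat"
  assumes A: "A \<in> carrier_mat p p" and c: "c > 0"
    and pd: "\<And>x. c * (\<Sum>k<p. (x k)\<^sup>2) \<le> quad_form p (\<lambda>j k. A $$ (j, k)) x"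
    and jk: "j < p" "k < p"
  shows "(\<Sum>l<p. the (mat_inverse A) $$ (j, l) * A $$ (l, k)) = (if j = k then 1 else 0)"
proof -
  have "Determinant.det A \<noteq> 0"
  proof
    assume "Determinant.det A = 0"
    then obtain v where v: "v \<in> carrier_vec p" "v \<noteq> 0\<^sub>v p" "A *\<^sub>v v = 0\<^sub>v p"
      using det_0_iff_vec_prod_zero_field[OF A] by auto
    have "(\<Sum>k<p. A $$ (i, k) * v $ k) = 0" if "i < p" for i
    proof -
      have "(A *\<^sub>v v) $ i = 0" using v that by simp
      then show ?thesis using v(1) A that by (simp add: scalar_prod_def atLeast0LessThan)
    qed
    then have "quad_form p (\<lambda>j k. A $$ (j, k)) (\<lambda>k. v $ k) = 0"
      by (simp add: quad_form_def mult.assoc sum_distrib_left[symmetric])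
    then have "c * (\<Sum>k<p. (v $ k)\<^sup>2) \<le> 0" using pd[of "\<lambda>k. v $ k"] by simp
    then have "(\<Sum>k<p. (v $ k)\<^sup>2) = 0"
      using c by (simp add: mult_le_0_iff antisym sum_nonneg)
    then have "\<forall>k<p. v $ k = 0" by (auto simp: sum_nonneg_eq_0_iff)
    then have "v = 0\<^sub>v p" using v(1) by (intro eq_vecI) auto
    then show False using v by simp
  qed
  then have "A \<in> Units (ring_mat TYPE(real) p undefined)"
    by (rule det_non_zero_imp_unit[OF A])
  then obtain B where B: "mat_inverse A = Some B"
    using mat_inverse(1)[OF A, of undefined] by (cases "mat_inverse A") auto
  from mat_inverse(2)[OF A B] have BA: "B * A = 1\<^sub>m p" "B \<in> carrier_mat p p" by auto
  have "(B * A) $$ (j, k) = (\<Sum>l<p. B $$ (j, l) * A $$ (l, k))"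
    using BA(2) A jk by (simp add: scalar_prod_def atLeast0LessThan)
  then show ?thesis using BA(1) jk B by simp
qed

text \<open>\<open>t\<close> is the \<open>j\<close>-th row of the inverse of \<open>S\<close>; after normalisation of its \<open>j\<close>-th entry to 1 it
  minimises the quadratic form among the vectors with \<open>j\<close>-th entry 1.\<close>

locale inverse_row =
  fixes p j :: nat and S :: "nat \<Rightarrow> nat \<Rightarrow> real" and t :: "nat \<Rightarrow> real" and c :: real
  assumes sym: "\<And>j k. j < p \<Longrightarrow> k < p \<Longrightarrow> S j k = S k j"
    and j: "j < p" and c: "c > 0"
    and pd: "\<And>x. c * (\<Sum>k<p. (x k)\<^sup>2) \<le> quad_form p S x"
    and inv: "\<And>k. k < p \<Longrightarrow> (\<Sum>l<p. t l * S l k) = (if j = k then 1 else 0)"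
begin

text \<open>When S is Sigma and t the j-th row of Theta, these are the coefficients of the
  population residual eta_j: 1 at j and -gamma_j elsewhere.\<close>

definition u :: "nat \<Rightarrow> real" where "u k = t k / t j"

lemma quad_form_row: "quad_form p S t = t j"
proof -
  have "quad_form p S t = (\<Sum>k<p. (\<Sum>l<p. t l * S l k) * t k)"
    unfolding quad_form_def by (subst sum.swap) (simp add: sum_distrib_right)
  also have "\<dots> = (\<Sum>k<p. (if j = k then t k else 0))" by (intro sum.cong) (auto simp: inv)
  also have "\<dots> = t j" using j by simp
  finally show ?thesis .
qed

lemma diag_pos: "t j > 0"
proof -
  have "0 \<le> c * (\<Sum>k<p. (t k)\<^sup>2)" using c by (simp add: sum_nonneg)
  then have "t j \<ge> 0" using pd[of t] quad_form_row by simp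
  moreover have "t j \<noteq> 0"
  proof
    assume "t j = 0"
    then have "c * (\<Sum>k<p. (t k)\<^sup>2) \<le> 0" using pd[of t] quad_form_row by simp
    then have "(\<Sum>k<p. (t k)\<^sup>2) = 0" using c by (simp add: mult_le_0_iff antisym sum_nonneg)
    then have "\<forall>k<p. t k = 0" by (auto simp: sum_nonneg_eq_0_iff)
    then show False using inv[OF j] by simp
  qed
  ultimately show ?thesis by simp
qed

lemma u_j: "u j = 1" using diag_pos by (simp add: u_def)

lemma u_S: "k < p \<Longrightarrow> (\<Sum>l<p. u l * S l k) = (if j = k then 1 / t j else 0)"
  using inv[of k] by (simp add: u_def sum_divide_distrib[symmetric])

lemma S_u: "k < p \<Longrightarrow> (\<Sum>l<p. S k l * u l) = (if j = k then 1 / t j else 0)"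
proof -
  assume k: "k < p"
  have "(\<Sum>l<p. S k l * u l) = (\<Sum>l<p. u l * S l k)"
    by (intro sum.cong refl) (use sym k in \<open>simp add: mult.commute\<close>)
  with u_S[OF k] show ?thesis by simp
qed

lemma quad_form_u: "quad_form p S u = 1 / t j"
proof -
  have "quad_form p S u = quad_form p S (\<lambda>k. (1 / t j) * t k)" by (simp add: u_def[abs_def])
  then show ?thesis
    unfolding quad_form_scale quad_form_row using diag_pos by (simp add: power2_eq_square)
qed

text \<open>Pythagoras: S u is a multiple of the j-th unit vector and y - u vanishes at j, so the
  cross term is zero. Any linear prediction of column j thus has residual variance 1 / theta_jj plus
  the form of its coefficient error.\<close>

lemma quad_form_decomp:
  assumes "y j = 1"
  shows "quad_form p S y = 1 / t j + quad_form p S (\<lambda>k. y k - u k)"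
proof -
  have "quad_form p S y = quad_form p S (\<lambda>k. u k + 1 * (y k - u k))" by simp
  also have "\<dots> = quad_form p S u + 2 * (\<Sum>i<p. (y i - u i) * (\<Sum>k<p. S i k * u k))
      + quad_form p S (\<lambda>k. y k - u k)"
    by (subst quad_form_add[OF sym]) simp_all
  also have "(\<Sum>i<p. (y i - u i) * (\<Sum>k<p. S i k * u k)) = 0"
    by (intro sum.neutral) (auto simp: S_u assms u_j)
  finally show ?thesis by (simp add: quad_form_u)
qed

text \<open>Compares u with the j-th unit vector, that is, with the prediction of column j by
  0.\<close>

lemma inverse_diag_le: "1 / t j \<le> S j j"
proof -
  let ?y = "\<lambda>k. if k = j then 1 else (0::real)"
  have "0 \<le> c * (\<Sum>k<p. (?y k - u k)\<^sup>2)" using c by (simp add: sum_nonneg)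
  then have "1 / t j \<le> quad_form p S ?y"
    using quad_form_decomp[of ?y] pd[of "\<lambda>k. ?y k - u k"] by simp
  also have "quad_form p S ?y = S j j"
    unfolding quad_form_def by (simp only: sum_delta_mult[OF j])
  finally show ?thesis .
qed

lemma sum_u_le: "c * (\<Sum>k<p. (u k)\<^sup>2) \<le> 1 / t j"
  using pd[of u] quad_form_u by simp

lemma diag_le: "c \<le> 1 / t j"
proof -
  have "1 \<le> (\<Sum>k<p. (u k)\<^sup>2)"
    using member_le_sum[of j "{..<p}" "\<lambda>k. (u k)\<^sup>2"] j u_j by simp
  then have "c \<le> c * (\<Sum>k<p. (u k)\<^sup>2)" using c by simp
  then show ?thesis using sum_u_le by simp
qed

end

section \<open>Deterministic analysis of the Lasso\<close>

text \<open>One-sided version for a nonsmooth penalty: the l1 norm is only directionally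
  differentiable, and along the direction -b it shrinks linearly only up to t = 1.\<close>

lemma linear_plus_quadratic_nonneg:
  fixes b c :: real
  assumes "\<And>t. 0 < t \<Longrightarrow> t \<le> 1 \<Longrightarrow> 0 \<le> 2 * t * b + t\<^sup>2 * c"
  shows "0 \<le> b"
proof (rule ccontr)
  assume b: "\<not> 0 \<le> b"
  define t where "t = - b / (\<bar>c\<bar> + \<bar>b\<bar> + 1)"
  have t: "0 < t" "t \<le> 1" using b by (auto simp: t_def divide_simps)
  have "t * (\<bar>c\<bar> + \<bar>b\<bar> + 1) = - b"
    unfolding t_def by (simp add: add_nonneg_eq_0_iff)
  then have "t * c \<le> - b"
    using mult_left_mono[of c "\<bar>c\<bar> + \<bar>b\<bar> + 1" t] t by simp
  then have "t * (2 * b + t * c) < 0" using t b by (intro mult_pos_neg) auto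
  then show False using assms[OF t] by (simp add: power2_eq_square algebra_simps)
qed

lemma sum_power2_diff:
  fixes f g :: "nat \<Rightarrow> real"
  shows "(\<Sum>i\<in>J. (f i - t * g i)\<^sup>2) =
    (\<Sum>i\<in>J. (f i)\<^sup>2) - 2 * t * (\<Sum>i\<in>J. f i * g i) + t\<^sup>2 * (\<Sum>i\<in>J. (g i)\<^sup>2)"
  unfolding sum_distrib_left sum_subtractf[symmetric] sum.distrib[symmetric]
  by (intro sum.cong refl) (simp add: power2_eq_square algebra_simps)

section \<open>Optimality conditions of the Lasso\<close>

locale lasso_solution =
  fixes n :: nat and I :: "nat set" and l :: real and y :: "nat \<Rightarrow> real"
    and A :: "nat \<Rightarrow> nat \<Rightarrow> real" and b :: "nat \<Rightarrow> real"
  assumes fin: "finite I" and l: "l \<ge> 0"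
    and min: "is_arg_min (lasso_objective n I l y A) (\<lambda>b. b \<in> extensional I) b"
begin

definition "r i = y i - (\<Sum>k\<in>I. A i k * b k)"

lemma objective_le: "lasso_objective n I l y A b \<le> lasso_objective n I l y A b'"
proof -
  have "lasso_objective n I l y A b \<le> lasso_objective n I l y A (restrict b' I)"
    using min unfolding is_arg_min_linorder by auto
  also have "\<dots> = lasso_objective n I l y A b'"
    unfolding lasso_objective_def by simp
  finally show ?thesis .
qed

text \<open>First-order condition without subgradients: along d the quadratic part has slope -2
  times the left-hand side and the penalty at most 2 l D, while at a minimiser the total slope
  cannot be negative.\<close>

lemma directional_derivative_nonneg:
  assumes d: "\<And>t. 0 < t \<Longrightarrow> t \<le> 1 \<Longrightarrow> (\<Sum>k\<in>I. \<bar>b k + t * d k\<bar>) \<le> (\<Sum>k\<in>I. \<bar>b k\<bar>) + t * D"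
  shows "(\<Sum>i<n. r i * (\<Sum>k\<in>I. A i k * d k)) / n \<le> l * D"
proof -
  let ?Ad = "\<lambda>i. \<Sum>k\<in>I. A i k * d k"
  have "0 \<le> - ((\<Sum>i<n. r i * ?Ad i) / n) + l * D"
  proof (rule linear_plus_quadratic_nonneg)
    fix t :: real assume t: "0 < t" "t \<le> 1"
    have "lasso_objective n I l y A (\<lambda>k. b k + t * d k) =
       (\<Sum>i<n. (r i - t * ?Ad i)\<^sup>2) / n + 2 * l * (\<Sum>k\<in>I. \<bar>b k + t * d k\<bar>)"
      unfolding lasso_objective_def r_def
      by (simp add: algebra_simps sum.distrib sum_distrib_left)
    also have "(\<Sum>i<n. (r i - t * ?Ad i)\<^sup>2) =
        (\<Sum>i<n. (r i)\<^sup>2) - 2 * t * (\<Sum>i<n. r i * ?Ad i) + t\<^sup>2 * (\<Sum>i<n. (?Ad i)\<^sup>2)"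
      by (rule sum_power2_diff)
    also have "2 * l * (\<Sum>k\<in>I. \<bar>b k + t * d k\<bar>) \<le> 2 * l * ((\<Sum>k\<in>I. \<bar>b k\<bar>) + t * D)"
      using d[OF t] l by (intro mult_left_mono) auto
    finally have "lasso_objective n I l y A (\<lambda>k. b k + t * d k) \<le>
       ((\<Sum>i<n. (r i)\<^sup>2) - 2 * t * (\<Sum>i<n. r i * ?Ad i) + t\<^sup>2 * (\<Sum>i<n. (?Ad i)\<^sup>2)) / n
       + 2 * l * ((\<Sum>k\<in>I. \<bar>b k\<bar>) + t * D)" by simp
    moreover have "lasso_objective n I l y A b = (\<Sum>i<n. (r i)\<^sup>2) / n + 2 * l * (\<Sum>k\<in>I. \<bar>b k\<bar>)"
      by (simp add: lasso_objective_def r_def)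
    ultimately have "(\<Sum>i<n. (r i)\<^sup>2) / n + 2 * l * (\<Sum>k\<in>I. \<bar>b k\<bar>) \<le>
       ((\<Sum>i<n. (r i)\<^sup>2) - 2 * t * (\<Sum>i<n. r i * ?Ad i) + t\<^sup>2 * (\<Sum>i<n. (?Ad i)\<^sup>2)) / n
       + 2 * l * ((\<Sum>k\<in>I. \<bar>b k\<bar>) + t * D)"
      using objective_le[of "\<lambda>k. b k + t * d k"] by simp
    then show "0 \<le> 2 * t * (- ((\<Sum>i<n. r i * ?Ad i) / n) + l * D)
        + t\<^sup>2 * ((\<Sum>i<n. (?Ad i)\<^sup>2) / n)"
      by (simp add: add_divide_distrib diff_divide_distrib algebra_simps)
  qed
  then show ?thesis by simp
qed

text \<open>Moving along plus or minus the k-th unit vector changes the l1 norm with slope at most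
  1.\<close>

lemma kkt:
  assumes k: "k \<in> I"
  shows "\<bar>(\<Sum>i<n. r i * A i k) / n\<bar> \<le> l"
proof -
  have *: "(\<Sum>m\<in>I. A i m * (if m = k then s else 0)) = A i k * s" for i and s :: real
    using k fin by (simp add: if_distrib cong: if_cong)
  have **: "(\<Sum>m\<in>I. \<bar>b m + t * (if m = k then s else 0)\<bar>) \<le> (\<Sum>m\<in>I. \<bar>b m\<bar>) + t * 1"
    if "\<bar>s\<bar> = 1" "0 < t" for s t :: real
  proof -
    have "(\<Sum>m\<in>I. \<bar>b m + t * (if m = k then s else 0)\<bar>) \<le> (\<Sum>m\<in>I. \<bar>b m\<bar> + (if m = k then t else 0))"
      using that by (intro sum_mono) (auto simp: abs_if split: if_splits)
    also have "\<dots> = (\<Sum>m\<in>I. \<bar>b m\<bar>) + t * 1" using k fin by (simp add: sum.distrib)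
    finally show ?thesis .
  qed
  have "(\<Sum>i<n. r i * (A i k * s)) / n \<le> l" if "\<bar>s\<bar> = 1" for s :: real
    using directional_derivative_nonneg[of "\<lambda>m. if m = k then s else 0" 1] **[OF that]
    unfolding * by simp
  from this[of 1] this[of "-1"] show ?thesis by (simp add: sum_negf abs_le_iff)
qed

text \<open>Rescaling b itself: the directions b and -b have l1 slopes that are exact negatives of
  each other, so the two first-order conditions combine to an equality.\<close>

lemma residual_fit: "(\<Sum>i<n. r i * (\<Sum>k\<in>I. A i k * b k)) / n = l * (\<Sum>k\<in>I. \<bar>b k\<bar>)"
proof (rule antisym)
  have "(\<Sum>k\<in>I. \<bar>b k + t * b k\<bar>) \<le> (\<Sum>k\<in>I. \<bar>b k\<bar>) + t * (\<Sum>k\<in>I. \<bar>b k\<bar>)" if "0 < t" for t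
    using that unfolding sum_distrib_left sum.distrib[symmetric]
    by (intro sum_mono) (metis abs_triangle_ineq abs_mult abs_of_pos)
  then show "(\<Sum>i<n. r i * (\<Sum>k\<in>I. A i k * b k)) / n \<le> l * (\<Sum>k\<in>I. \<bar>b k\<bar>)"
    by (intro directional_derivative_nonneg) auto
  have "(\<Sum>k\<in>I. \<bar>b k + t * - b k\<bar>) \<le> (\<Sum>k\<in>I. \<bar>b k\<bar>) + t * - (\<Sum>k\<in>I. \<bar>b k\<bar>)"
    if "0 < t" "t \<le> 1" for t
  proof -
    have "\<bar>b k + t * - b k\<bar> = \<bar>b k\<bar> + t * - \<bar>b k\<bar>" for k
    proof -
      have "b k + t * - b k = (1 - t) * b k" by (simp add: algebra_simps)
      then have "\<bar>b k + t * - b k\<bar> = (1 - t) * \<bar>b k\<bar>" using that by (simp add: abs_mult)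
      also have "\<dots> = \<bar>b k\<bar> + t * - \<bar>b k\<bar>" by (simp add: algebra_simps)
      finally show ?thesis .
    qed
    then show ?thesis by (simp add: sum.distrib sum_negf sum_distrib_left sum_subtractf)
  qed
  then have "(\<Sum>i<n. r i * (\<Sum>k\<in>I. A i k * - b k)) / n \<le> l * - (\<Sum>k\<in>I. \<bar>b k\<bar>)"
    by (rule directional_derivative_nonneg)
  then show "l * (\<Sum>k\<in>I. \<bar>b k\<bar>) \<le> (\<Sum>i<n. r i * (\<Sum>k\<in>I. A i k * b k)) / n"
    by (simp add: sum_negf)
qed

end

text \<open>Used twice: for the response, with the true regression vector and the errors, and for
  column j, with coefficients \<open>- u\<close> and the population residual as noise. Noise at
  level l / 2 leaves half of the penalty to control the estimation error.\<close>

locale lasso_model = lasso_solution +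
  fixes \<beta> e :: "nat \<Rightarrow> real"
  assumes y: "\<And>i. i < n \<Longrightarrow> y i = (\<Sum>k\<in>I. A i k * \<beta> k) + e i"
    and noise: "\<And>k. k \<in> I \<Longrightarrow> \<bar>(\<Sum>i<n. e i * A i k) / n\<bar> \<le> l / 2"
begin

definition "d k = b k - \<beta> k"
definition "Ad i = (\<Sum>k\<in>I. A i k * d k)"

lemma residual_eq: "i < n \<Longrightarrow> r i = e i - Ad i"
  by (simp add: r_def y Ad_def d_def algebra_simps sum_subtractf)

lemma noise_inner: "(\<Sum>i<n. e i * Ad i) / n \<le> l / 2 * (\<Sum>k\<in>I. \<bar>d k\<bar>)"
proof -
  have "(\<Sum>i<n. e i * Ad i) / n = (\<Sum>k\<in>I. (\<Sum>i<n. e i * A i k) / n * d k)"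
    unfolding Ad_def sum_distrib_left sum_distrib_right sum_divide_distrib
    by (subst sum.swap) (simp add: mult_ac)
  also have "\<dots> \<le> \<bar>\<dots>\<bar>" by (rule abs_ge_self)
  also have "\<dots> \<le> (\<Sum>k\<in>I. \<bar>(\<Sum>i<n. e i * A i k) / n * d k\<bar>)" by (rule sum_abs)
  also have "\<dots> \<le> (\<Sum>k\<in>I. l / 2 * \<bar>d k\<bar>)"
    using noise unfolding abs_mult by (intro sum_mono mult_right_mono) auto
  finally show ?thesis by (simp add: sum_distrib_left)
qed

text \<open>Compares the objective at the minimiser with that at the true vector; the noise enters
  only through twice the inner product in \<open>noise_inner\<close>.\<close>

lemma basic_inequality:
  "(\<Sum>i<n. (Ad i)\<^sup>2) / n + 2 * l * (\<Sum>k\<in>I. \<bar>b k\<bar>)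
     \<le> l * (\<Sum>k\<in>I. \<bar>d k\<bar>) + 2 * l * (\<Sum>k\<in>I. \<bar>\<beta> k\<bar>)"
proof -
  have "(\<Sum>i<n. (r i)\<^sup>2) = (\<Sum>i<n. (e i - Ad i)\<^sup>2)"
    by (intro sum.cong) (auto simp: residual_eq)
  also have "\<dots> = (\<Sum>i<n. (e i)\<^sup>2) - 2 * (\<Sum>i<n. e i * Ad i) + (\<Sum>i<n. (Ad i)\<^sup>2)"
    using sum_power2_diff[of e 1 Ad "{..<n}"] by simp
  finally have "(\<Sum>i<n. (r i)\<^sup>2) / n =
      (\<Sum>i<n. (e i)\<^sup>2) / n - 2 * ((\<Sum>i<n. e i * Ad i) / n) + (\<Sum>i<n. (Ad i)\<^sup>2) / n"
    by (simp add: add_divide_distrib diff_divide_distrib)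
  moreover have "lasso_objective n I l y A b = (\<Sum>i<n. (r i)\<^sup>2) / n + 2 * l * (\<Sum>k\<in>I. \<bar>b k\<bar>)"
    by (simp add: lasso_objective_def r_def)
  moreover have "lasso_objective n I l y A \<beta> = (\<Sum>i<n. (e i)\<^sup>2) / n + 2 * l * (\<Sum>k\<in>I. \<bar>\<beta> k\<bar>)"
    by (simp add: lasso_objective_def y)
  ultimately show ?thesis
    using objective_le[of \<beta>] noise_inner by linarith
qed

text \<open>The basic inequality and the triangle inequality bound the l1 error by four times the l1
  norm of the true vector, so fitting the noise lowers the residual sum of squares by little. No
  eigenvalue or compatibility bound enters; for the nodewise Lasso this is what bounds tau_j^2 from
  below.\<close>

lemma slow_rate:
  assumes l_pos: "l > 0"
  shows "(\<Sum>i<n. (e i)\<^sup>2) / n - 4 * l * (\<Sum>k\<in>I. \<bar>\<beta> k\<bar>) \<le> (\<Sum>i<n. (r i)\<^sup>2) / n"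
proof -
  have d: "(\<Sum>k\<in>I. \<bar>d k\<bar>) \<le> (\<Sum>k\<in>I. \<bar>b k\<bar>) + (\<Sum>k\<in>I. \<bar>\<beta> k\<bar>)"
    unfolding sum.distrib[symmetric] d_def by (intro sum_mono) auto
  have "0 \<le> (\<Sum>i<n. (Ad i)\<^sup>2) / n" by (simp add: sum_nonneg)
  then have "l * (2 * (\<Sum>k\<in>I. \<bar>b k\<bar>)) \<le> l * ((\<Sum>k\<in>I. \<bar>d k\<bar>) + 2 * (\<Sum>k\<in>I. \<bar>\<beta> k\<bar>))"
    using basic_inequality by (simp add: algebra_simps)
  then have "2 * (\<Sum>k\<in>I. \<bar>b k\<bar>) \<le> (\<Sum>k\<in>I. \<bar>d k\<bar>) + 2 * (\<Sum>k\<in>I. \<bar>\<beta> k\<bar>)"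
    using l_pos by simp
  then have "(\<Sum>k\<in>I. \<bar>d k\<bar>) \<le> 4 * (\<Sum>k\<in>I. \<bar>\<beta> k\<bar>)" using d by simp
  then have "l * (\<Sum>k\<in>I. \<bar>d k\<bar>) \<le> l * (4 * (\<Sum>k\<in>I. \<bar>\<beta> k\<bar>))" using l by (rule mult_left_mono)
  then have inner: "2 * ((\<Sum>i<n. e i * Ad i) / n) \<le> 4 * l * (\<Sum>k\<in>I. \<bar>\<beta> k\<bar>)"
    using noise_inner by linarith
  have "(\<Sum>i<n. (e i)\<^sup>2) - 2 * (\<Sum>i<n. e i * Ad i) \<le> (\<Sum>i<n. (r i)\<^sup>2)"
    unfolding sum_distrib_left sum_subtractf[symmetric]
    by (intro sum_mono) (simp add: residual_eq power2_diff)
  then have "((\<Sum>i<n. (e i)\<^sup>2) - 2 * (\<Sum>i<n. e i * Ad i)) / n \<le> (\<Sum>i<n. (r i)\<^sup>2) / n"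
    by (rule divide_right_mono) simp
  then show ?thesis using inner by (simp add: diff_divide_distrib)
qed

text \<open>Standard oracle argument: the cone condition bounds the l1 error by 4 D, where D is its
  part on the support; Cauchy-Schwarz gives D^2 <= s Q, and compatibility gives c Q <= 6 l D. Hence
  D <= 6 l s / c, and the factor 4 yields 24. The term with \<rho> allows a sample covariance matrix
  that is only entrywise close to a definite one.\<close>

lemma fast_rate:
  assumes S: "card {k\<in>I. \<beta> k \<noteq> 0} \<le> s" and c: "c > 0" and l_pos: "l > 0"
    and compat: "c * (\<Sum>k\<in>I. (d k)\<^sup>2) \<le> (\<Sum>i<n. (Ad i)\<^sup>2) / n + \<rho> * (\<Sum>k\<in>I. \<bar>d k\<bar>)\<^sup>2"
    and \<rho>: "\<rho> \<ge> 0" "32 * \<rho> * s \<le> c"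
  shows "(\<Sum>k\<in>I. \<bar>d k\<bar>) \<le> 24 * l * s / c"
proof -
  define S where "S = {k\<in>I. \<beta> k \<noteq> 0}"
  have fS: "finite S" "S \<subseteq> I" using fin by (auto simp: S_def)
  define D where "D = (\<Sum>k\<in>S. \<bar>d k\<bar>)"
  define D' where "D' = (\<Sum>k\<in>I - S. \<bar>d k\<bar>)"
  define Q where "Q = (\<Sum>k\<in>I. (d k)\<^sup>2)"
  define P where "P = (\<Sum>i<n. (Ad i)\<^sup>2) / n"
  have P0: "P \<ge> 0" by (simp add: P_def sum_nonneg)
  have D0: "D \<ge> 0" by (simp add: D_def sum_nonneg)
  have Q0: "Q \<ge> 0" by (simp add: Q_def sum_nonneg)
  have split: "(\<Sum>k\<in>I. f k) = (\<Sum>k\<in>I - S. f k) + (\<Sum>k\<in>S. f k)" for f :: "nat \<Rightarrow> real"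
    using sum.subset_diff[OF fS(2) fin] .
  have off: "(\<Sum>k\<in>I - S. \<bar>\<beta> k\<bar>) = 0" "(\<Sum>k\<in>I - S. \<bar>b k\<bar>) = D'"
    unfolding D'_def d_def by (auto simp: S_def intro!: sum.cong)
  have on: "(\<Sum>k\<in>S. \<bar>\<beta> k\<bar>) \<le> (\<Sum>k\<in>S. \<bar>b k\<bar>) + D"
    unfolding D_def d_def sum.distrib[symmetric] by (intro sum_mono) auto
  have d1: "(\<Sum>k\<in>I. \<bar>d k\<bar>) = D' + D" unfolding D_def D'_def by (rule split)
  have bi: "P + 2 * l * (D' + (\<Sum>k\<in>S. \<bar>b k\<bar>)) \<le> l * (D' + D) + 2 * l * (\<Sum>k\<in>S. \<bar>\<beta> k\<bar>)"
    using basic_inequality unfolding split[of "\<lambda>k. \<bar>b k\<bar>"] split[of "\<lambda>k. \<bar>\<beta> k\<bar>"] off d1 P_def by simp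
  have "l * (\<Sum>k\<in>S. \<bar>\<beta> k\<bar>) \<le> l * ((\<Sum>k\<in>S. \<bar>b k\<bar>) + D)"
    using on l by (rule mult_left_mono)
  \<comment> \<open>Off the support the error equals the estimate, so its penalty survives with
    factor l on the left; on the support the triangle inequality loses at most 3 l D.\<close>
  with bi have cone: "P + l * D' \<le> 3 * l * D" by (simp add: algebra_simps)
  then have "l * D' \<le> l * (3 * D)" using P0 by simp
  then have D': "D' \<le> 3 * D" using l_pos by simp
  have D'0: "D' \<ge> 0" by (simp add: D'_def sum_nonneg)
  have "P \<le> 3 * l * D" using cone D'0 l by (smt (verit) mult_nonneg_nonneg)
  have "(D' + D)\<^sup>2 \<le> (4 * D)\<^sup>2" using D' D'0 D0 by (intro power_mono) auto
  then have le16: "(D' + D)\<^sup>2 \<le> 16 * D\<^sup>2" by (simp add: power_mult_distrib)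
  have "D\<^sup>2 \<le> (\<Sum>k\<in>S. 1\<^sup>2) * (\<Sum>k\<in>S. \<bar>d k\<bar>\<^sup>2)"
    unfolding D_def using Cauchy_Schwarz_ineq_sum[of "\<lambda>_. 1" "\<lambda>k. \<bar>d k\<bar>" S] by simp
  also have "\<dots> = card S * (\<Sum>k\<in>S. (d k)\<^sup>2)" by simp
  also have "\<dots> \<le> s * Q"
    using S fS fin unfolding S_def[symmetric] Q_def
    by (intro mult_mono sum_mono2 sum_nonneg) auto
  finally have DQ: "D\<^sup>2 \<le> s * Q" .
  have "c * Q \<le> P + \<rho> * (D' + D)\<^sup>2" using compat unfolding Q_def P_def d1 .
  \<comment> \<open>By the cone condition the perturbation is at most 16 \<rho> s Q; the bound 32
    \<rho> s <= c turns this into c Q / 2, which the left-hand side absorbs.\<close>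
  also have "\<rho> * (D' + D)\<^sup>2 \<le> \<rho> * (16 * (s * Q))"
    using le16 DQ \<rho>(1) by (intro mult_left_mono) auto
  also have "\<rho> * (16 * (s * Q)) = (32 * \<rho> * s) * (Q / 2)" by simp
  also have "\<dots> \<le> c * (Q / 2)" using \<rho>(2) Q0 by (intro mult_right_mono) auto
  finally have "c * Q \<le> 6 * l * D" using \<open>P \<le> 3 * l * D\<close> by simp
  have "c * (D * D) \<le> c * (s * Q)" using DQ c by (simp add: power2_eq_square)
  also have "\<dots> = s * (c * Q)" by simp
  also have "\<dots> \<le> s * (6 * l * D)" using \<open>c * Q \<le> 6 * l * D\<close> by (intro mult_left_mono) auto
  finally have "D * (c * D) \<le> D * (6 * l * s)" by (simp add: mult_ac)
  then have "c * D \<le> 6 * l * s"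
    using D0 l by (cases "D = 0") auto
  then have "D \<le> 6 * l * s / c" using c by (simp add: field_simps)
  then show ?thesis unfolding d1 using D' by simp
qed

end

section \<open>Sample covariance forms\<close>

lemma quad_form_Sigma_hat:
  "quad_form p (Sigma_hat n A) x = (\<Sum>i<n. (\<Sum>k<p. A i k * x k)\<^sup>2) / n"
proof -
  have "quad_form p (Sigma_hat n A) x = (\<Sum>j<p. \<Sum>k<p. \<Sum>i<n. x j * (A i j * A i k) * x k / n)"
    unfolding quad_form_def Sigma_hat_def
    by (simp add: sum_distrib_left sum_distrib_right sum_divide_distrib)
  also have "\<dots> = (\<Sum>j<p. \<Sum>i<n. \<Sum>k<p. x j * (A i j * A i k) * x k / n)"
    by (intro sum.cong refl sum.swap)
  also have "\<dots> = (\<Sum>i<n. \<Sum>j<p. \<Sum>k<p. x j * (A i j * A i k) * x k / n)"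
    by (rule sum.swap)
  also have "\<dots> = (\<Sum>i<n. (\<Sum>k<p. A i k * x k)\<^sup>2) / n"
    unfolding power2_eq_square sum_product sum_divide_distrib
    by (intro sum.cong refl) (simp add: mult_ac)
  finally show ?thesis .
qed

text \<open>Entrywise closeness costs only the squared l1 norm, which the cone condition in
  \<open>fast_rate\<close> bounds by a multiple of s times the squared l2 norm. This transfers the
  population eigenvalue bound to the sample.\<close>

lemma quad_form_perturbation:
  assumes "\<And>j k. j < p \<Longrightarrow> k < p \<Longrightarrow> \<bar>S j k - T j k\<bar> \<le> \<rho>"
  shows "quad_form p T x \<le> quad_form p S x + \<rho> * (\<Sum>k<p. \<bar>x k\<bar>)\<^sup>2"
proof -
  have "quad_form p T x - quad_form p S x = (\<Sum>j<p. \<Sum>k<p. x j * (T j k - S j k) * x k)"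
    unfolding quad_form_def by (simp add: algebra_simps sum_subtractf)
  also have "\<dots> \<le> (\<Sum>j<p. \<Sum>k<p. \<bar>x j\<bar> * \<rho> * \<bar>x k\<bar>)"
  proof (intro sum_mono)
    fix j k assume jk: "j \<in> {..<p}" "k \<in> {..<p}"
    have "x j * (T j k - S j k) * x k \<le> \<bar>x j * (T j k - S j k) * x k\<bar>" by (rule abs_ge_self)
    also have "\<dots> = \<bar>x j\<bar> * \<bar>S j k - T j k\<bar> * \<bar>x k\<bar>" by (simp add: abs_mult abs_minus_commute)
    also have "\<dots> \<le> \<bar>x j\<bar> * \<rho> * \<bar>x k\<bar>"
      using assms jk by (intro mult_right_mono mult_left_mono) auto
    finally show "x j * (T j k - S j k) * x k \<le> \<bar>x j\<bar> * \<rho> * \<bar>x k\<bar>" .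
  qed
  also have "\<dots> = \<rho> * (\<Sum>k<p. \<bar>x k\<bar>)\<^sup>2"
    unfolding power2_eq_square sum_product
    by (simp add: sum_distrib_left mult_ac)
  finally show ?thesis by simp
qed

section \<open>The de-sparsified Lasso\<close>

lemma omega_hat_eq:
  "omega_hat n p l A g v j j = v * ((\<Sum>i<n. (\<Sum>k<p. Theta_hat n p l A g j k * A i k)\<^sup>2) / n)"
proof -
  have "omega_hat n p l A g v j j = quad_form p (Sigma_hat n A) (Theta_hat n p l A g j) * v"
    unfolding omega_hat_def quad_form_def ..
  moreover have "(\<Sum>k<p. A i k * Theta_hat n p l A g j k) = (\<Sum>k<p. Theta_hat n p l A g j k * A i k)" for i
    by (intro sum.cong refl mult.commute)
  ultimately show ?thesis unfolding quad_form_Sigma_hat by simp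
qed

locale nodewise_solution =
  fixes n p :: nat and l :: "nat \<Rightarrow> real" and A :: "nat \<Rightarrow> nat \<Rightarrow> real"
    and g :: "nat \<Rightarrow> nat \<Rightarrow> real" and j :: nat
  assumes j: "j < p" and lj: "l j \<ge> 0"
    and min: "is_arg_min (lasso_objective n ({..<p} - {j}) (l j) (\<lambda>i. A i j) A)
            (\<lambda>g. g \<in> extensional ({..<p} - {j})) (g j)"
begin

sublocale L: lasso_solution n "{..<p} - {j}" "l j" "\<lambda>i. A i j" A "g j"
  using min lj by unfold_locales auto

abbreviation "tau2 \<equiv> tau2_hat n p l A g j"

text \<open>The design times the j-th row of the estimated precision matrix: the noise part of the
  de-sparsified estimator is the inner product of w with the errors, divided by n.\<close>

definition "w i = (\<Sum>k<p. Theta_hat n p l A g j k * A i k)"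

lemma w_eq: "w i = L.r i / tau2"
proof -
  have "w i = (\<Sum>k<p. C_hat g j k * A i k) / tau2"
    by (simp add: w_def Theta_hat_def sum_divide_distrib)
  also have "(\<Sum>k<p. C_hat g j k * A i k) = C_hat g j j * A i j + (\<Sum>k\<in>{..<p} - {j}. C_hat g j k * A i k)"
    using j by (intro sum.remove) auto
  also have "(\<Sum>k\<in>{..<p} - {j}. C_hat g j k * A i k) = - (\<Sum>k\<in>{..<p} - {j}. A i k * g j k)"
    unfolding sum_negf[symmetric] by (intro sum.cong) (auto simp: C_hat_def)
  finally show ?thesis by (simp add: L.r_def C_hat_def)
qed

text \<open>\<open>residual_fit\<close> turns the penalty term of tau_j^2 into an inner product of
  the residual with the fit; this normalisation makes the inner product of w with column j exactly
  n.\<close>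

lemma tau2_eq: "tau2 = (\<Sum>i<n. L.r i * A i j) / n"
proof -
  have "tau2 = (\<Sum>i<n. (L.r i)\<^sup>2) / n + (\<Sum>i<n. L.r i * (\<Sum>k\<in>{..<p} - {j}. A i k * g j k)) / n"
    unfolding L.residual_fit by (simp add: tau2_hat_def L.r_def)
  also have "\<dots> = (\<Sum>i<n. L.r i * A i j) / n"
    unfolding add_divide_distrib[symmetric] sum.distrib[symmetric]
    by (simp add: L.r_def power2_eq_square algebra_simps)
  finally show ?thesis .
qed

lemma rss_le_tau2: "(\<Sum>i<n. (L.r i)\<^sup>2) / n \<le> tau2"
  using lj by (simp add: tau2_hat_def L.r_def sum_nonneg)

lemma sum_w: "(\<Sum>i<n. w i * f i) = (\<Sum>i<n. L.r i * f i) / tau2"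
  by (simp add: w_eq sum_divide_distrib)

lemma w_diag: "tau2 > 0 \<Longrightarrow> (\<Sum>i<n. w i * A i j) / n = 1"
proof -
  assume "tau2 > 0"
  have "(\<Sum>i<n. w i * A i j) / n = ((\<Sum>i<n. L.r i * A i j) / n) / tau2" by (simp add: sum_w)
  also have "\<dots> = tau2 / tau2" by (simp only: tau2_eq[symmetric])
  finally show ?thesis using \<open>tau2 > 0\<close> by simp
qed

lemma w_off_diag:
  assumes "tau2 > 0" "k < p" "k \<noteq> j"
  shows "\<bar>(\<Sum>i<n. w i * A i k) / n\<bar> \<le> l j / tau2"
proof -
  have "(\<Sum>i<n. w i * A i k) / n = (\<Sum>i<n. L.r i * A i k) / n / tau2"
    by (simp add: sum_w)
  then have "\<bar>(\<Sum>i<n. w i * A i k) / n\<bar> = \<bar>(\<Sum>i<n. L.r i * A i k) / n\<bar> / tau2"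
    using assms(1) by (simp add: abs_divide)
  also have "\<dots> \<le> l j / tau2"
    using L.kkt[of k] assms by (intro divide_right_mono) auto
  finally show ?thesis .
qed

lemma omega_hat_w: "omega_hat n p l A g v j j = v * ((\<Sum>i<n. (w i)\<^sup>2) / n)"
  unfolding omega_hat_eq w_def ..

lemma sum_w_le: "tau2 > 0 \<Longrightarrow> (\<Sum>i<n. (w i)\<^sup>2) / n \<le> 1 / tau2"
proof -
  assume t: "tau2 > 0"
  have "(\<Sum>i<n. (w i)\<^sup>2) = (\<Sum>i<n. (L.r i)\<^sup>2) / tau2\<^sup>2"
    by (simp only: w_eq power_divide sum_divide_distrib)
  then have "(\<Sum>i<n. (w i)\<^sup>2) / n = ((\<Sum>i<n. (L.r i)\<^sup>2) / n) / tau2\<^sup>2"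
    by simp
  also have "\<dots> \<le> tau2 / tau2\<^sup>2" using rss_le_tau2 by (intro divide_right_mono) auto
  finally show ?thesis using t by (simp add: power2_eq_square)
qed

text \<open>Vanishing weights would contradict \<open>w_diag\<close>; this keeps the estimated
  variance in the denominator positive.\<close>

lemma sum_w_pos: "tau2 > 0 \<Longrightarrow> (\<Sum>i<n. (w i)\<^sup>2) / n > 0"
proof -
  assume t: "tau2 > 0"
  have "(\<Sum>i<n. (w i)\<^sup>2) / n \<noteq> 0"
  proof
    assume "(\<Sum>i<n. (w i)\<^sup>2) / n = 0"
    then have "n = 0 \<or> (\<forall>i<n. w i = 0)" by (auto simp: sum_nonneg_eq_0_iff)
    then have "(\<Sum>i<n. w i * A i j) / n = 0" by auto
    then show False using w_diag[OF t] by simp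
  qed
  moreover have "(\<Sum>i<n. (w i)\<^sup>2) / n \<ge> 0" by (intro divide_nonneg_nonneg sum_nonneg) auto
  ultimately show ?thesis by linarith
qed

text \<open>The Lasso error in coordinate j cancels exactly by \<open>w_diag\<close>. Every other
  coordinate contributes with a factor of at most l j / tau2 by the optimality conditions, and
  summing gives the l1 error.\<close>

lemma desparsified_error:
  assumes t: "tau2 > 0" and y: "\<And>i. i < n \<Longrightarrow> y i = (\<Sum>k<p. A i k * \<beta> k) + e i"
  shows "\<bar>desparsified_lasso n p l y A b g j - \<beta> j - (\<Sum>i<n. w i * e i) / n\<bar>
    \<le> l j / tau2 * (\<Sum>k<p. \<bar>b k - \<beta> k\<bar>)"
proof -
  let ?d = "\<lambda>k. b k - \<beta> k"
  let ?a = "\<lambda>k. (\<Sum>i<n. w i * A i k) / n"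
  have "(\<Sum>k<p. Theta_hat n p l A g j k * (\<Sum>i<n. A i k * (y i - (\<Sum>m<p. A i m * b m))))
      = (\<Sum>i<n. w i * (y i - (\<Sum>m<p. A i m * b m)))"
    unfolding w_def sum_distrib_left sum_distrib_right
    by (subst sum.swap) (simp add: mult_ac)
  also have "\<dots> = (\<Sum>i<n. w i * (e i - (\<Sum>k<p. A i k * ?d k)))"
    by (intro sum.cong refl arg_cong2[of _ _ _ _ times]) (simp add: y right_diff_distrib sum_subtractf)
  also have "\<dots> = (\<Sum>i<n. w i * e i) - (\<Sum>i<n. \<Sum>k<p. w i * A i k * ?d k)"
    by (simp only: right_diff_distrib sum_subtractf[symmetric] sum_distrib_left mult.assoc)
  also have "(\<Sum>i<n. \<Sum>k<p. w i * A i k * ?d k) = (\<Sum>k<p. (\<Sum>i<n. w i * A i k) * ?d k)"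
    unfolding sum_distrib_right by (rule sum.swap)
  finally have "desparsified_lasso n p l y A b g j - \<beta> j - (\<Sum>i<n. w i * e i) / n
     = ?d j - (\<Sum>k<p. (\<Sum>i<n. w i * A i k) * ?d k) / n"
    unfolding desparsified_lasso_def by (simp add: diff_divide_distrib)
  also have "(\<Sum>k<p. (\<Sum>i<n. w i * A i k) * ?d k) / n = (\<Sum>k<p. ?a k * ?d k)"
    by (subst sum_divide_distrib) simp
  also have "(\<Sum>k<p. ?a k * ?d k) = ?a j * ?d j + (\<Sum>k\<in>{..<p} - {j}. ?a k * ?d k)"
    using j by (intro sum.remove) auto
  also have "?a j = 1" by (rule w_diag[OF t])
  finally have "\<bar>desparsified_lasso n p l y A b g j - \<beta> j - (\<Sum>i<n. w i * e i) / n\<bar>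
     = \<bar>\<Sum>k\<in>{..<p} - {j}. ?a k * ?d k\<bar>" by simp
  also have "\<dots> \<le> (\<Sum>k\<in>{..<p} - {j}. \<bar>?a k * ?d k\<bar>)" by (rule sum_abs)
  also have "\<dots> \<le> (\<Sum>k\<in>{..<p} - {j}. l j / tau2 * \<bar>?d k\<bar>)"
    unfolding abs_mult using w_off_diag[OF t] by (intro sum_mono mult_right_mono) auto
  also have "\<dots> \<le> (\<Sum>k<p. l j / tau2 * \<bar>?d k\<bar>)"
    using lj t by (intro sum_mono2) auto
  finally show ?thesis by (simp add: sum_distrib_left)
qed

end

section \<open>Exponential inequalities\<close>

lemma (in prob_space) chernoff_two_sided:
  fixes S :: "'a \<Rightarrow> real"
  assumes [measurable]: "S \<in> borel_measurable M" and u: "u > 0"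
    and pos: "(\<integral>\<^sup>+\<omega>. ennreal (exp (u * S \<omega>)) \<partial>M) \<le> ennreal (exp v)"
    and neg: "(\<integral>\<^sup>+\<omega>. ennreal (exp (- u * S \<omega>)) \<partial>M) \<le> ennreal (exp v)"
  shows "prob {\<omega>\<in>space M. \<bar>S \<omega>\<bar> \<ge> t} \<le> 2 * exp (v - u * t)"
proof -
  have one: "prob {\<omega>\<in>space M. f \<omega> \<ge> t} \<le> exp (v - u * t)"
    if [measurable]: "f \<in> borel_measurable M"
      and mgf: "(\<integral>\<^sup>+\<omega>. ennreal (exp (u * f \<omega>)) \<partial>M) \<le> ennreal (exp v)" for f :: "'a \<Rightarrow> real"
  proof -
    have "ennreal (prob {\<omega>\<in>space M. f \<omega> \<ge> t}) = emeasure M {\<omega>\<in>space M. f \<omega> \<ge> t}"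
      by (simp add: emeasure_eq_measure)
    also have "\<dots> \<le> ennreal (exp (- u * t)) * (\<integral>\<^sup>+\<omega>\<in>space M. ennreal (exp (u * f \<omega>)) \<partial>M)"
      by (intro Chernoff_ineq_nn_integral_ge u) auto
    also have "(\<integral>\<^sup>+\<omega>\<in>space M. ennreal (exp (u * f \<omega>)) \<partial>M) = (\<integral>\<^sup>+\<omega>. ennreal (exp (u * f \<omega>)) \<partial>M)"
      by (intro nn_integral_cong) simp
    also have "ennreal (exp (- u * t)) * \<dots> \<le> ennreal (exp (- u * t)) * ennreal (exp v)"
      by (intro mult_left_mono mgf) simp
    also have "\<dots> = ennreal (exp (v - u * t))"
      by (simp add: ennreal_mult[symmetric] exp_add[symmetric])
    finally show ?thesis by (subst (asm) ennreal_le_iff) auto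
  qed
  have "prob {\<omega>\<in>space M. \<bar>S \<omega>\<bar> \<ge> t} \<le>
      prob ({\<omega>\<in>space M. S \<omega> \<ge> t} \<union> {\<omega>\<in>space M. - S \<omega> \<ge> t})"
    by (intro finite_measure_mono) (auto simp: abs_if split: if_splits)
  also have "\<dots> \<le> prob {\<omega>\<in>space M. S \<omega> \<ge> t} + prob {\<omega>\<in>space M. - S \<omega> \<ge> t}"
    by (intro measure_Un_le) auto
  also have "\<dots> \<le> exp (v - u * t) + exp (v - u * t)"
    using pos neg by (intro add_mono one) auto
  finally show ?thesis by simp
qed

lemma exp_le_quadratic:
  fixes x :: real
  shows "exp x \<le> 1 + x + x\<^sup>2 / 2 * exp \<bar>x\<bar>"
proof -
  obtain t where t: "\<bar>t\<bar> \<le> \<bar>x\<bar>" "exp x = (\<Sum>m<2. x ^ m / fact m) + exp t / fact 2 * x\<^sup>2"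
    using Maclaurin_exp_le[of x 2] by blast
  have "exp t * x\<^sup>2 \<le> exp \<bar>x\<bar> * x\<^sup>2" using t by (intro mult_right_mono) auto
  then show ?thesis using t(2) by (simp add: numeral_2_eq_2 mult.commute)
qed

lemma square_le_exp:
  fixes x :: real
  assumes "x \<ge> 0"
  shows "x\<^sup>2 \<le> 2 * exp x"
  using exp_lower_Taylor_quadratic[OF assms] assms by simp

text \<open>One integral in place of bounds on all moments: it controls the remainder of a
  second-order Taylor expansion of the exponential for all arguments up to h, and as a nonnegative
  integral it includes integrability.\<close>

abbreviation "bernstein_moment M h V Z \<equiv>
  (\<integral>\<^sup>+\<omega>. ennreal ((Z \<omega>)\<^sup>2 * exp (h * \<bar>Z \<omega>\<bar>)) \<partial>M) \<le> ennreal V"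

abbreviation "sub_gaussian M D Z \<equiv> (\<integral>\<^sup>+\<omega>. ennreal (exp ((Z \<omega>)\<^sup>2 / D)) \<partial>M) \<le> 2"

abbreviation "sub_exponential M D Z \<equiv> (\<integral>\<^sup>+\<omega>. ennreal (exp (\<bar>Z \<omega>\<bar> / D)) \<partial>M) \<le> 2"

text \<open>Second-order Taylor bound under the expectation, followed by 1 + y <= exp y. The
  first-order term u E Z is what the centring on the left cancels, so the moment condition may be
  stated for the uncentred variable.\<close>

lemma (in prob_space) mgf_le:
  fixes Z :: "'a \<Rightarrow> real"
  assumes [measurable]: "Z \<in> borel_measurable M" and V: "V \<ge> 0"
    and bern: "bernstein_moment M h V Z"
    and u: "\<bar>u\<bar> \<le> h"
  shows "(\<integral>\<^sup>+\<omega>. ennreal (exp (u * (Z \<omega> - expectation Z))) \<partial>M) \<le> ennreal (exp (u\<^sup>2 * V / 2))"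
proof -
  let ?Q = "\<lambda>\<omega>. (Z \<omega>)\<^sup>2 * exp (h * \<bar>Z \<omega>\<bar>)"
  have h: "h \<ge> 0" using u by simp
  have Qi: "integrable M ?Q"
    using bern by (intro integrableI_nonneg) (auto intro: order_le_less_trans)
  have "ennreal (expectation ?Q) \<le> ennreal V"
    using bern by (subst nn_integral_eq_integral[OF Qi, symmetric]) auto
  then have EQ: "expectation ?Q \<le> V" using V by simp
  have Zi: "integrable M Z"
  proof (rule Bochner_Integration.integrable_bound)
    show "integrable M (\<lambda>\<omega>. 1 + ?Q \<omega>)" using Qi by simp
    show "AE \<omega> in M. norm (Z \<omega>) \<le> norm (1 + ?Q \<omega>)"
    proof (rule AE_I2)
      fix \<omega>
      have "0 \<le> (\<bar>Z \<omega>\<bar> - 1)\<^sup>2" by simp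
      also have "\<dots> = (Z \<omega>)\<^sup>2 - 2 * \<bar>Z \<omega>\<bar> + 1" by (simp add: power2_diff)
      finally have "\<bar>Z \<omega>\<bar> \<le> 1 + (Z \<omega>)\<^sup>2" using zero_le_power2[of "Z \<omega>"] by linarith
      moreover have "(Z \<omega>)\<^sup>2 * 1 \<le> ?Q \<omega>" using h by (intro mult_left_mono) auto
      ultimately show "norm (Z \<omega>) \<le> norm (1 + ?Q \<omega>)" by simp
    qed
  qed simp
  have pt: "exp (u * Z \<omega>) \<le> 1 + u * Z \<omega> + u\<^sup>2 / 2 * ?Q \<omega>" for \<omega>
  proof -
    have "exp (u * Z \<omega>) \<le> 1 + u * Z \<omega> + (u * Z \<omega>)\<^sup>2 / 2 * exp \<bar>u * Z \<omega>\<bar>"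
      by (rule exp_le_quadratic)
    also have "\<dots> \<le> 1 + u * Z \<omega> + (u * Z \<omega>)\<^sup>2 / 2 * exp (h * \<bar>Z \<omega>\<bar>)"
      using u by (intro add_left_mono mult_left_mono) (auto simp: abs_mult mult_right_mono)
    finally show ?thesis by (simp add: power_mult_distrib mult_ac)
  qed
  have exp_i: "integrable M (\<lambda>\<omega>. exp (u * Z \<omega>))"
  proof (rule Bochner_Integration.integrable_bound)
    show "integrable M (\<lambda>\<omega>. 1 + u * Z \<omega> + u\<^sup>2 / 2 * ?Q \<omega>)" using Qi Zi by simp
    show "AE \<omega> in M. norm (exp (u * Z \<omega>)) \<le> norm (1 + u * Z \<omega> + u\<^sup>2 / 2 * ?Q \<omega>)"
    proof (rule AE_I2)
      fix \<omega>
      show "norm (exp (u * Z \<omega>)) \<le> norm (1 + u * Z \<omega> + u\<^sup>2 / 2 * ?Q \<omega>)"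
        unfolding real_norm_def abs_exp_cancel by (rule order_trans[OF pt abs_ge_self])
    qed
  qed simp
  have "expectation (\<lambda>\<omega>. exp (u * Z \<omega>)) \<le> expectation (\<lambda>\<omega>. 1 + u * Z \<omega> + u\<^sup>2 / 2 * ?Q \<omega>)"
    using Qi Zi by (intro integral_mono exp_i pt) auto
  also have "\<dots> = 1 + u * expectation Z + u\<^sup>2 / 2 * expectation ?Q"
    using Qi Zi by (simp add: prob_space)
  also have "\<dots> \<le> 1 + u * expectation Z + u\<^sup>2 / 2 * V"
    using EQ by (intro add_left_mono mult_left_mono) auto
  also have "\<dots> \<le> exp (u * expectation Z + u\<^sup>2 / 2 * V)"
    using exp_ge_add_one_self[of "u * expectation Z + u\<^sup>2 / 2 * V"] by linarith
  finally have E: "expectation (\<lambda>\<omega>. exp (u * Z \<omega>)) \<le> exp (u * expectation Z + u\<^sup>2 / 2 * V)" .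
  have "(\<integral>\<^sup>+\<omega>. ennreal (exp (u * (Z \<omega> - expectation Z))) \<partial>M) =
     (\<integral>\<^sup>+\<omega>. ennreal (exp (- u * expectation Z) * exp (u * Z \<omega>)) \<partial>M)"
    by (intro nn_integral_cong) (simp add: exp_add[symmetric] algebra_simps)
  also have "\<dots> = ennreal (exp (- u * expectation Z) * expectation (\<lambda>\<omega>. exp (u * Z \<omega>)))"
    using exp_i by (subst nn_integral_eq_integral) auto
  also have "\<dots> \<le> ennreal (exp (- u * expectation Z) * exp (u * expectation Z + u\<^sup>2 / 2 * V))"
    using E by (intro ennreal_leI mult_left_mono) auto
  also have "\<dots> = ennreal (exp (u\<^sup>2 * V / 2))"
    by (simp add: exp_add[symmetric])
  finally show ?thesis .
qed

text \<open>Chernoff's bound with u = t / V, the minimiser of u^2 V / 2 - u t. The restriction t <=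
  h V makes this u admissible, so the tail is purely Gaussian.\<close>

lemma (in prob_space) bernstein:
  fixes Z :: "nat \<Rightarrow> 'a \<Rightarrow> real"
  assumes n: "n > 0" and ind: "indep_vars (\<lambda>_. borel) Z {..<n}" and V: "V > 0"
    and bern: "\<And>i. i < n \<Longrightarrow> bernstein_moment M h V (\<lambda>\<omega>. Z i \<omega>)"
    and m: "\<And>i. i < n \<Longrightarrow> expectation (Z i) = m"
    and t: "0 < t" "t \<le> h * V"
  shows "prob {\<omega>\<in>space M. \<bar>(\<Sum>i<n. Z i \<omega>) / n - m\<bar> \<ge> t} \<le> 2 * exp (- (n * t\<^sup>2 / (2 * V)))"
proof -
  have rv: "Z i \<in> borel_measurable M" if "i < n" for i
    using ind that by (auto simp: indep_vars_def2)
  define S where "S \<omega> = (\<Sum>i<n. Z i \<omega> - m)" for \<omega>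
  have [measurable]: "S \<in> borel_measurable M"
    unfolding S_def using rv by (intro borel_measurable_sum borel_measurable_diff) auto
  define u where "u = t / V"
  have u: "u > 0" "u \<le> h" using t V by (auto simp: u_def field_simps)
  have mgf: "(\<integral>\<^sup>+\<omega>. ennreal (exp (s * S \<omega>)) \<partial>M) \<le> ennreal (exp (n * (u\<^sup>2 * V / 2)))"
    if s: "\<bar>s\<bar> = u" for s
  proof -
    have "(\<integral>\<^sup>+\<omega>. ennreal (exp (s * S \<omega>)) \<partial>M) = (\<integral>\<^sup>+\<omega>. (\<Prod>i<n. ennreal (exp (s * (Z i \<omega> - m)))) \<partial>M)"
      by (intro nn_integral_cong) (simp add: S_def sum_distrib_left exp_sum prod_ennreal)
    also have "\<dots> = (\<Prod>i<n. \<integral>\<^sup>+\<omega>. ennreal (exp (s * (Z i \<omega> - m))) \<partial>M)"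
      by (intro indep_vars_nn_integral indep_vars_compose2[OF ind]) auto
    also have "\<dots> \<le> (\<Prod>i<n. ennreal (exp (s\<^sup>2 * V / 2)))"
    proof (intro prod_mono_ennreal)
      fix i assume i: "i \<in> {..<n}"
      then show "(\<integral>\<^sup>+\<omega>. ennreal (exp (s * (Z i \<omega> - m))) \<partial>M) \<le> ennreal (exp (s\<^sup>2 * V / 2))"
        using mgf_le[of "Z i" V h s] rv[of i] bern[of i] V s u(2) m[of i] by simp
    qed
    also have "\<dots> = ennreal (exp (n * (s\<^sup>2 * V / 2)))"
      unfolding exp_of_nat_mult by (simp only: prod_constant card_lessThan ennreal_power exp_ge_zero)
    also have "s\<^sup>2 = u\<^sup>2" using s by (metis power2_abs)
    finally show ?thesis .
  qed
  have "prob {\<omega>\<in>space M. \<bar>(\<Sum>i<n. Z i \<omega>) / n - m\<bar> \<ge> t} = prob {\<omega>\<in>space M. \<bar>S \<omega>\<bar> \<ge> n * t}"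
  proof -
    have "(\<Sum>i<n. Z i \<omega>) / n - m = S \<omega> / n" for \<omega>
      using n by (simp add: S_def sum_subtractf diff_divide_distrib)
    then have "\<bar>(\<Sum>i<n. Z i \<omega>) / n - m\<bar> \<ge> t \<longleftrightarrow> \<bar>S \<omega>\<bar> \<ge> n * t" for \<omega>
      using n by (simp add: pos_le_divide_eq mult.commute)
    then show ?thesis by simp
  qed
  also have "\<dots> \<le> 2 * exp (n * (u\<^sup>2 * V / 2) - u * (n * t))"
    using u(1) mgf[of u] mgf[of "- u"] by (intro chernoff_two_sided) simp_all
  also have "n * (u\<^sup>2 * V / 2) - u * (n * t) = - (n * t\<^sup>2 / (2 * V))"
    using V by (simp add: u_def power2_eq_square)
  finally show ?thesis .
qed

section \<open>Gaussian multipliers\<close>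

lemma std_normal_mgf:
  "(\<integral>\<^sup>+x. ennreal (exp (u * x)) \<partial>density lborel std_normal_density) = ennreal (exp (u\<^sup>2 / 2))"
proof -
  interpret N: prob_space "density lborel (normal_density u 1)"
    by (rule prob_space_normal_density) simp
  have "(\<integral>\<^sup>+x. ennreal (exp (u * x)) \<partial>density lborel std_normal_density)
      = (\<integral>\<^sup>+x. ennreal (std_normal_density x) * ennreal (exp (u * x)) \<partial>lborel)"
    by (subst nn_integral_density) auto
  also have "\<dots> = (\<integral>\<^sup>+x. ennreal (exp (u\<^sup>2 / 2)) * ennreal (normal_density u 1 x) \<partial>lborel)"
  proof (intro nn_integral_cong)
    fix x :: real
    have "- x\<^sup>2 / 2 + u * x = u\<^sup>2 / 2 + - (x - u)\<^sup>2 / 2" by (simp add: power2_eq_square field_simps)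
    then have "exp (- x\<^sup>2 / 2) * exp (u * x) = exp (u\<^sup>2 / 2) * exp (- (x - u)\<^sup>2 / 2)"
      by (simp only: exp_add[symmetric])
    then have "std_normal_density x * exp (u * x) = exp (u\<^sup>2 / 2) * normal_density u 1 x"
      by (simp add: normal_density_def)
    then show "ennreal (std_normal_density x) * ennreal (exp (u * x)) =
        ennreal (exp (u\<^sup>2 / 2)) * ennreal (normal_density u 1 x)"
      by (simp add: ennreal_mult[symmetric])
  qed
  also have "\<dots> = ennreal (exp (u\<^sup>2 / 2)) * (\<integral>\<^sup>+x. ennreal (normal_density u 1 x) \<partial>lborel)"
    by (rule nn_integral_cmult) simp
  also have "(\<integral>\<^sup>+x. ennreal (normal_density u 1 x) \<partial>lborel) = 1"
    using N.emeasure_space_1 by (simp add: emeasure_density)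
  finally show ?thesis by simp
qed

lemma prob_space_multipliers: "prob_space (multipliers n)"
  unfolding multipliers_def by (intro prob_space_PiM prob_space_normal_density) simp

lemma sets_multipliers [measurable_cong]: "sets (multipliers n) = sets (vecs {..<n})"
  unfolding multipliers_def by (intro sets_PiM_cong) auto

lemma measurable_multiplier_component [measurable]:
  "i < n \<Longrightarrow> (\<lambda>e. e i) \<in> borel_measurable (multipliers n)"
  by (subst measurable_cong_sets[OF sets_multipliers refl]) simp

text \<open>Chernoff's bound with exponent t, optimal for unit variance; a smaller variance only
  improves it.\<close>

lemma multipliers_tail:
  assumes c: "(\<Sum>i<n. (c i)\<^sup>2) \<le> 1" and t: "t > 0"
  shows "measure (multipliers n) {e\<in>space (multipliers n). \<bar>\<Sum>i<n. c i * e i\<bar> \<ge> t} \<le> 2 * exp (- (t\<^sup>2 / 2))"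
proof -
  interpret prob_space "multipliers n" by (rule prob_space_multipliers)
  interpret N: prob_space "density lborel std_normal_density"
    by (rule prob_space_normal_density) simp
  interpret P: product_sigma_finite "\<lambda>_::nat. density lborel std_normal_density"
    by unfold_locales
  have mgf: "(\<integral>\<^sup>+e. ennreal (exp (s * (\<Sum>i<n. c i * e i))) \<partial>multipliers n) \<le> ennreal (exp (t\<^sup>2 / 2))"
    if s: "\<bar>s\<bar> = t" for s
  proof -
    have "(\<integral>\<^sup>+e. ennreal (exp (s * (\<Sum>i<n. c i * e i))) \<partial>multipliers n)
       = (\<integral>\<^sup>+e. (\<Prod>i<n. ennreal (exp ((s * c i) * e i))) \<partial>multipliers n)"
      by (intro nn_integral_cong) (simp add: sum_distrib_left exp_sum prod_ennreal mult_ac)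
    also have "\<dots> = (\<Prod>i<n. \<integral>\<^sup>+x. ennreal (exp ((s * c i) * x)) \<partial>density lborel std_normal_density)"
      unfolding multipliers_def by (rule P.product_nn_integral_prod) auto
    also have "\<dots> = ennreal (exp (\<Sum>i<n. (s * c i)\<^sup>2 / 2))"
      unfolding std_normal_mgf by (simp add: prod_ennreal exp_sum)
    also have "(\<Sum>i<n. (s * c i)\<^sup>2 / 2) = t\<^sup>2 / 2 * (\<Sum>i<n. (c i)\<^sup>2)"
    proof -
      have "s\<^sup>2 = t\<^sup>2" using s by (metis power2_abs)
      then show ?thesis by (simp add: sum_distrib_left power_mult_distrib)
    qed
    also have "ennreal (exp \<dots>) \<le> ennreal (exp (t\<^sup>2 / 2 * 1))"
      using c by (intro ennreal_leI) (auto intro!: mult_left_le)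
    finally show ?thesis by simp
  qed
  have "prob {e\<in>space (multipliers n). \<bar>\<Sum>i<n. c i * e i\<bar> \<ge> t} \<le> 2 * exp (t\<^sup>2 / 2 - t * t)"
    using t mgf[of t] mgf[of "- t"] by (intro chernoff_two_sided) auto
  then show ?thesis by (simp add: power2_eq_square)
qed

section \<open>Moment bounds\<close>

lemma (in prob_space) bernstein_moment_sub_exponential:
  assumes [measurable]: "Z \<in> borel_measurable M" and C: "C > 0"
    and Z: "sub_exponential M C Z"
  shows "bernstein_moment M (1 / (2 * C)) (64 * C\<^sup>2) Z"
proof -
  have "z\<^sup>2 * exp (1 / (2 * C) * \<bar>z\<bar>) \<le> 32 * C\<^sup>2 * exp (\<bar>z\<bar> / C)" for z :: real
  proof -
    \<comment> \<open>In units of 4 C the weight exp (|z| / (2 C)) is exp (2 y) and the available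
      moment is exp (4 y); the square costs at most 2 exp y, so there is room. The constant 32 is 16
      times 2, doubled once more by the moment bound 2.\<close>
    define y where "y = \<bar>z\<bar> / (4 * C)"
    have y: "y \<ge> 0" "\<bar>z\<bar> = 4 * C * y" using C by (auto simp: y_def)
    have "z\<^sup>2 = \<bar>z\<bar>\<^sup>2" by simp
    also have "\<dots> = 16 * C\<^sup>2 * y\<^sup>2" unfolding y(2) by (simp add: power_mult_distrib)
    also have "\<dots> \<le> 16 * C\<^sup>2 * (2 * exp y)"
      using square_le_exp[OF y(1)] by (intro mult_left_mono) auto
    finally have "z\<^sup>2 * exp (2 * y) \<le> 32 * C\<^sup>2 * exp y * exp (2 * y)"
      by (intro mult_right_mono) auto
    also have "\<dots> = 32 * C\<^sup>2 * exp (3 * y)" by (simp add: exp_add[symmetric])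
    also have "\<dots> \<le> 32 * C\<^sup>2 * exp (4 * y)" using y by (intro mult_left_mono) auto
    finally show ?thesis using C y by simp
  qed
  then have "(\<integral>\<^sup>+\<omega>. ennreal ((Z \<omega>)\<^sup>2 * exp (1 / (2 * C) * \<bar>Z \<omega>\<bar>)) \<partial>M)
      \<le> (\<integral>\<^sup>+\<omega>. ennreal (32 * C\<^sup>2) * ennreal (exp (\<bar>Z \<omega>\<bar> / C)) \<partial>M)"
    by (intro nn_integral_mono) (simp add: ennreal_mult[symmetric])
  also have "\<dots> = ennreal (32 * C\<^sup>2) * (\<integral>\<^sup>+\<omega>. ennreal (exp (\<bar>Z \<omega>\<bar> / C)) \<partial>M)"
    by (rule nn_integral_cmult) simp
  also have "\<dots> \<le> ennreal (32 * C\<^sup>2) * ennreal 2" using Z by (intro mult_left_mono) auto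
  also have "\<dots> = ennreal (64 * C\<^sup>2)" by (simp add: ennreal_mult[symmetric] del: ennreal_numeral)
  finally show ?thesis .
qed

text \<open>Uses |x y| <= (x^2 + y^2) / 2 in the exponent and then the arithmetic-geometric mean
  inequality for the two exponentials, so the constant D is preserved and independence of the
  factors is irrelevant.\<close>

lemma (in prob_space) sub_exponential_product:
  assumes [measurable]: "U \<in> borel_measurable M" "W \<in> borel_measurable M" and D: "D > 0"
    and U: "sub_gaussian M D U"
    and W: "sub_gaussian M D W"
  shows "sub_exponential M D (\<lambda>\<omega>. U \<omega> * W \<omega>)"
proof -
  have "exp (\<bar>x * y\<bar> / D) \<le> (exp (x\<^sup>2 / D) + exp (y\<^sup>2 / D)) / 2" for x y :: real
  proof -
    have "0 \<le> (\<bar>x\<bar> - \<bar>y\<bar>)\<^sup>2" by simp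
    also have "\<dots> = x\<^sup>2 + y\<^sup>2 - 2 * \<bar>x * y\<bar>" by (simp add: power2_diff abs_mult)
    finally have "\<bar>x * y\<bar> \<le> (x\<^sup>2 + y\<^sup>2) / 2" by simp
    then have "\<bar>x * y\<bar> / D \<le> (x\<^sup>2 + y\<^sup>2) / 2 / D" using D by (intro divide_right_mono) auto
    also have "\<dots> = x\<^sup>2 / D / 2 + y\<^sup>2 / D / 2" by (simp add: add_divide_distrib)
    finally have "exp (\<bar>x * y\<bar> / D) \<le> exp (x\<^sup>2 / D / 2) * exp (y\<^sup>2 / D / 2)"
      by (simp add: exp_add[symmetric])
    also have "\<dots> \<le> ((exp (x\<^sup>2 / D / 2))\<^sup>2 + (exp (y\<^sup>2 / D / 2))\<^sup>2) / 2"
      using sum_squares_bound[of "exp (x\<^sup>2 / D / 2)" "exp (y\<^sup>2 / D / 2)"] by simp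
    also have "\<dots> = (exp (x\<^sup>2 / D) + exp (y\<^sup>2 / D)) / 2"
      by (simp add: power2_eq_square exp_add[symmetric])
    finally show ?thesis .
  qed
  then have "(\<integral>\<^sup>+\<omega>. ennreal (exp (\<bar>U \<omega> * W \<omega>\<bar> / D)) \<partial>M) \<le>
      (\<integral>\<^sup>+\<omega>. ennreal ((1 / 2) * (exp ((U \<omega>)\<^sup>2 / D) + exp ((W \<omega>)\<^sup>2 / D))) \<partial>M)"
    by (intro nn_integral_mono ennreal_leI) simp
  also have "\<dots> = ennreal (1 / 2) * (\<integral>\<^sup>+\<omega>. ennreal (exp ((U \<omega>)\<^sup>2 / D)) + ennreal (exp ((W \<omega>)\<^sup>2 / D)) \<partial>M)"
  proof -
    have "ennreal (1 / 2 * (x + y)) = ennreal (1 / 2) * (ennreal x + ennreal y)" if "x \<ge> 0" "y \<ge> 0" for x y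
      using that by (subst ennreal_plus[symmetric]) (auto simp only: ennreal_mult)
    then show ?thesis by (subst nn_integral_cmult[symmetric]) (auto intro!: nn_integral_cong)
  qed
  also have "\<dots> = ennreal (1 / 2) * ((\<integral>\<^sup>+\<omega>. ennreal (exp ((U \<omega>)\<^sup>2 / D)) \<partial>M)
      + (\<integral>\<^sup>+\<omega>. ennreal (exp ((W \<omega>)\<^sup>2 / D)) \<partial>M))"
    by (subst nn_integral_add) auto
  also have "\<dots> \<le> ennreal (1 / 2) * (2 + 2)"
    by (intro mult_left_mono add_mono U W) auto
  also have "\<dots> = ennreal (1 / 2) * ennreal 4" by simp
  also have "\<dots> = 2" by (subst ennreal_mult[symmetric]) auto
  finally show ?thesis .
qed

text \<open>The exponential factor is at most e <= 3. Only one factor is bounded pointwise in the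
  square; the other enters through its second moment, so the variance proxy grows like K^2 instead
  of K^4 for bounded designs. This gives the rate K sqrt (ln p / n).\<close>

lemma (in prob_space) bernstein_moment_bounded:
  assumes U: "AE \<omega> in M. \<bar>U \<omega>\<bar> \<le> a" and W: "AE \<omega> in M. \<bar>W \<omega>\<bar> \<le> b"
    and W2: "integrable M (\<lambda>\<omega>. (W \<omega>)\<^sup>2)" "expectation (\<lambda>\<omega>. (W \<omega>)\<^sup>2) \<le> v"
    and pos: "a > 0" "b > 0" and h: "h * (a * b) \<le> 1" "h \<ge> 0"
  shows "bernstein_moment M h (3 * a\<^sup>2 * v) (\<lambda>\<omega>. U \<omega> * W \<omega>)"
proof -
  have "(\<integral>\<^sup>+\<omega>. ennreal ((U \<omega> * W \<omega>)\<^sup>2 * exp (h * \<bar>U \<omega> * W \<omega>\<bar>)) \<partial>M)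
      \<le> (\<integral>\<^sup>+\<omega>. ennreal (3 * a\<^sup>2 * (W \<omega>)\<^sup>2) \<partial>M)"
  proof (intro nn_integral_mono_AE)
    show "AE \<omega> in M. ennreal ((U \<omega> * W \<omega>)\<^sup>2 * exp (h * \<bar>U \<omega> * W \<omega>\<bar>)) \<le> ennreal (3 * a\<^sup>2 * (W \<omega>)\<^sup>2)"
      using U W
    proof eventually_elim
      case (elim \<omega>)
      have "h * \<bar>U \<omega> * W \<omega>\<bar> \<le> h * (a * b)"
        unfolding abs_mult using elim pos h by (intro mult_left_mono mult_mono) auto
      then have "exp (h * \<bar>U \<omega> * W \<omega>\<bar>) \<le> exp 1" using h by simp
      also have "\<dots> \<le> 3" by (rule exp_le)
      finally have e: "exp (h * \<bar>U \<omega> * W \<omega>\<bar>) \<le> 3" .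
      have "(U \<omega>)\<^sup>2 \<le> a\<^sup>2" using elim pos by (simp add: abs_le_square_iff[symmetric])
      then have "(U \<omega> * W \<omega>)\<^sup>2 * exp (h * \<bar>U \<omega> * W \<omega>\<bar>) \<le> (a\<^sup>2 * (W \<omega>)\<^sup>2) * 3"
        unfolding power_mult_distrib using e by (intro mult_mono) auto
      then show ?case by (intro ennreal_leI) (simp add: mult_ac)
    qed
  qed
  also have "\<dots> = ennreal (3 * a\<^sup>2 * expectation (\<lambda>\<omega>. (W \<omega>)\<^sup>2))"
    using W2 by (subst nn_integral_eq_integral) auto
  also have "\<dots> \<le> ennreal (3 * a\<^sup>2 * v)" using W2 by (intro ennreal_leI mult_left_mono) auto
  finally show ?thesis .
qed

text \<open>With U bounded, h |U W| is at most |W| / (2 C), so the moment bound for W alone applies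
  after extracting a^2.\<close>

lemma (in prob_space) bernstein_moment_bounded_sub_exponential:
  assumes [measurable]: "W \<in> borel_measurable M" and U: "AE \<omega> in M. \<bar>U \<omega>\<bar> \<le> a" and a: "a > 0" and C: "C > 0"
    and W: "sub_exponential M C W"
    and h: "h * (2 * C * a) \<le> 1" "h \<ge> 0"
  shows "bernstein_moment M h (64 * C\<^sup>2 * a\<^sup>2) (\<lambda>\<omega>. U \<omega> * W \<omega>)"
proof -
  have "(\<integral>\<^sup>+\<omega>. ennreal ((U \<omega> * W \<omega>)\<^sup>2 * exp (h * \<bar>U \<omega> * W \<omega>\<bar>)) \<partial>M)
      \<le> (\<integral>\<^sup>+\<omega>. ennreal (a\<^sup>2) * ennreal ((W \<omega>)\<^sup>2 * exp (1 / (2 * C) * \<bar>W \<omega>\<bar>)) \<partial>M)"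
  proof (intro nn_integral_mono_AE)
    show "AE \<omega> in M. ennreal ((U \<omega> * W \<omega>)\<^sup>2 * exp (h * \<bar>U \<omega> * W \<omega>\<bar>)) \<le>
      ennreal (a\<^sup>2) * ennreal ((W \<omega>)\<^sup>2 * exp (1 / (2 * C) * \<bar>W \<omega>\<bar>))"
      using U
    proof eventually_elim
      case (elim \<omega>)
      have "h * \<bar>U \<omega>\<bar> \<le> h * a" using elim h by (intro mult_left_mono) auto
      also have "\<dots> \<le> 1 / (2 * C)" using h C by (simp add: field_simps)
      finally have "h * \<bar>U \<omega>\<bar> * \<bar>W \<omega>\<bar> \<le> 1 / (2 * C) * \<bar>W \<omega>\<bar>" by (intro mult_right_mono) auto
      then have e: "exp (h * \<bar>U \<omega> * W \<omega>\<bar>) \<le> exp (1 / (2 * C) * \<bar>W \<omega>\<bar>)" by (simp add: abs_mult mult.assoc)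
      have "(U \<omega>)\<^sup>2 \<le> a\<^sup>2" using elim a by (simp add: abs_le_square_iff[symmetric])
      then have "(U \<omega> * W \<omega>)\<^sup>2 * exp (h * \<bar>U \<omega> * W \<omega>\<bar>) \<le> (a\<^sup>2 * (W \<omega>)\<^sup>2) * exp (1 / (2 * C) * \<bar>W \<omega>\<bar>)"
        unfolding power_mult_distrib using e by (intro mult_mono) auto
      then show ?case by (subst ennreal_mult[symmetric]) (auto intro!: ennreal_leI simp: mult_ac)
    qed
  qed
  also have "\<dots> = ennreal (a\<^sup>2) * (\<integral>\<^sup>+\<omega>. ennreal ((W \<omega>)\<^sup>2 * exp (1 / (2 * C) * \<bar>W \<omega>\<bar>)) \<partial>M)"
    by (rule nn_integral_cmult) simp
  also have "\<dots> \<le> ennreal (a\<^sup>2) * ennreal (64 * C\<^sup>2)"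
    using C W by (intro mult_left_mono bernstein_moment_sub_exponential) auto
  also have "\<dots> = ennreal (64 * C\<^sup>2 * a\<^sup>2)" by (simp add: ennreal_mult[symmetric] mult_ac)
  finally show ?thesis .
qed

section \<open>Independence\<close>

text \<open>Independence within each family and between the two families makes the joint family
  indexed by \<open>bool\<close> times I independent; grouping it into the pairs with common i then
  gives independent products.\<close>

lemma (in prob_space) indep_vars_mult:
  fixes Z W :: "'i \<Rightarrow> 'a \<Rightarrow> real"
  assumes I: "finite I" "I \<noteq> {}"
    and Z: "indep_vars (\<lambda>_. borel) Z I" and W: "indep_vars (\<lambda>_. borel) W I"
    and ZW: "indep_var (PiM I (\<lambda>_. borel)) (\<lambda>\<omega>. \<lambda>i\<in>I. Z i \<omega>) (PiM I (\<lambda>_. borel)) (\<lambda>\<omega>. \<lambda>i\<in>I. W i \<omega>)"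
  shows "indep_vars (\<lambda>_. borel) (\<lambda>i \<omega>. Z i \<omega> * W i \<omega>) I"
proof -
  define V where "V = (\<lambda>(b, i) \<omega>. if b then Z i \<omega> else W i \<omega>)"
  let ?J = "(UNIV :: bool set) \<times> I"
  have Zm: "Z i \<in> borel_measurable M" and Wm: "W i \<in> borel_measurable M" if "i \<in> I" for i
    using that Z W by (auto simp: indep_vars_def2)
  have Vm: "V x \<in> borel_measurable M" if "x \<in> ?J" for x
    using that Zm Wm by (cases x; cases "fst x") (auto simp: V_def)
  have "indep_vars (\<lambda>_. borel) V ?J"
    unfolding indep_vars_def2
  proof (intro conjI ballI)
    fix x assume "x \<in> ?J"
    then show "random_variable borel (V x)" by (rule Vm)
  next
    let ?F = "\<lambda>x. {V x -` A \<inter> space M |A. A \<in> sets (borel :: real measure)}"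
    have prod: "\<forall>A\<in>Pi ?J ?F. prob (\<Inter>j\<in>?J. A j) = (\<Prod>j\<in>?J. prob (A j))"
    proof
      fix A assume "A \<in> Pi ?J ?F"
      then have "\<forall>x\<in>?J. \<exists>B. A x = V x -` B \<inter> space M \<and> B \<in> sets borel" by auto
      then obtain B where B: "\<And>x. x \<in> ?J \<Longrightarrow> A x = V x -` B x \<inter> space M"
        "\<And>x. x \<in> ?J \<Longrightarrow> B x \<in> sets borel" by metis
      let ?BZ = "PiE I (\<lambda>i. B (True, i))" and ?BW = "PiE I (\<lambda>i. B (False, i))"
      let ?AZ = "\<Inter>i\<in>I. A (True, i)" and ?AW = "\<Inter>i\<in>I. A (False, i)"
      have AZ: "?AZ = (\<lambda>\<omega>. \<lambda>i\<in>I. Z i \<omega>) -` ?BZ \<inter> space M"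
        using I B(1) by (auto simp: V_def PiE_iff)
      have AW: "?AW = (\<lambda>\<omega>. \<lambda>i\<in>I. W i \<omega>) -` ?BW \<inter> space M"
        using I B(1) by (auto simp: V_def PiE_iff)
      have BZ: "?BZ \<in> sets (PiM I (\<lambda>_. borel))" and BW: "?BW \<in> sets (PiM I (\<lambda>_. borel))"
        using I B(2) by (auto intro!: sets_PiM_I_finite)
      have ind: "indep_set
          (sigma_sets (space M) { (\<lambda>\<omega>. \<lambda>i\<in>I. Z i \<omega>) -` A \<inter> space M | A. A \<in> sets (PiM I (\<lambda>_. borel))})
          (sigma_sets (space M) { (\<lambda>\<omega>. \<lambda>i\<in>I. W i \<omega>) -` A \<inter> space M | A. A \<in> sets (PiM I (\<lambda>_. borel))})"
        using ZW unfolding indep_var_eq by blast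
      have "(\<Inter>j\<in>?J. A j) = ?AZ \<inter> ?AW"
      proof -
        have "?J = Pair True ` I \<union> Pair False ` I"
          by (rule Set.set_eqI) (case_tac x; case_tac "fst x"; auto)
        then show ?thesis by (simp only: image_Un Inter_Un_distrib image_image)
      qed
      also have "prob (?AZ \<inter> ?AW) = prob ?AZ * prob ?AW"
        using BZ BW unfolding AZ AW by (intro indep_setD[OF ind] sigma_sets.Basic) auto
      also have "prob ?AZ = (\<Prod>i\<in>I. prob (A (True, i)))"
      proof -
        have eq: "A (True, i) = Z i -` B (True, i) \<inter> space M" if "i \<in> I" for i
          using B(1)[of "(True, i)"] that by (auto simp: V_def)
        have "prob (\<Inter>i\<in>I. Z i -` B (True, i) \<inter> space M) = (\<Prod>i\<in>I. prob (Z i -` B (True, i) \<inter> space M))"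
          using I B(2) by (intro indep_varsD_finite[OF Z]) auto
        then show ?thesis by (simp add: eq)
      qed
      also have "prob ?AW = (\<Prod>i\<in>I. prob (A (False, i)))"
      proof -
        have eq: "A (False, i) = W i -` B (False, i) \<inter> space M" if "i \<in> I" for i
          using B(1)[of "(False, i)"] that by (auto simp: V_def)
        have "prob (\<Inter>i\<in>I. W i -` B (False, i) \<inter> space M) = (\<Prod>i\<in>I. prob (W i -` B (False, i) \<inter> space M))"
          using I B(2) by (intro indep_varsD_finite[OF W]) auto
        then show ?thesis by (simp add: eq)
      qed
      also have "(\<Prod>i\<in>I. prob (A (True, i))) * (\<Prod>i\<in>I. prob (A (False, i))) = (\<Prod>j\<in>?J. prob (A j))"
      proof -
        have "(\<Prod>j\<in>?J. prob (A j)) = (\<Prod>b\<in>UNIV. \<Prod>i\<in>I. prob (A (b, i)))"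
          by (subst prod.cartesian_product) simp
        then show ?thesis by (simp add: UNIV_bool mult.commute)
      qed
      finally show "prob (\<Inter>j\<in>?J. A j) = (\<Prod>j\<in>?J. prob (A j))" .
    qed
    \<comment> \<open>Each generating family contains the whole space, so it suffices to check the
      product formula for the full finite index set.\<close>
    have F: "?F x \<subseteq> events" "space M \<in> ?F x" if "x \<in> ?J" for x
    proof -
      show "?F x \<subseteq> events" using measurable_sets[OF Vm[OF that]] by blast
      show "space M \<in> ?F x" by (intro CollectI exI[of _ UNIV]) simp
    qed
    have "?J \<noteq> {}" "finite ?J" using I by auto
    from iffD2[OF indep_sets_finite[OF this F] prod] show "indep_sets ?F ?J" .
  qed
  then have "indep_vars (\<lambda>i. PiM (UNIV \<times> {i}) (\<lambda>_. borel)) (\<lambda>i \<omega>. restrict (\<lambda>x. V x \<omega>) (UNIV \<times> {i})) I"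
    by (rule indep_vars_restrict) (auto simp: disjoint_family_on_def)
  then have "indep_vars (\<lambda>_. borel)
      (\<lambda>i \<omega>. (\<lambda>f. f (True, i) * f (False, i)) (restrict (\<lambda>x. V x \<omega>) (UNIV \<times> {i}))) I"
    by (rule indep_vars_compose2) measurable
  then show ?thesis by (simp add: V_def)
qed

section \<open>Population quantities of the regression model\<close>

lemma integral_double_sum:
  fixes f :: "'i \<Rightarrow> 'j \<Rightarrow> 'a \<Rightarrow> real"
  assumes f: "\<And>i j. i \<in> I \<Longrightarrow> j \<in> J \<Longrightarrow> integrable M (f i j)"
  shows "(\<integral>x. (\<Sum>i\<in>I. \<Sum>j\<in>J. f i j x) \<partial>M) = (\<Sum>i\<in>I. \<Sum>j\<in>J. \<integral>x. f i j x \<partial>M)"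
proof -
  have "(\<integral>x. (\<Sum>i\<in>I. \<Sum>j\<in>J. f i j x) \<partial>M) = (\<Sum>i\<in>I. \<integral>x. (\<Sum>j\<in>J. f i j x) \<partial>M)"
    using f by (intro Bochner_Integration.integral_sum Bochner_Integration.integrable_sum)
  also have "\<dots> = (\<Sum>i\<in>I. \<Sum>j\<in>J. \<integral>x. f i j x \<partial>M)"
    using f by (intro sum.cong refl Bochner_Integration.integral_sum)
  finally show ?thesis .
qed

lemma design_entry_measurable:
  "i < n \<Longrightarrow> j < p \<Longrightarrow> (\<lambda>A. A i j) \<in> borel_measurable (designs n p)"
  using measurable_compose[OF measurable_component_singleton[of i "{..<n}" "\<lambda>_. vecs {..<p}"]
      measurable_component_singleton[of j "{..<p}"]] by simp

locale regression_model =
  fixes M :: "'a measure" and n p :: nat and X :: "'a \<Rightarrow> nat \<Rightarrow> nat \<Rightarrow> real"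
    and eps :: "'a \<Rightarrow> nat \<Rightarrow> real" and sig2 :: real
  assumes model: "linear_model M n p X eps sig2" and n: "n \<ge> 1" and p: "p \<ge> 1"

sublocale regression_model \<subseteq> prob_space M
  using model by (simp add: linear_model_def)

context regression_model
begin

lemma X_measurable [measurable]: "X \<in> M \<rightarrow>\<^sub>M designs n p"
  and eps_measurable [measurable]: "eps \<in> M \<rightarrow>\<^sub>M vecs {..<n}"
  using model by (simp_all add: linear_model_def)

lemma row_measurable: "i < n \<Longrightarrow> (\<lambda>\<omega>. X \<omega> i) \<in> M \<rightarrow>\<^sub>M vecs {..<p}"
  using measurable_compose[OF X_measurable measurable_component_singleton[of i]] by simp

lemma entry_measurable [measurable]:
  "i < n \<Longrightarrow> j < p \<Longrightarrow> (\<lambda>\<omega>. X \<omega> i j) \<in> borel_measurable M"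
  using measurable_compose[OF row_measurable measurable_component_singleton[of j]] by simp

lemma eps_entry_measurable [measurable]: "i < n \<Longrightarrow> (\<lambda>\<omega>. eps \<omega> i) \<in> borel_measurable M"
  using measurable_compose[OF eps_measurable measurable_component_singleton[of i]] by simp

lemma square_integrable: "i < n \<Longrightarrow> j < p \<Longrightarrow> integrable M (\<lambda>\<omega>. (X \<omega> i j)\<^sup>2)"
  and entry_mean: "i < n \<Longrightarrow> j < p \<Longrightarrow> expectation (\<lambda>\<omega>. X \<omega> i j) = 0"
  and eps_square_integrable: "i < n \<Longrightarrow> integrable M (\<lambda>\<omega>. (eps \<omega> i)\<^sup>2)"
  and eps_mean: "i < n \<Longrightarrow> expectation (\<lambda>\<omega>. eps \<omega> i) = 0"
  and eps_variance: "i < n \<Longrightarrow> expectation (\<lambda>\<omega>. (eps \<omega> i)\<^sup>2) = sig2"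
  and rows_indep: "indep_vars (\<lambda>_. vecs {..<p}) (\<lambda>i \<omega>. X \<omega> i) {..<n}"
  and eps_indep: "indep_vars (\<lambda>_. borel) (\<lambda>i \<omega>. eps \<omega> i) {..<n}"
  using model by (simp_all add: linear_model_def)

lemma design_noise_indep:
  assumes f: "f \<in> designs n p \<rightarrow>\<^sub>M N" and g: "g \<in> vecs {..<n} \<rightarrow>\<^sub>M N'"
  shows "indep_var N (\<lambda>\<omega>. f (X \<omega>)) N' (\<lambda>\<omega>. g (eps \<omega>))"
proof -
  let ?X = "sets (vimage_algebra (space M) X (designs n p))"
  let ?E = "sets (vimage_algebra (space M) eps (vecs {..<n}))"
  have ind: "indep_set ?X ?E" using model by (simp add: linear_model_def)
  have X: "(\<lambda>\<omega>. f (X \<omega>)) -` A \<inter> space M \<in> ?X" if "A \<in> sets N" for A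
  proof -
    have "X -` (f -` A \<inter> space (designs n p)) \<inter> space M \<in> ?X"
      by (intro in_vimage_algebra measurable_sets[OF f that])
    also have "X -` (f -` A \<inter> space (designs n p)) \<inter> space M = (\<lambda>\<omega>. f (X \<omega>)) -` A \<inter> space M"
      using measurable_space[OF X_measurable] by auto
    finally show ?thesis .
  qed
  have E: "(\<lambda>\<omega>. g (eps \<omega>)) -` A \<inter> space M \<in> ?E" if "A \<in> sets N'" for A
  proof -
    have "eps -` (g -` A \<inter> space (vecs {..<n})) \<inter> space M \<in> ?E"
      by (intro in_vimage_algebra measurable_sets[OF g that])
    also have "eps -` (g -` A \<inter> space (vecs {..<n})) \<inter> space M = (\<lambda>\<omega>. g (eps \<omega>)) -` A \<inter> space M"
      using measurable_space[OF eps_measurable] by auto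
    finally show ?thesis .
  qed
  have gen: "{(\<lambda>\<omega>. f (X \<omega>)) -` A \<inter> space M |A. A \<in> sets N} \<subseteq> ?X"
    "{(\<lambda>\<omega>. g (eps \<omega>)) -` A \<inter> space M |A. A \<in> sets N'} \<subseteq> ?E"
    using X E by auto
  have sub: "sigma_sets (space M) {(\<lambda>\<omega>. f (X \<omega>)) -` A \<inter> space M |A. A \<in> sets N} \<subseteq> ?X"
    "sigma_sets (space M) {(\<lambda>\<omega>. g (eps \<omega>)) -` A \<inter> space M |A. A \<in> sets N'} \<subseteq> ?E"
    using sets.sigma_sets_subset[OF gen(1)] sets.sigma_sets_subset[OF gen(2)]
    by (simp_all only: space_vimage_algebra)
  have "indep_set (sigma_sets (space M) {(\<lambda>\<omega>. f (X \<omega>)) -` A \<inter> space M |A. A \<in> sets N})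
      (sigma_sets (space M) {(\<lambda>\<omega>. g (eps \<omega>)) -` A \<inter> space M |A. A \<in> sets N'})"
    using ind unfolding indep_set_def
  proof (rule indep_sets_mono_sets)
    fix b :: bool
    show "case_bool (sigma_sets (space M) {(\<lambda>\<omega>. f (X \<omega>)) -` A \<inter> space M |A. A \<in> sets N})
      (sigma_sets (space M) {(\<lambda>\<omega>. g (eps \<omega>)) -` A \<inter> space M |A. A \<in> sets N'}) b \<subseteq> case_bool ?X ?E b"
      using sub by (cases b) (simp_all only: bool.case)
  qed
  then show ?thesis
    unfolding indep_var_eq
    using measurable_compose[OF X_measurable f] measurable_compose[OF eps_measurable g] by simp
qed

lemma integrable_mult_square:
  fixes f g :: "'a \<Rightarrow> real"
  assumes [measurable]: "f \<in> borel_measurable M" "g \<in> borel_measurable M"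
    and "integrable M (\<lambda>\<omega>. (f \<omega>)\<^sup>2)" "integrable M (\<lambda>\<omega>. (g \<omega>)\<^sup>2)"
  shows "integrable M (\<lambda>\<omega>. f \<omega> * g \<omega>)"
proof (rule Bochner_Integration.integrable_bound)
  show "integrable M (\<lambda>\<omega>. (f \<omega>)\<^sup>2 + (g \<omega>)\<^sup>2)" using assms by simp
  show "AE \<omega> in M. norm (f \<omega> * g \<omega>) \<le> norm ((f \<omega>)\<^sup>2 + (g \<omega>)\<^sup>2)"
  proof (rule AE_I2)
    fix \<omega>
    have "0 \<le> (\<bar>f \<omega>\<bar> - \<bar>g \<omega>\<bar>)\<^sup>2" by simp
    then have "2 * \<bar>f \<omega> * g \<omega>\<bar> \<le> (f \<omega>)\<^sup>2 + (g \<omega>)\<^sup>2" by (simp add: power2_diff abs_mult)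
    then show "norm (f \<omega> * g \<omega>) \<le> norm ((f \<omega>)\<^sup>2 + (g \<omega>)\<^sup>2)" by simp
  qed
qed simp

definition S :: "nat \<Rightarrow> nat \<Rightarrow> real" where
  "S j k = expectation (\<lambda>\<omega>. X \<omega> 0 j * X \<omega> 0 k)"

lemma covariance_S: "j < p \<Longrightarrow> k < p \<Longrightarrow> covariance M p X $$ (j, k) = S j k"
  by (simp add: covariance_def S_def)

lemma S_sym: "S j k = S k j" by (simp add: S_def mult.commute)

lemma covariance_carrier: "covariance M p X \<in> carrier_mat p p"
  by (simp add: covariance_def)

text \<open>Unit vectors a give the entries of the design and \<open>u\<close> gives the population
  residual, so the moments and independence of all products of these are treated at once.\<close>

definition lin :: "(nat \<Rightarrow> real) \<Rightarrow> 'a \<Rightarrow> nat \<Rightarrow> real" where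
  "lin a \<omega> i = (\<Sum>k<p. a k * X \<omega> i k)"

lemma lin_measurable [measurable]: "i < n \<Longrightarrow> (\<lambda>\<omega>. lin a \<omega> i) \<in> borel_measurable M"
  unfolding lin_def by (intro borel_measurable_sum) auto

lemma entry_eq_lin: "j < p \<Longrightarrow> X \<omega> i j = lin (\<lambda>k. if k = j then 1 else 0) \<omega> i"
  by (simp add: lin_def sum_delta_mult)

lemma entry_product_integrable: "i < n \<Longrightarrow> j < p \<Longrightarrow> k < p \<Longrightarrow> integrable M (\<lambda>\<omega>. X \<omega> i j * X \<omega> i k)"
  by (intro integrable_mult_square square_integrable) auto

lemma row_integral_eq:
  fixes f :: "(nat \<Rightarrow> real) \<Rightarrow> real"
  assumes i: "i < n" and f: "f \<in> borel_measurable (vecs {..<p})"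
  shows "expectation (\<lambda>\<omega>. f (X \<omega> i)) = expectation (\<lambda>\<omega>. f (X \<omega> 0))"
proof -
  have "distr M (vecs {..<p}) (\<lambda>\<omega>. X \<omega> i) = distr M (vecs {..<p}) (\<lambda>\<omega>. X \<omega> 0)"
    using model i unfolding linear_model_def by blast
  then have "integral\<^sup>L (distr M (vecs {..<p}) (\<lambda>\<omega>. X \<omega> i)) f =
      integral\<^sup>L (distr M (vecs {..<p}) (\<lambda>\<omega>. X \<omega> 0)) f" by simp
  then show ?thesis
    using i n f by (simp add: integral_distr row_measurable)
qed

lemma entry_product_expectation:
  "i < n \<Longrightarrow> j < p \<Longrightarrow> k < p \<Longrightarrow> expectation (\<lambda>\<omega>. X \<omega> i j * X \<omega> i k) = S j k"
  unfolding S_def by (rule row_integral_eq[of i "\<lambda>x. x j * x k"]) auto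

lemma lin_product:
  "lin a \<omega> i * lin b \<omega> i = (\<Sum>j<p. \<Sum>k<p. (a j * b k) * (X \<omega> i j * X \<omega> i k))"
  unfolding lin_def sum_product by (intro sum.cong refl) (simp add: mult_ac)

lemma lin_product_integrable: "i < n \<Longrightarrow> integrable M (\<lambda>\<omega>. lin a \<omega> i * lin b \<omega> i)"
  unfolding lin_product
  by (intro Bochner_Integration.integrable_sum integrable_mult_right entry_product_integrable) auto

lemma lin_product_expectation:
  assumes i: "i < n"
  shows "expectation (\<lambda>\<omega>. lin a \<omega> i * lin b \<omega> i) = (\<Sum>j<p. a j * (\<Sum>k<p. S j k * b k))"
proof -
  have "expectation (\<lambda>\<omega>. lin a \<omega> i * lin b \<omega> i) =
      (\<Sum>j<p. \<Sum>k<p. expectation (\<lambda>\<omega>. (a j * b k) * (X \<omega> i j * X \<omega> i k)))"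
    unfolding lin_product using i entry_product_integrable by (intro integral_double_sum) auto
  also have "\<dots> = (\<Sum>j<p. \<Sum>k<p. (a j * b k) * S j k)"
    using i by (intro sum.cong refl) (simp add: entry_product_expectation)
  also have "\<dots> = (\<Sum>j<p. a j * (\<Sum>k<p. S j k * b k))"
    unfolding sum_distrib_left by (intro sum.cong refl) (simp add: mult_ac)
  finally show ?thesis .
qed

lemma lin_square_expectation:
  assumes i: "i < n"
  shows "expectation (\<lambda>\<omega>. (lin a \<omega> i)\<^sup>2) = quad_form p S a"
proof -
  have "(\<Sum>j<p. a j * (\<Sum>k<p. S j k * a k)) = quad_form p S a"
    unfolding quad_form_def sum_distrib_left by (intro sum.cong refl) (simp add: mult_ac)
  then show ?thesis unfolding power2_eq_square lin_product_expectation[OF i] .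
qed

lemma lin_square_integrable: "i < n \<Longrightarrow> integrable M (\<lambda>\<omega>. (lin a \<omega> i)\<^sup>2)"
  unfolding power2_eq_square by (rule lin_product_integrable)

lemma lin_products_indep: "indep_vars (\<lambda>_. borel) (\<lambda>i \<omega>. lin a \<omega> i * lin b \<omega> i) {..<n}"
  unfolding lin_def
  by (rule indep_vars_compose2[OF rows_indep, where Y = "\<lambda>i x. (\<Sum>k<p. a k * x k) * (\<Sum>k<p. b k * x k)"])
    measurable

lemma design_noise_expectation:
  fixes f :: "(nat \<Rightarrow> nat \<Rightarrow> real) \<Rightarrow> real" and g :: "(nat \<Rightarrow> real) \<Rightarrow> real"
  assumes f: "f \<in> borel_measurable (designs n p)" and g: "g \<in> borel_measurable (vecs {..<n})"
    and int: "integrable M (\<lambda>\<omega>. f (X \<omega>))" "integrable M (\<lambda>\<omega>. g (eps \<omega>))"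
  shows "expectation (\<lambda>\<omega>. f (X \<omega>) * g (eps \<omega>)) = expectation (\<lambda>\<omega>. f (X \<omega>)) * expectation (\<lambda>\<omega>. g (eps \<omega>))"
    and "integrable M (\<lambda>\<omega>. f (X \<omega>) * g (eps \<omega>))"
proof -
  note ind = design_noise_indep[OF f g]
  show "expectation (\<lambda>\<omega>. f (X \<omega>) * g (eps \<omega>)) = expectation (\<lambda>\<omega>. f (X \<omega>)) * expectation (\<lambda>\<omega>. g (eps \<omega>))"
    and "integrable M (\<lambda>\<omega>. f (X \<omega>) * g (eps \<omega>))"
    using indep_var_lebesgue_integral[OF ind int] indep_var_integrable[OF ind int] by auto
qed

lemma entry_integrable: "i < n \<Longrightarrow> j < p \<Longrightarrow> integrable M (\<lambda>\<omega>. X \<omega> i j)"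
  using integrable_mult_square[of "\<lambda>\<omega>. X \<omega> i j" "\<lambda>_. 1"] square_integrable[of i j] by simp

lemma eps_integrable: "i < n \<Longrightarrow> integrable M (\<lambda>\<omega>. eps \<omega> i)"
  using integrable_mult_square[of "\<lambda>\<omega>. eps \<omega> i" "\<lambda>_. 1"] eps_square_integrable[of i] by simp

lemma entry_noise_mean:
  assumes "i < n" "j < p"
  shows "expectation (\<lambda>\<omega>. X \<omega> i j * eps \<omega> i) = 0"
  using assms design_noise_expectation(1)[of "\<lambda>A. A i j" "\<lambda>e. e i"]
  by (simp add: design_entry_measurable entry_integrable eps_integrable entry_mean)

lemma entry_noise_indep:
  assumes j: "j < p"
  shows "indep_vars (\<lambda>_. borel) (\<lambda>i \<omega>. X \<omega> i j * eps \<omega> i) {..<n}"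
proof (rule indep_vars_mult)
  show "indep_vars (\<lambda>_. borel) (\<lambda>i \<omega>. X \<omega> i j) {..<n}"
    using j by (intro indep_vars_compose2[OF rows_indep]) measurable
  show "indep_vars (\<lambda>_. borel) (\<lambda>i \<omega>. eps \<omega> i) {..<n}" by (rule eps_indep)
  show "indep_var (vecs {..<n}) (\<lambda>\<omega>. \<lambda>i\<in>{..<n}. X \<omega> i j) (vecs {..<n}) (\<lambda>\<omega>. \<lambda>i\<in>{..<n}. eps \<omega> i)"
    using j by (intro design_noise_indep measurable_restrict design_entry_measurable) auto
qed (use n in \<open>auto simp: lessThan_empty_iff\<close>)

text \<open>Chebyshev's inequality for the noise, with weights depending on the design: they are
  normalised to unit length so that they are bounded.\<close>

lemma weighted_noise_tail:
  fixes w :: "(nat \<Rightarrow> nat \<Rightarrow> real) \<Rightarrow> nat \<Rightarrow> real"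
  assumes w: "\<And>i. i < n \<Longrightarrow> (\<lambda>A. w A i) \<in> borel_measurable (designs n p)" and s: "s > 0"
  shows "prob {\<omega> \<in> space M. \<bar>\<Sum>i<n. w (X \<omega>) i * eps \<omega> i\<bar> > s * sqrt (\<Sum>i<n. (w (X \<omega>) i)\<^sup>2)} \<le> sig2 / s\<^sup>2"
proof -
  define Q where "Q A = sqrt (\<Sum>i<n. (w A i)\<^sup>2)" for A
  \<comment> \<open>If all weights vanish, division by zero makes v zero, and the bounds below still
    hold.\<close>
  define v where "v A i = w A i / Q A" for A i
  have Qm: "Q \<in> borel_measurable (designs n p)"
    unfolding Q_def using w by (intro measurable_compose[OF _ borel_measurable_sqrt] borel_measurable_sum borel_measurable_power) auto
  have vm: "(\<lambda>A. v A i) \<in> borel_measurable (designs n p)" if "i < n" for i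
    unfolding v_def using w[OF that] Qm by simp
  have vle: "\<bar>v A i\<bar> \<le> 1" if "i < n" for A i
  proof -
    have "(w A i)\<^sup>2 \<le> (\<Sum>i<n. (w A i)\<^sup>2)" using that by (intro member_le_sum) auto
    then have "\<bar>w A i\<bar> \<le> Q A" unfolding Q_def by (metis real_sqrt_abs real_sqrt_le_iff)
    then show ?thesis unfolding v_def by (cases "Q A = 0") (auto simp: divide_le_eq)
  qed
  have sum_v: "(\<Sum>i<n. (v A i)\<^sup>2) \<le> 1" for A
  proof -
    have "(\<Sum>i<n. (v A i)\<^sup>2) = (\<Sum>i<n. (w A i)\<^sup>2) / (Q A)\<^sup>2"
      by (simp add: v_def power_divide sum_divide_distrib)
    also have "(Q A)\<^sup>2 = (\<Sum>i<n. (w A i)\<^sup>2)" by (simp add: Q_def sum_nonneg)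
    finally show ?thesis by simp
  qed
  have int2: "integrable M (\<lambda>\<omega>. v (X \<omega>) i * v (X \<omega>) k)" if "i < n" "k < n" for i k
  proof (rule integrable_const_bound[where B = 1])
    show "AE \<omega> in M. norm (v (X \<omega>) i * v (X \<omega>) k) \<le> 1"
      using vle that by (intro AE_I2) (simp add: abs_mult mult_le_one)
    show "(\<lambda>\<omega>. v (X \<omega>) i * v (X \<omega>) k) \<in> borel_measurable M"
      using measurable_compose[OF X_measurable vm[OF that(1)]] measurable_compose[OF X_measurable vm[OF that(2)]] by simp
  qed
  have epsint: "integrable M (\<lambda>\<omega>. eps \<omega> i * eps \<omega> k)" if "i < n" "k < n" for i k
    using that by (intro integrable_mult_square eps_square_integrable) auto
  have eps_cov: "expectation (\<lambda>\<omega>. eps \<omega> i * eps \<omega> k) = (if i = k then sig2 else 0)" if "i < n" "k < n" for i k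
  proof (cases "i = k")
    case True
    then show ?thesis using eps_variance[OF that(1)] by (simp add: power2_eq_square)
  next
    case False
    have "indep_vars (\<lambda>_. borel) (\<lambda>i \<omega>. eps \<omega> i) {i, k}"
      using that by (intro indep_vars_subset[OF eps_indep]) auto
    moreover have "integrable M (\<lambda>\<omega>. eps \<omega> x)" if "x \<in> {i, k}" for x
      using that \<open>i < n\<close> \<open>k < n\<close> eps_integrable by auto
    ultimately have "expectation (\<lambda>\<omega>. \<Prod>x\<in>{i, k}. eps \<omega> x) = (\<Prod>x\<in>{i, k}. expectation (\<lambda>\<omega>. eps \<omega> x))"
      by (intro indep_vars_lebesgue_integral) auto
    then show ?thesis using that False by (simp add: eps_mean)
  qed
  let ?f = "\<lambda>i k \<omega>. (v (X \<omega>) i * v (X \<omega>) k) * (eps \<omega> i * eps \<omega> k)"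
  have vm2: "(\<lambda>A. v A i * v A k) \<in> borel_measurable (designs n p)" if "i < n" "k < n" for i k
    using vm that by simp
  have em2: "(\<lambda>e. e i * e k) \<in> borel_measurable (vecs {..<n})" if "i < n" "k < n" for i k
    using that by simp
  \<comment> \<open>Since v is bounded and depends on the design only, expectations factor; off the
    diagonal the errors are uncorrelated, so only the squares survive.\<close>
  have E: "expectation (?f i k) = expectation (\<lambda>\<omega>. v (X \<omega>) i * v (X \<omega>) k) * (if i = k then sig2 else 0)"
    and I: "integrable M (?f i k)" if "i < n" "k < n" for i k
    using design_noise_expectation[OF vm2[OF that] em2[OF that] int2[OF that] epsint[OF that]] eps_cov[OF that] by auto
  define T where "T \<omega> = (\<Sum>i<n. v (X \<omega>) i * eps \<omega> i)" for \<omega>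
  have T2: "(T \<omega>)\<^sup>2 = (\<Sum>i<n. \<Sum>k<n. ?f i k \<omega>)" for \<omega>
    unfolding T_def power2_eq_square sum_product by (intro sum.cong refl) (simp add: mult_ac)
  have T2i: "integrable M (\<lambda>\<omega>. (T \<omega>)\<^sup>2)"
    unfolding T2 using I by (intro Bochner_Integration.integrable_sum) auto
  have Tm: "T \<in> borel_measurable M"
    unfolding T_def using measurable_compose[OF X_measurable vm]
    by (intro borel_measurable_sum borel_measurable_times) auto
  have "0 \<le> expectation (\<lambda>\<omega>. (eps \<omega> 0)\<^sup>2)" by (intro Bochner_Integration.integral_nonneg) simp
  then have sig: "sig2 \<ge> 0" using eps_variance[of 0] n by simp
  have "expectation (\<lambda>\<omega>. (T \<omega>)\<^sup>2) = (\<Sum>i<n. \<Sum>k<n. expectation (?f i k))"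
    unfolding T2 using I by (intro integral_double_sum) auto
  also have "\<dots> = (\<Sum>i<n. \<Sum>k<n. if k = i then expectation (\<lambda>\<omega>. (v (X \<omega>) i)\<^sup>2) * sig2 else 0)"
    using E by (intro sum.cong refl) (auto simp: power2_eq_square)
  also have "\<dots> = (\<Sum>i<n. expectation (\<lambda>\<omega>. (v (X \<omega>) i)\<^sup>2) * sig2)" by simp
  also have "\<dots> = expectation (\<lambda>\<omega>. \<Sum>i<n. (v (X \<omega>) i)\<^sup>2) * sig2"
    using int2 by (subst Bochner_Integration.integral_sum) (auto simp: power2_eq_square sum_distrib_right)
  also have "\<dots> \<le> expectation (\<lambda>\<omega>. 1) * sig2"
    using int2 sum_v sig
    by (intro mult_right_mono integral_mono Bochner_Integration.integrable_sum) (auto simp: power2_eq_square)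
  finally have ET: "expectation (\<lambda>\<omega>. (T \<omega>)\<^sup>2) \<le> sig2" by (simp add: prob_space)
  have "prob {\<omega> \<in> space M. \<bar>\<Sum>i<n. w (X \<omega>) i * eps \<omega> i\<bar> > s * Q (X \<omega>)} \<le> prob {\<omega> \<in> space M. (T \<omega>)\<^sup>2 \<ge> s\<^sup>2}"
  proof (intro finite_measure_mono)
    show "{\<omega> \<in> space M. \<bar>\<Sum>i<n. w (X \<omega>) i * eps \<omega> i\<bar> > s * Q (X \<omega>)} \<subseteq> {\<omega> \<in> space M. (T \<omega>)\<^sup>2 \<ge> s\<^sup>2}"
    proof safe
      fix \<omega> assume *: "\<bar>\<Sum>i<n. w (X \<omega>) i * eps \<omega> i\<bar> > s * Q (X \<omega>)"
      have Q0: "Q (X \<omega>) \<ge> 0" by (simp add: Q_def sum_nonneg)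
      \<comment> \<open>The strict inequality excludes vanishing weights, so dividing by Q loses
        nothing.\<close>
      have "Q (X \<omega>) \<noteq> 0"
      proof
        assume "Q (X \<omega>) = 0"
        then have "\<forall>i<n. w (X \<omega>) i = 0" unfolding Q_def by (auto simp: sum_nonneg_eq_0_iff)
        then show False using * \<open>Q (X \<omega>) = 0\<close> by simp
      qed
      then have Q: "Q (X \<omega>) > 0" using Q0 by simp
      have "T \<omega> = (\<Sum>i<n. w (X \<omega>) i * eps \<omega> i) / Q (X \<omega>)"
        by (simp add: T_def v_def sum_divide_distrib)
      then have "\<bar>T \<omega>\<bar> > s" using * Q by (simp add: abs_divide pos_less_divide_eq)
      then have "s\<^sup>2 \<le> \<bar>T \<omega>\<bar>\<^sup>2" using s by (intro power_mono) auto
      then show "s\<^sup>2 \<le> (T \<omega>)\<^sup>2" by simp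
    qed
    show "{\<omega> \<in> space M. (T \<omega>)\<^sup>2 \<ge> s\<^sup>2} \<in> events" using Tm by measurable
  qed
  also have "\<dots> \<le> expectation (\<lambda>\<omega>. (T \<omega>)\<^sup>2) / s\<^sup>2"
    using T2i s by (intro integral_Markov_inequality_measure[where A = "{}"]) auto
  also have "\<dots> \<le> sig2 / s\<^sup>2" using ET by (intro divide_right_mono) auto
  finally show ?thesis unfolding Q_def .
qed

end

section \<open>Population regression of one column on the others\<close>

locale regression_row = regression_model +
  fixes c Cd :: real and j :: nat
  assumes c: "c > 0" and pd: "\<And>x. c * (\<Sum>k<p. (x k)\<^sup>2) \<le> quad_form p S x"
    and diag: "\<And>k. k < p \<Longrightarrow> S k k \<le> Cd" and j: "j < p"
begin

definition \<theta> :: real where "\<theta> = precision M p X $$ (j, j)"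

sublocale R: inverse_row p j S "\<lambda>k. precision M p X $$ (j, k)" c
proof
  fix k assume k: "k < p"
  have quad: "quad_form p (\<lambda>j k. covariance M p X $$ (j, k)) = quad_form p S"
    unfolding quad_form_def by (intro ext sum.cong refl) (simp add: covariance_S)
  have "(\<Sum>l<p. the (mat_inverse (covariance M p X)) $$ (j, l) * covariance M p X $$ (l, k)) =
      (if j = k then 1 else 0)"
    using covariance_carrier c pd j k by (intro mat_inverse_of_definite[where c = c]) (auto simp: quad)
  then show "(\<Sum>l<p. precision M p X $$ (j, l) * S l k) = (if j = k then 1 else 0)"
    using k by (simp add: precision_def covariance_S)
qed (use S_sym j c pd in auto)

lemma theta_pos: "\<theta> > 0" using R.diag_pos by (simp add: \<theta>_def)

lemma inverse_theta_le: "1 / \<theta> \<le> Cd" using R.inverse_diag_le diag[OF j] by (simp add: \<theta>_def)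

lemma theta_le: "\<theta> \<le> 1 / c"
  using R.diag_le theta_pos c unfolding \<theta>_def[symmetric] by (simp add: field_simps)

abbreviation u :: "nat \<Rightarrow> real" where "u \<equiv> R.u"

lemma sum_u_square_le: "(\<Sum>k<p. (u k)\<^sup>2) \<le> Cd / c"
proof -
  have "c * (\<Sum>k<p. (u k)\<^sup>2) \<le> Cd"
    using R.sum_u_le inverse_theta_le unfolding \<theta>_def by linarith
  then show ?thesis using c by (simp add: field_simps)
qed

text \<open>Cauchy-Schwarz over the nonzero off-diagonal entries of row j, whose number is
  s_j.\<close>

lemma sum_u_off_diag:
  "(\<Sum>k\<in>{..<p} - {j}. \<bar>u k\<bar>) \<le> sqrt (row_sparsity M p X j) * sqrt (Cd / c)"
proof -
  define T where "T = {k. k < p \<and> k \<noteq> j \<and> precision M p X $$ (j, k) \<noteq> 0}"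
  have T: "finite T" "T \<subseteq> {..<p} - {j}" "card T = row_sparsity M p X j"
    by (auto simp: T_def row_sparsity_def)
  have "(\<Sum>k\<in>{..<p} - {j}. \<bar>u k\<bar>) = (\<Sum>k\<in>T. \<bar>u k\<bar>)"
    using T by (intro sum.mono_neutral_right) (auto simp: T_def R.u_def)
  also have "\<dots> \<le> sqrt (row_sparsity M p X j * (Cd / c))"
  proof (rule real_le_rsqrt)
    have "(\<Sum>k\<in>T. \<bar>u k\<bar>)\<^sup>2 \<le> (\<Sum>k\<in>T. 1\<^sup>2) * (\<Sum>k\<in>T. \<bar>u k\<bar>\<^sup>2)"
      using Cauchy_Schwarz_ineq_sum[of "\<lambda>_. 1" "\<lambda>k. \<bar>u k\<bar>" T] by simp
    also have "\<dots> = row_sparsity M p X j * (\<Sum>k\<in>T. (u k)\<^sup>2)" using T by simp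
    also have "(\<Sum>k\<in>T. (u k)\<^sup>2) \<le> (\<Sum>k<p. (u k)\<^sup>2)"
      using T by (intro sum_mono2) auto
    also note sum_u_square_le
    finally show "(\<Sum>k\<in>T. \<bar>u k\<bar>)\<^sup>2 \<le> row_sparsity M p X j * (Cd / c)"
      by (simp add: mult_left_mono)
  qed
  finally show ?thesis by (simp only: real_sqrt_mult)
qed

lemma sum_split_j: "(\<Sum>k<p. f k) = f j + (\<Sum>k\<in>{..<p} - {j}. f k)" for f :: "nat \<Rightarrow> real"
  using j by (intro sum.remove) auto

text \<open>The objective is n times the form of the vector with 1 at j and -g elsewhere. By
  \<open>quad_form_decomp\<close> its minimum is n / \<theta>, attained at -u, and definiteness
  makes the minimiser unique. As \<open>arg_min\<close> is a choice, the explicit minimiser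
  \<open>g0\<close> is needed to know that the chosen function minimises at all.\<close>

lemma pop_gamma_eq:
  assumes k: "k \<in> {..<p} - {j}"
  shows "pop_gamma M n p X j k = - u k"
proof -
  let ?I = "{..<p} - {j}"
  let ?f = "\<lambda>g. \<integral>\<omega>. (\<Sum>i<n. (X \<omega> i j - (\<Sum>k\<in>?I. X \<omega> i k * g k))\<^sup>2) \<partial>M"
  define ext where "ext g k = (if k = j then 1 else - g k)" for g :: "nat \<Rightarrow> real" and k
  have f: "?f g = n * quad_form p S (ext g)" for g
  proof -
    have *: "X \<omega> i j - (\<Sum>k\<in>?I. X \<omega> i k * g k) = lin (ext g) \<omega> i" for \<omega> i
    proof -
      have "(\<Sum>k\<in>?I. ext g k * X \<omega> i k) = - (\<Sum>k\<in>?I. X \<omega> i k * g k)"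
        unfolding sum_negf[symmetric] by (intro sum.cong) (auto simp: ext_def)
      then show ?thesis unfolding lin_def sum_split_j by (simp add: ext_def)
    qed
    have "?f g = (\<integral>\<omega>. (\<Sum>i<n. (lin (ext g) \<omega> i)\<^sup>2) \<partial>M)" unfolding * ..
    also have "\<dots> = (\<Sum>i<n. expectation (\<lambda>\<omega>. (lin (ext g) \<omega> i)\<^sup>2))"
      by (rule Bochner_Integration.integral_sum) (simp add: lin_square_integrable)
    also have "\<dots> = n * quad_form p S (ext g)" by (simp add: lin_square_expectation)
    finally show ?thesis .
  qed
  have decomp: "quad_form p S (ext g) = 1 / \<theta> + quad_form p S (\<lambda>k. ext g k - u k)" for g
    unfolding \<theta>_def by (rule R.quad_form_decomp) (simp add: ext_def)
  have nonneg: "0 \<le> quad_form p S x" for x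
    using pd[of x] c by (meson mult_nonneg_nonneg order_trans less_imp_le sum_nonneg zero_le_power2)
  define g0 where "g0 = restrict (\<lambda>k. - u k) ?I"
  have g0_ext: "g0 \<in> extensional ?I" by (simp add: g0_def)
  have ext0: "quad_form p S (ext g0) = 1 / \<theta>"
  proof -
    have "quad_form p S (\<lambda>k. ext g0 k - u k) = 0"
      unfolding quad_form_def by (intro sum.neutral ballI) (auto simp: ext_def g0_def R.u_j)
    then show ?thesis unfolding decomp by simp
  qed
  let ?P = "\<lambda>g. g \<in> extensional ?I"
  have "is_arg_min ?f ?P g0"
    unfolding is_arg_min_linorder
  proof (intro conjI allI impI)
    fix g
    have "quad_form p S (ext g0) \<le> quad_form p S (ext g)"
      using ext0 decomp[of g] nonneg[of "\<lambda>k. ext g k - u k"] by linarith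
    then show "?f g0 \<le> ?f g" unfolding f by (intro mult_left_mono) auto
  qed (simp add: g0_def)
  then have "is_arg_min ?f ?P (arg_min ?f ?P)"
    unfolding arg_min_def by (rule someI[of "is_arg_min ?f ?P"])
  then have am: "is_arg_min ?f ?P (pop_gamma M n p X j)" by (simp add: pop_gamma_def)
  define g where "g = pop_gamma M n p X j"
  have "?f g \<le> ?f g0"
    using am g0_ext unfolding is_arg_min_linorder g_def[symmetric] by blast
  then have "real n * quad_form p S (ext g) \<le> real n * (1 / \<theta>)" unfolding f ext0 .
  moreover have "real n > 0" using n by simp
  ultimately have "quad_form p S (ext g) \<le> 1 / \<theta>" by (rule mult_left_le_imp_le)
  then have "quad_form p S (\<lambda>k. ext g k - u k) \<le> 0" unfolding decomp by simp
  then have "c * (\<Sum>k<p. (ext g k - u k)\<^sup>2) \<le> 0" using pd[of "\<lambda>k. ext g k - u k"] by simp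
  then have "(\<Sum>k<p. (ext g k - u k)\<^sup>2) = 0" using c by (simp add: mult_le_0_iff antisym sum_nonneg)
  then have "\<forall>k<p. ext g k = u k" by (auto simp: sum_nonneg_eq_0_iff)
  then have "ext g k = u k" using k by auto
  then show ?thesis using k by (simp add: ext_def g_def)
qed

lemma pop_fit_eq: "pop_fit M n p X j \<omega> i = X \<omega> i j - lin u \<omega> i"
proof -
  have "pop_fit M n p X j \<omega> i = - (\<Sum>k\<in>{..<p} - {j}. u k * X \<omega> i k)"
    unfolding pop_fit_def sum_negf[symmetric] by (intro sum.cong refl) (simp add: pop_gamma_eq)
  then show ?thesis unfolding lin_def sum_split_j by (simp add: R.u_j)
qed

lemma regression_eq:
  "X \<omega> i j = (\<Sum>k\<in>{..<p} - {j}. X \<omega> i k * - u k) + lin u \<omega> i"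
proof -
  have "(\<Sum>k\<in>{..<p} - {j}. X \<omega> i k * - u k) = - (\<Sum>k\<in>{..<p} - {j}. u k * X \<omega> i k)"
    unfolding sum_negf[symmetric] by (intro sum.cong refl) (simp add: mult.commute)
  then show ?thesis unfolding lin_def sum_split_j by (simp add: R.u_j)
qed

lemma lin_u_square_expectation: "i < n \<Longrightarrow> expectation (\<lambda>\<omega>. (lin u \<omega> i)\<^sup>2) = 1 / \<theta>"
  by (simp add: lin_square_expectation R.quad_form_u \<theta>_def)

lemma lin_u_entry_expectation:
  assumes "i < n" "k < p" "k \<noteq> j"
  shows "expectation (\<lambda>\<omega>. lin u \<omega> i * X \<omega> i k) = 0"
proof -
  have "expectation (\<lambda>\<omega>. lin u \<omega> i * X \<omega> i k) = (\<Sum>l<p. u l * S l k)"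
    unfolding entry_eq_lin[OF assms(2)] lin_product_expectation[OF assms(1)]
    by (simp only: sum_delta_mult[OF assms(2)])
  then show ?thesis using R.u_S[OF assms(2)] assms(3) by simp
qed

end

section \<open>Concentration\<close>

locale concentrated_row = regression_row +
  fixes h V :: real
  assumes h: "h > 0" and V: "V > 0"
    and bern_entries: "\<And>i k m. i < n \<Longrightarrow> k < p \<Longrightarrow> m < p \<Longrightarrow>
      bernstein_moment M h V (\<lambda>\<omega>. X \<omega> i k * X \<omega> i m)"
    and bern_cross: "\<And>i k. i < n \<Longrightarrow> k < p \<Longrightarrow>
      bernstein_moment M h V (\<lambda>\<omega>. lin u \<omega> i * X \<omega> i k)"
    and bern_resid: "\<And>i. i < n \<Longrightarrow>
      bernstein_moment M h V (\<lambda>\<omega>. lin u \<omega> i * lin u \<omega> i)"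
    and bern_noise: "\<And>i k. i < n \<Longrightarrow> k < p \<Longrightarrow>
      bernstein_moment M h V (\<lambda>\<omega>. X \<omega> i k * eps \<omega> i)"
begin

text \<open>The four parts serve, in order, the compatibility condition, the noise level of the
  nodewise Lasso, the lower bound on tau_j^2, and the noise level of the Lasso.\<close>

definition concentrated :: "real \<Rightarrow> 'a \<Rightarrow> bool" where
  "concentrated t \<omega> \<longleftrightarrow>
     (\<forall>k<p. \<forall>m<p. \<bar>Sigma_hat n (X \<omega>) k m - S k m\<bar> \<le> t) \<and>
     (\<forall>k\<in>{..<p} - {j}. \<bar>(\<Sum>i<n. lin u \<omega> i * X \<omega> i k) / n\<bar> \<le> t) \<and>
     \<bar>(\<Sum>i<n. (lin u \<omega> i)\<^sup>2) / n - 1 / \<theta>\<bar> \<le> t \<and>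
     (\<forall>k<p. \<bar>(\<Sum>i<n. eps \<omega> i * X \<omega> i k) / n\<bar> \<le> t)"

text \<open>Union bound over four families of at most p^2 events, each of probability at most 2 exp
  (- n t^2 / (2 V)) by Bernstein's inequality.\<close>

lemma concentration:
  fixes t :: real
  assumes t: "0 < t" "t \<le> h * V"
  shows "\<exists>B\<in>events. prob B \<le> 8 * (real p)\<^sup>2 * exp (- (real n * t\<^sup>2 / (2 * V))) \<and> (\<forall>\<omega>\<in>space M - B. concentrated t \<omega>)"
proof -
  define \<pi> where "\<pi> = 2 * exp (- (real n * t\<^sup>2 / (2 * V)))"
  have n0: "n > 0" using n by simp
  let ?E1 = "\<lambda>k m. {\<omega>\<in>space M. \<bar>(\<Sum>i<n. X \<omega> i k * X \<omega> i m) / n - S k m\<bar> \<ge> t}"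
  let ?E2 = "\<lambda>k. {\<omega>\<in>space M. \<bar>(\<Sum>i<n. lin u \<omega> i * X \<omega> i k) / n - 0\<bar> \<ge> t}"
  let ?E3 = "{\<omega>\<in>space M. \<bar>(\<Sum>i<n. lin u \<omega> i * lin u \<omega> i) / n - 1 / \<theta>\<bar> \<ge> t}"
  let ?E4 = "\<lambda>k. {\<omega>\<in>space M. \<bar>(\<Sum>i<n. X \<omega> i k * eps \<omega> i) / n - 0\<bar> \<ge> t}"
  have P1: "prob (?E1 k m) \<le> \<pi>" if "k < p" "m < p" for k m
    unfolding \<pi>_def using that t V bern_entries entry_product_expectation
      lin_products_indep[of "\<lambda>l. if l = k then 1 else 0" "\<lambda>l. if l = m then 1 else 0"]
    by (intro bernstein[OF n0]) (auto simp: entry_eq_lin[symmetric])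
  have P2: "prob (?E2 k) \<le> \<pi>" if "k \<in> {..<p} - {j}" for k
    unfolding \<pi>_def using that t V bern_cross lin_u_entry_expectation
      lin_products_indep[of u "\<lambda>l. if l = k then 1 else 0"]
    by (intro bernstein[OF n0]) (auto simp: entry_eq_lin[symmetric])
  have P3: "prob ?E3 \<le> \<pi>"
    unfolding \<pi>_def using t V bern_resid lin_u_square_expectation lin_products_indep[of u u]
    by (intro bernstein[OF n0]) (auto simp: power2_eq_square)
  have P4: "prob (?E4 k) \<le> \<pi>" if "k < p" for k
    unfolding \<pi>_def using that t V bern_noise entry_noise_mean entry_noise_indep
    by (intro bernstein[OF n0]) auto
  have meas: "?E1 k m \<in> events" "?E2 k \<in> events" "?E3 \<in> events" "?E4 k \<in> events" if "k < p" "m < p" for k m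
  proof -
    have [measurable]: "(\<lambda>\<omega>. \<Sum>i<n. X \<omega> i k * X \<omega> i m) \<in> borel_measurable M"
      "(\<lambda>\<omega>. \<Sum>i<n. lin u \<omega> i * X \<omega> i k) \<in> borel_measurable M"
      "(\<lambda>\<omega>. \<Sum>i<n. lin u \<omega> i * lin u \<omega> i) \<in> borel_measurable M"
      "(\<lambda>\<omega>. \<Sum>i<n. X \<omega> i k * eps \<omega> i) \<in> borel_measurable M"
      using that by (auto intro!: borel_measurable_sum borel_measurable_times)
    show "?E1 k m \<in> events" "?E2 k \<in> events" "?E3 \<in> events" "?E4 k \<in> events" by measurable
  qed
  define B1 where "B1 = (\<Union>k<p. \<Union>m<p. ?E1 k m)"
  define B2 where "B2 = (\<Union>k\<in>{..<p} - {j}. ?E2 k)"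
  define B4 where "B4 = (\<Union>k<p. ?E4 k)"
  have B: "B1 \<in> events" "B2 \<in> events" "?E3 \<in> events" "B4 \<in> events"
    unfolding B1_def B2_def B4_def using meas j by (auto intro!: sets.finite_UN)
  have \<pi>0: "\<pi> \<ge> 0" by (simp add: \<pi>_def)
  have "prob B1 \<le> (\<Sum>k<p. prob (\<Union>m<p. ?E1 k m))"
    unfolding B1_def using meas by (intro measure_UNION_le) auto
  also have "\<dots> \<le> (\<Sum>k<p. \<Sum>m<p. prob (?E1 k m))"
    using meas by (intro sum_mono measure_UNION_le) auto
  also have "\<dots> \<le> (\<Sum>k<p. \<Sum>m<p. \<pi>)" using P1 by (intro sum_mono) auto
  finally have b1: "prob B1 \<le> (real p)\<^sup>2 * \<pi>" by (simp add: power2_eq_square)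
  have pp: "real p \<le> (real p)\<^sup>2" "1 \<le> (real p)\<^sup>2" 
    using p mult_mono[of 1 "real p" 1 "real p"] by (auto simp: power2_eq_square)
  have "prob B2 \<le> (\<Sum>k\<in>{..<p} - {j}. prob (?E2 k))"
    unfolding B2_def using meas by (intro measure_UNION_le) auto
  also have "\<dots> \<le> (\<Sum>k\<in>{..<p} - {j}. \<pi>)" using P2 by (intro sum_mono) auto
  also have "\<dots> \<le> (\<Sum>k<p. \<pi>)" using \<pi>0 by (intro sum_mono2) auto
  also have "\<dots> = p * \<pi>" by simp
  also have "\<dots> \<le> (real p)\<^sup>2 * \<pi>" using pp \<pi>0 by (intro mult_right_mono) auto
  finally have b2: "prob B2 \<le> (real p)\<^sup>2 * \<pi>" .
  have "\<pi> = 1 * \<pi>" by simp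
  also have "\<dots> \<le> (real p)\<^sup>2 * \<pi>" using pp \<pi>0 by (intro mult_right_mono) auto
  finally have b3: "prob ?E3 \<le> (real p)\<^sup>2 * \<pi>" using P3 by linarith
  have "prob B4 \<le> (\<Sum>k<p. prob (?E4 k))"
    unfolding B4_def using meas by (intro measure_UNION_le) auto
  also have "\<dots> \<le> (\<Sum>k<p. \<pi>)" using P4 by (intro sum_mono) auto
  also have "\<dots> = p * \<pi>" by simp
  also have "\<dots> \<le> (real p)\<^sup>2 * \<pi>" using pp \<pi>0 by (intro mult_right_mono) auto
  finally have b4: "prob B4 \<le> (real p)\<^sup>2 * \<pi>" .
  define B where "B = (B1 \<union> B2) \<union> (?E3 \<union> B4)"
  have "prob B \<le> prob (B1 \<union> B2) + prob (?E3 \<union> B4)"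
    unfolding B_def using B by (intro measure_Un_le) auto
  also have "\<dots> \<le> (prob B1 + prob B2) + (prob ?E3 + prob B4)"
    using B by (intro add_mono measure_Un_le) auto
  also have "\<dots> \<le> 4 * ((real p)\<^sup>2 * \<pi>)" using b1 b2 b3 b4 by linarith
  finally have "prob B \<le> 8 * (real p)\<^sup>2 * exp (- (real n * t\<^sup>2 / (2 * V)))" by (simp add: \<pi>_def)
  moreover have "B \<in> events" unfolding B_def using B by blast
  moreover have "concentrated t \<omega>" if "\<omega> \<in> space M - B" for \<omega>
    unfolding concentrated_def Sigma_hat_def
  proof (intro conjI allI impI ballI)
    fix k m assume "k < p" "m < p"
    then show "\<bar>(\<Sum>i<n. X \<omega> i k * X \<omega> i m) / n - S k m\<bar> \<le> t"
      using that unfolding B_def B1_def by force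
  next
    fix k assume "k \<in> {..<p} - {j}"
    then show "\<bar>(\<Sum>i<n. lin u \<omega> i * X \<omega> i k) / n\<bar> \<le> t"
      using that unfolding B_def B2_def by force
  next
    show "\<bar>(\<Sum>i<n. (lin u \<omega> i)\<^sup>2) / n - 1 / \<theta>\<bar> \<le> t"
      using that unfolding B_def power2_eq_square by force
  next
    fix k assume "k < p"
    then have "\<bar>(\<Sum>i<n. X \<omega> i k * eps \<omega> i) / n - 0\<bar> \<le> t"
      using that unfolding B_def B4_def by force
    then show "\<bar>(\<Sum>i<n. eps \<omega> i * X \<omega> i k) / n\<bar> \<le> t" by (simp add: mult.commute)
  qed
  ultimately show ?thesis by blast
qed

end

section \<open>The bootstrap test\<close>

definition boot_coeff where
  "boot_coeff n p l A g v j i =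
     (\<Sum>k<p. Theta_hat n p l A g j k * A i k) * sqrt v / sqrt (real n * omega_hat n p l A g v j j)"

lemma boot_stat_eq:
  "boot_stat n p l G A g v e = (MAX j\<in>G. \<bar>\<Sum>i<n. boot_coeff n p l A g v j i * e i\<bar>)"
  by (simp add: boot_stat_def boot_coeff_def)

text \<open>The studentised coefficients have unit length, except in the degenerate case of a zero
  denominator, where they all become 0. Hence the bound holds for every data set.\<close>

lemma sum_boot_coeff_square_le:
  assumes "v \<ge> 0"
  shows "(\<Sum>i<n. (boot_coeff n p l A g v j i)\<^sup>2) \<le> 1"
proof -
  let ?w = "\<lambda>i. \<Sum>k<p. Theta_hat n p l A g j k * A i k"
  define W where "W = (\<Sum>i<n. (?w i)\<^sup>2)"
  have W: "W \<ge> 0" by (simp add: W_def sum_nonneg)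
  have om: "real n * omega_hat n p l A g v j j = v * W"
    unfolding omega_hat_eq W_def by simp
  have "(\<Sum>i<n. (boot_coeff n p l A g v j i)\<^sup>2) = (\<Sum>i<n. (?w i)\<^sup>2 * v / (v * W))"
    unfolding boot_coeff_def om power_divide power_mult_distrib using assms W by simp
  also have "\<dots> = W * v / (v * W)"
    unfolding W_def by (simp add: sum_distrib_right sum_divide_distrib)
  also have "\<dots> \<le> 1" by simp
  finally show ?thesis .
qed

section \<open>The bootstrap critical value\<close>

context
  fixes n p :: nat and l :: "nat \<Rightarrow> real" and G :: "nat set"
    and A g :: "nat \<Rightarrow> nat \<Rightarrow> real" and v :: real
  assumes G: "finite G" "G \<noteq> {}" and v: "v \<ge> 0"
begin

lemma boot_stat_measurable: "boot_stat n p l G A g v \<in> borel_measurable (multipliers n)"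
  unfolding boot_stat_eq using G
  by (intro borel_measurable_Max borel_measurable_abs borel_measurable_sum borel_measurable_times) auto

lemma boot_stat_le_iff:
  "boot_stat n p l G A g v e \<le> t \<longleftrightarrow> (\<forall>j\<in>G. \<bar>\<Sum>i<n. boot_coeff n p l A g v j i * e i\<bar> \<le> t)"
  unfolding boot_stat_eq using G by simp

definition boot_cdf :: "real \<Rightarrow> real" where
  "boot_cdf t = measure (multipliers n) {e \<in> space (multipliers n). boot_stat n p l G A g v e \<le> t}"

lemma boot_cdf_mono: "s \<le> t \<Longrightarrow> boot_cdf s \<le> boot_cdf t"
proof -
  assume "s \<le> t"
  interpret prob_space "multipliers n" by (rule prob_space_multipliers)
  show ?thesis unfolding boot_cdf_def
    using \<open>s \<le> t\<close> boot_stat_measurable by (intro finite_measure_mono) (auto, measurable)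
qed

lemma boot_cdf_lower:
  assumes t: "t > 0"
  shows "boot_cdf t \<ge> 1 - card G * (2 * exp (- (t\<^sup>2 / 2)))"
proof -
  interpret prob_space "multipliers n" by (rule prob_space_multipliers)
  let ?E = "\<lambda>j. {e \<in> space (multipliers n). \<bar>\<Sum>i<n. boot_coeff n p l A g v j i * e i\<bar> \<ge> t}"
  have meas: "?E j \<in> events" for j
  proof -
    have [measurable]: "(\<lambda>e. \<Sum>i<n. boot_coeff n p l A g v j i * e i) \<in> borel_measurable (multipliers n)"
      by (intro borel_measurable_sum borel_measurable_times) auto
    show ?thesis by measurable
  qed
  have "prob (\<Union>j\<in>G. ?E j) \<le> (\<Sum>j\<in>G. prob (?E j))"
    using G meas by (intro measure_UNION_le) auto
  also have "\<dots> \<le> (\<Sum>j\<in>G. 2 * exp (- (t\<^sup>2 / 2)))"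
    using sum_boot_coeff_square_le[OF v] t by (intro sum_mono multipliers_tail) auto
  finally have U: "prob (\<Union>j\<in>G. ?E j) \<le> card G * (2 * exp (- (t\<^sup>2 / 2)))" by simp
  have Um: "(\<Union>j\<in>G. ?E j) \<in> events" using G meas by (intro sets.finite_UN) auto
  have "1 - card G * (2 * exp (- (t\<^sup>2 / 2))) \<le> 1 - prob (\<Union>j\<in>G. ?E j)" using U by simp
  also have "\<dots> = prob (space (multipliers n) - (\<Union>j\<in>G. ?E j))"
    using prob_compl[OF Um] by simp
  also have "\<dots> \<le> boot_cdf t"
    unfolding boot_cdf_def
  proof (rule finite_measure_mono)
    show "{e \<in> space (multipliers n). boot_stat n p l G A g v e \<le> t} \<in> events"
      using boot_stat_measurable by measurable
    show "space (multipliers n) - (\<Union>j\<in>G. ?E j) \<subseteq> {e \<in> space (multipliers n). boot_stat n p l G A g v e \<le> t}"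
      unfolding boot_stat_le_iff by (auto simp: not_le less_imp_le)
  qed
  finally show ?thesis .
qed

text \<open>The argument is the t for which the union bound 2 |G| exp (- t^2 / 2) equals a.\<close>

lemma boot_cdf_quantile:
  assumes a: "0 < a" "a < 1"
  shows "boot_cdf (sqrt (2 * ln (2 * card G / a))) \<ge> 1 - a"
proof -
  have "card G \<ge> 1" using G by (simp add: Suc_le_eq card_gt_0_iff)
  then have G1: "2 * card G / a > 1" using a by (simp add: less_divide_eq)
  then have ln: "ln (2 * card G / a) > 0" by (rule ln_gt_zero)
  then have "card G * (2 * exp (- ((sqrt (2 * ln (2 * card G / a)))\<^sup>2 / 2))) = card G * (2 * (inverse (2 * card G / a)))"
    using G1 by (simp add: exp_minus)
  also have "\<dots> = a" using \<open>card G \<ge> 1\<close> a by simp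
  finally show ?thesis using boot_cdf_lower[of "sqrt (2 * ln (2 * card G / a))"] ln by simp
qed

lemma boot_crit_less_iff:
  assumes a: "0 < a" "a < 1"
  shows "boot_crit n p l G A g v a < s \<longleftrightarrow> (\<exists>t<s. boot_cdf t \<ge> 1 - a)"
proof -
  let ?S = "{t. boot_cdf t \<ge> 1 - a}"
  \<comment> \<open>The statistic is a maximum of absolute values over a nonempty set, so negative
    levels have probability 0 < 1 - a. Together with nonemptiness this makes the real-valued infimum
    meaningful.\<close>
  have "bdd_below ?S"
  proof (rule bdd_belowI)
    fix t assume t: "t \<in> ?S"
    show "0 \<le> t"
    proof (rule ccontr)
      assume t0: "\<not> 0 \<le> t"
      obtain j where j: "j \<in> G" using G by auto
      have "{e \<in> space (multipliers n). boot_stat n p l G A g v e \<le> t} = {}"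
        unfolding boot_stat_le_iff using t0 j by force
      then have "boot_cdf t = 0" unfolding boot_cdf_def by (simp only: measure_empty)
      then show False using t a by simp
    qed
  qed
  moreover have "?S \<noteq> {}" using boot_cdf_quantile[OF a] by auto
  moreover have "boot_crit n p l G A g v a = Inf ?S" by (simp add: boot_crit_def boot_cdf_def)
  ultimately show ?thesis using cInf_less_iff[of ?S s] by auto
qed

lemma boot_crit_less_if:
  assumes "0 < a" "a < 1" "sqrt (2 * ln (2 * card G / a)) < s"
  shows "boot_crit n p l G A g v a < s"
  using assms boot_cdf_quantile by (subst boot_crit_less_iff) blast+

text \<open>By monotonicity of the distribution function a rational level can be inserted; a
  countable union then describes rejection.\<close>

lemma boot_crit_less_iff_rat:
  assumes a: "0 < a" "a < 1"
  shows "boot_crit n p l G A g v a < s \<longleftrightarrow> (\<exists>q::rat. of_rat q < s \<and> boot_cdf (of_rat q) \<ge> 1 - a)"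
  unfolding boot_crit_less_iff[OF a]
proof
  assume "\<exists>t<s. boot_cdf t \<ge> 1 - a"
  then obtain t where t: "t < s" "boot_cdf t \<ge> 1 - a" by blast
  obtain q where "t < of_rat q" "of_rat q < s" using of_rat_dense[OF t(1)] by blast
  then show "\<exists>q::rat. of_rat q < s \<and> boot_cdf (of_rat q) \<ge> 1 - a"
    using t(2) boot_cdf_mono[of t "of_rat q"] by (intro exI[of _ q]) auto
qed blast

end

section \<open>Measurability\<close>

context
  fixes n p :: nat and l :: "nat \<Rightarrow> real" and G :: "nat set" and bt :: "nat \<Rightarrow> real"
    and bhat :: "(nat \<Rightarrow> real) \<times> (nat \<Rightarrow> nat \<Rightarrow> real) \<Rightarrow> nat \<Rightarrow> real"
    and ghat :: "nat \<Rightarrow> (nat \<Rightarrow> nat \<Rightarrow> real) \<Rightarrow> nat \<Rightarrow> real"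
    and vhat :: "(nat \<Rightarrow> real) \<times> (nat \<Rightarrow> nat \<Rightarrow> real) \<Rightarrow> real"
  assumes b: "bhat \<in> samples n p \<rightarrow>\<^sub>M vecs {..<p}"
    and g: "\<And>j. j < p \<Longrightarrow> ghat j \<in> designs n p \<rightarrow>\<^sub>M vecs ({..<p} - {j})"
    and v: "vhat \<in> borel_measurable (samples n p)" "\<And>d. d \<in> space (samples n p) \<Longrightarrow> 0 \<le> vhat d"
    and G: "G \<subseteq> {..<p}" "G \<noteq> {}"
begin

lemma finite_G: "finite G" using G finite_subset by blast

lemma ghat_entry_measurable: "j < p \<Longrightarrow> k \<in> {..<p} - {j} \<Longrightarrow> (\<lambda>A. ghat j A k) \<in> borel_measurable (designs n p)"
  using measurable_compose[OF g measurable_component_singleton[of k "{..<p} - {j}"]] by simp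

lemma tau2_hat_measurable:
  assumes j: "j < p"
  shows "(\<lambda>A. tau2_hat n p l A (\<lambda>j. ghat j A) j) \<in> borel_measurable (designs n p)"
  unfolding tau2_hat_def
  by (intro borel_measurable_add borel_measurable_divide borel_measurable_sum borel_measurable_power
      borel_measurable_diff borel_measurable_times borel_measurable_abs borel_measurable_const
      design_entry_measurable ghat_entry_measurable) (use j in auto)

lemma Theta_hat_measurable:
  assumes j: "j < p" and k: "k < p"
  shows "(\<lambda>A. Theta_hat n p l A (\<lambda>j. ghat j A) j k) \<in> borel_measurable (designs n p)"
proof (cases "j = k")
  case True
  then show ?thesis unfolding Theta_hat_def C_hat_def using tau2_hat_measurable[OF j] by simp
next
  case False
  then show ?thesis
    unfolding Theta_hat_def C_hat_def using tau2_hat_measurable[OF j] ghat_entry_measurable[OF j, of k] k by simp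
qed

lemma weight_measurable:
  assumes j: "j < p" and i: "i < n"
  shows "(\<lambda>A. \<Sum>k<p. Theta_hat n p l A (\<lambda>j. ghat j A) j k * A i k) \<in> borel_measurable (designs n p)"
  by (intro borel_measurable_sum borel_measurable_times Theta_hat_measurable design_entry_measurable)
    (use i j in auto)

lemma snd_measurable: "f \<in> borel_measurable (designs n p) \<Longrightarrow> (\<lambda>d. f (snd d)) \<in> borel_measurable (samples n p)"
  by (rule measurable_compose[OF measurable_snd])

lemma omega_hat_measurable:
  assumes j: "j < p"
  shows "(\<lambda>d. omega_hat n p l (snd d) (\<lambda>j. ghat j (snd d)) (vhat d) j j) \<in> borel_measurable (samples n p)"
  unfolding omega_hat_eq
  by (intro borel_measurable_times v borel_measurable_divide borel_measurable_sum borel_measurable_power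
      borel_measurable_const snd_measurable weight_measurable) (use j in auto)

lemma boot_coeff_measurable:
  assumes j: "j < p" and i: "i < n"
  shows "(\<lambda>d. boot_coeff n p l (snd d) (\<lambda>j. ghat j (snd d)) (vhat d) j i) \<in> borel_measurable (samples n p)"
  unfolding boot_coeff_def
  by (intro borel_measurable_times v borel_measurable_divide borel_measurable_const snd_measurable
      weight_measurable omega_hat_measurable measurable_compose[OF _ borel_measurable_sqrt]) (use i j in auto)

lemma test_stat_measurable:
  "(\<lambda>d. test_stat n p l G bt (fst d) (snd d) (bhat d) (\<lambda>j. ghat j (snd d)) (vhat d)) \<in> borel_measurable (samples n p)"
proof -
  have fst_m: "(\<lambda>d. fst d i) \<in> borel_measurable (samples n p)" if "i < n" for i
    using that measurable_compose[OF measurable_fst measurable_component_singleton[of i "{..<n}"]] by simp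
  have b_m: "(\<lambda>d. bhat d k) \<in> borel_measurable (samples n p)" if "k < p" for k
    using that measurable_compose[OF b measurable_component_singleton[of k "{..<p}"]] by simp
  show ?thesis
    unfolding test_stat_def desparsified_lasso_def
    by (intro borel_measurable_Max finite_G borel_measurable_divide borel_measurable_times
        borel_measurable_const borel_measurable_abs borel_measurable_diff borel_measurable_add borel_measurable_sum
        snd_measurable omega_hat_measurable Theta_hat_measurable design_entry_measurable fst_m b_m
        measurable_compose[OF _ borel_measurable_sqrt]) (use G in auto)
qed

lemma boot_cdf_measurable:
  "(\<lambda>d. boot_cdf n p l G (snd d) (\<lambda>j. ghat j (snd d)) (vhat d) t) \<in> borel_measurable (samples n p)"
proof -
  interpret E: prob_space "multipliers n" by (rule prob_space_multipliers)
  let ?c = "\<lambda>d j i. boot_coeff n p l (snd d) (\<lambda>j. ghat j (snd d)) (vhat d) j i"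
  define Q where "Q = {x \<in> space (samples n p \<Otimes>\<^sub>M multipliers n).
     (MAX j\<in>G. \<bar>\<Sum>i<n. ?c (fst x) j i * snd x i\<bar>) \<le> t}"
  have "(\<lambda>x. MAX j\<in>G. \<bar>\<Sum>i<n. ?c (fst x) j i * snd x i\<bar>) \<in> borel_measurable (samples n p \<Otimes>\<^sub>M multipliers n)"
    by (intro borel_measurable_Max finite_G borel_measurable_abs borel_measurable_sum borel_measurable_times
        measurable_compose[OF measurable_fst boot_coeff_measurable]
        measurable_compose[OF measurable_snd measurable_multiplier_component]) (use G in auto)
  then have "Q \<in> sets (samples n p \<Otimes>\<^sub>M multipliers n)" unfolding Q_def by measurable
  \<comment> \<open>The conditional distribution function is the measure of a section of a jointly
    measurable set, hence measurable in the data.\<close>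
  then have "(\<lambda>d. emeasure (multipliers n) (Pair d -` Q)) \<in> borel_measurable (samples n p)"
    by (rule E.measurable_emeasure_Pair)
  then have "(\<lambda>d. measure (multipliers n) (Pair d -` Q)) \<in> borel_measurable (samples n p)"
    unfolding measure_def by simp
  moreover have "measure (multipliers n) (Pair d -` Q) = boot_cdf n p l G (snd d) (\<lambda>j. ghat j (snd d)) (vhat d) t"
    if d: "d \<in> space (samples n p)" for d
  proof -
    have "Pair d -` Q = {e \<in> space (multipliers n). boot_stat n p l G (snd d) (\<lambda>j. ghat j (snd d)) (vhat d) e \<le> t}"
      unfolding Q_def boot_stat_eq using d by (auto simp: space_pair_measure)
    then show ?thesis using boot_cdf_def[OF finite_G G(2) v(2)[OF d]] by simp
  qed
  ultimately show ?thesis by (subst measurable_cong[symmetric]) auto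
qed

lemma rejects_measurable:
  assumes a: "0 < a" "a < 1"
  shows "{d \<in> space (samples n p). rejects n p l G bt a bhat ghat vhat d} \<in> sets (samples n p)"
proof -
  let ?T = "\<lambda>d. test_stat n p l G bt (fst d) (snd d) (bhat d) (\<lambda>j. ghat j (snd d)) (vhat d)"
  let ?F = "\<lambda>d. boot_cdf n p l G (snd d) (\<lambda>j. ghat j (snd d)) (vhat d)"
  have "rejects n p l G bt a bhat ghat vhat d \<longleftrightarrow> (\<exists>q::rat. of_rat q < ?T d \<and> ?F d (of_rat q) \<ge> 1 - a)"
    if "d \<in> space (samples n p)" for d
    unfolding rejects_def Let_def using boot_crit_less_iff_rat[OF finite_G G(2) v(2)[OF that] a] by simp
  then have "{d \<in> space (samples n p). rejects n p l G bt a bhat ghat vhat d} =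
      (\<Union>q::rat. {d \<in> space (samples n p). of_rat q < ?T d \<and> ?F d (of_rat q) \<ge> 1 - a})" by auto
  also have "\<dots> \<in> sets (samples n p)"
  proof (rule sets.countable_UN, rule image_subsetI, rule sets.sets_Collect_conj)
    fix q :: rat
    show "{d \<in> space (samples n p). of_rat q < ?T d} \<in> sets (samples n p)"
      using test_stat_measurable by measurable
    show "{d \<in> space (samples n p). ?F d (of_rat q) \<ge> 1 - a} \<in> sets (samples n p)"
      using boot_cdf_measurable[of "of_rat q"] by measurable
  qed
  finally show ?thesis .
qed

end

section \<open>Rejection probability at a fixed sample size\<close>

lemma (in regression_model) data_measurable: "data n p X eps \<beta> \<in> M \<rightarrow>\<^sub>M samples n p"
proof -
  have "(\<lambda>\<omega>. response n p (X \<omega>) \<beta> (eps \<omega>)) \<in> M \<rightarrow>\<^sub>M vecs {..<n}"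
    unfolding response_def
    by (intro measurable_restrict borel_measurable_add borel_measurable_sum borel_measurable_times
        entry_measurable eps_entry_measurable borel_measurable_const) auto
  then have "(\<lambda>\<omega>. (response n p (X \<omega>) \<beta> (eps \<omega>), X \<omega>)) \<in> M \<rightarrow>\<^sub>M samples n p"
    by (intro measurable_Pair X_measurable)
  then show ?thesis by (simp add: data_def[abs_def])
qed

text \<open>The deterministic core. All terms are expressed as multiples of the square root of the
  true variance, so this unknown scale cancels; \<open>margin\<close> then says that the signal,
  less noise and bias, reaches the bootstrap quantile inflated by the error of the estimated
  scale.\<close>

lemma (in concentrated_row) concentrated_imp_rejects:
  fixes bhat ghat vhat and G :: "nat set" and bt \<beta> :: "nat \<Rightarrow> real" and a \<delta> t lam s c0 :: real and s0 :: nat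
  assumes lam_def: "lam = 2 * t"
    and lasso: "lasso_estimator n p lam bhat" and node: "nodewise_lasso n p (\<lambda>_. lam) ghat"
    and var: "variance_estimator n p vhat"
    and G: "G \<subseteq> {..<p}" "j \<in> G" and a: "0 < a" "a < 1"
    and \<beta>: "card {k. k < p \<and> \<beta> k \<noteq> 0} \<le> s0"
    and t: "t > 0" "32 * t * s0 \<le> c"
    and \<delta>: "0 < \<delta>" "\<delta> \<le> 1 / 2" "t + 8 * t * (sqrt (row_sparsity M p X j) * sqrt (Cd / c)) \<le> \<delta> * c"
    and sig2: "sig2 > 0" and s: "s > 0" and c0: "c0 > 0"
    and alt: "\<bar>\<beta> j - bt j\<bar> / sqrt (sig2 * \<theta>) > c0 * sqrt (ln (card G) / n)"
    and margin: "sqrt ((1 + \<delta>) / (1 - \<delta>)) * sqrt (2 * ln (2 * card G / a)) \<le>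
       c0 * sqrt (ln (card G)) - s * sqrt (2 / sig2) - 192 * sqrt n * t\<^sup>2 * s0 / (c * sqrt (c * sig2))"
    and \<omega>: "\<omega> \<in> space M" and conc: "concentrated t \<omega>"
    and noise: "\<bar>\<Sum>i<n. (\<Sum>k<p. Theta_hat n p (\<lambda>_. lam) (X \<omega>) (\<lambda>j. ghat j (X \<omega>)) j k * X \<omega> i k) * eps \<omega> i\<bar>
       \<le> s * sqrt (\<Sum>i<n. (\<Sum>k<p. Theta_hat n p (\<lambda>_. lam) (X \<omega>) (\<lambda>j. ghat j (X \<omega>)) j k * X \<omega> i k)\<^sup>2)"
    and v: "\<bar>vhat (data n p X eps \<beta> \<omega>) - sig2\<bar> \<le> \<delta> * sig2"
  shows "rejects n p (\<lambda>_. lam) G bt a bhat ghat vhat (data n p X eps \<beta> \<omega>)"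
proof -
  define d where "d = data n p X eps \<beta> \<omega>"
  define y where "y = response n p (X \<omega>) \<beta> (eps \<omega>)"
  define b where "b = bhat d"
  define g where "g = (\<lambda>j. ghat j (X \<omega>))"
  define vv where "vv = vhat d"
  have d: "d = (y, X \<omega>)" by (simp add: d_def y_def data_def)
  have d_space: "d \<in> space (samples n p)" unfolding d_def using measurable_space[OF data_measurable \<omega>] .
  have X_space: "X \<omega> \<in> space (designs n p)" using measurable_space[OF X_measurable \<omega>] .
  have lam: "lam > 0" "t = lam / 2" using t by (auto simp: lam_def)
  have y_eq: "y i = (\<Sum>k<p. X \<omega> i k * \<beta> k) + eps \<omega> i" if "i < n" for i
    using that by (simp add: y_def response_def)
  have finG: "finite G" "G \<noteq> {}" using G finite_subset by auto
  interpret A: lasso_model n "{..<p}" lam y "X \<omega>" b \<beta> "eps \<omega>"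
  proof
    show "is_arg_min (lasso_objective n {..<p} lam y (X \<omega>)) (\<lambda>b. b \<in> extensional {..<p}) b"
      using lasso d_space unfolding lasso_estimator_def b_def d by auto
    show "\<bar>(\<Sum>i<n. eps \<omega> i * X \<omega> i k) / n\<bar> \<le> lam / 2" if "k \<in> {..<p}" for k
      using conc that unfolding concentrated_def lam(2) by auto
  qed (use lam y_eq in auto)
  interpret N: nodewise_solution n p "\<lambda>_. lam" "X \<omega>" g j
  proof
    show "is_arg_min (lasso_objective n ({..<p} - {j}) lam (\<lambda>i. X \<omega> i j) (X \<omega>))
        (\<lambda>g. g \<in> extensional ({..<p} - {j})) (g j)"
      using node X_space j unfolding nodewise_lasso_def g_def by auto
  qed (use lam j in auto)
  interpret B: lasso_model n "{..<p} - {j}" lam "\<lambda>i. X \<omega> i j" "X \<omega>" "g j" "\<lambda>k. - u k" "lin u \<omega>"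
  proof
    show "X \<omega> i j = (\<Sum>k\<in>{..<p} - {j}. X \<omega> i k * - u k) + lin u \<omega> i" for i
      by (rule regression_eq)
    show "\<bar>(\<Sum>i<n. lin u \<omega> i * X \<omega> i k) / n\<bar> \<le> lam / 2" if "k \<in> {..<p} - {j}" for k
      using conc that unfolding concentrated_def lam(2) by auto
  qed
  have S_conc: "\<bar>Sigma_hat n (X \<omega>) k m - S k m\<bar> \<le> t" if "k < p" "m < p" for k m
    using conc that unfolding concentrated_def by auto
  have l1: "(\<Sum>k<p. \<bar>b k - \<beta> k\<bar>) \<le> 24 * lam * s0 / c"
    using \<beta> c lam(1) t
  proof -
    have "c * (\<Sum>k<p. (A.d k)\<^sup>2) \<le> quad_form p S A.d" by (rule pd)
    also have "\<dots> \<le> quad_form p (Sigma_hat n (X \<omega>)) A.d + t * (\<Sum>k<p. \<bar>A.d k\<bar>)\<^sup>2"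
      by (rule quad_form_perturbation[OF S_conc])
    finally have compat: "c * (\<Sum>k<p. (A.d k)\<^sup>2) \<le> (\<Sum>i<n. (A.Ad i)\<^sup>2) / n + t * (\<Sum>k<p. \<bar>A.d k\<bar>)\<^sup>2"
      unfolding quad_form_Sigma_hat A.Ad_def .
    have "card {k \<in> {..<p}. \<beta> k \<noteq> 0} \<le> s0" using \<beta> by simp
    from A.fast_rate[OF this c lam(1) compat] t show ?thesis by (simp add: A.d_def)
  qed
  \<comment> \<open>The slow rate loses 4 lam = 8 t times the l1 norm of the population
    coefficients, concentration loses t; together this is at most \<delta> c, and c <= 1 / \<theta>
    makes the error relative.\<close>
  have tau_lower: "(1 - \<delta>) / \<theta> \<le> N.tau2"
  proof -
    have "1 / \<theta> - t \<le> (\<Sum>i<n. (lin u \<omega> i)\<^sup>2) / n"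
      using conc unfolding concentrated_def by auto
    moreover have "(\<Sum>i<n. (lin u \<omega> i)\<^sup>2) / n - 4 * lam * (\<Sum>k\<in>{..<p} - {j}. \<bar>- u k\<bar>) \<le> N.tau2"
      by (rule order_trans[OF B.slow_rate[OF lam(1)] N.rss_le_tau2])
    moreover have "4 * lam * (\<Sum>k\<in>{..<p} - {j}. \<bar>- u k\<bar>) \<le> 4 * lam * (sqrt (row_sparsity M p X j) * sqrt (Cd / c))"
      using sum_u_off_diag lam(1) by (intro mult_left_mono) auto
    moreover have "4 * lam * (sqrt (row_sparsity M p X j) * sqrt (Cd / c)) = 8 * t * (sqrt (row_sparsity M p X j) * sqrt (Cd / c))"
      by (simp add: lam_def)
    ultimately have "1 / \<theta> - \<delta> * c \<le> N.tau2" using \<delta>(3) by linarith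
    moreover have "\<delta> * c \<le> \<delta> * (1 / \<theta>)"
      using R.diag_le \<delta>(1) unfolding \<theta>_def by (intro mult_left_mono) auto
    ultimately show ?thesis by (simp add: diff_divide_distrib)
  qed
  have tau_pos: "N.tau2 > 0"
    using tau_lower theta_pos \<delta> by (intro less_le_trans[OF _ tau_lower] divide_pos_pos) auto
  have inv_tau: "1 / N.tau2 \<le> \<theta> / (1 - \<delta>)"
    using tau_lower tau_pos theta_pos \<delta> by (simp add: field_simps)
  also have "\<theta> / (1 - \<delta>) \<le> \<theta> / (1 / 2)"
    using theta_pos \<delta> by (intro divide_left_mono) auto
  finally have inv_tau2: "1 / N.tau2 \<le> 2 * \<theta>" by simp
  define W where "W = (\<Sum>i<n. (N.w i)\<^sup>2) / n"
  have W: "W > 0" "W \<le> 1 / N.tau2" unfolding W_def using N.sum_w_pos N.sum_w_le tau_pos by auto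
  have vv: "vv > 0" "vv \<le> (1 + \<delta>) * sig2"
  proof -
    have "\<bar>vv - sig2\<bar> \<le> \<delta> * sig2" using v by (simp add: vv_def d_def)
    moreover have "\<delta> * sig2 \<le> 1 / 2 * sig2" using \<delta> sig2 by (intro mult_right_mono) auto
    ultimately show "vv > 0" "vv \<le> (1 + \<delta>) * sig2"
      using sig2 unfolding distrib_right abs_le_iff by linarith+
  qed
  define om where "om = sig2 * \<theta>"
  have om: "om > 0" using sig2 theta_pos by (simp add: om_def)
  define oh where "oh = omega_hat n p (\<lambda>_. lam) (X \<omega>) g vv j j"
  have oh_eq: "oh = vv * W" unfolding oh_def W_def by (rule N.omega_hat_w)
  have oh_pos: "oh > 0" using oh_eq vv W by simp
  have "oh \<le> (1 + \<delta>) * sig2 * (\<theta> / (1 - \<delta>))"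
    unfolding oh_eq using vv W inv_tau sig2 \<delta> by (intro mult_mono) auto
  also have "\<dots> = (1 + \<delta>) / (1 - \<delta>) * om" by (simp add: om_def)
  finally have sqrt_oh: "sqrt oh \<le> sqrt ((1 + \<delta>) / (1 - \<delta>)) * sqrt om"
    by (simp add: real_sqrt_mult[symmetric])
  define D where "D = desparsified_lasso n p (\<lambda>_. lam) y (X \<omega>) b g j"
  define E where "E = (\<Sum>i<n. N.w i * eps \<omega> i) / n"
  define crit where "crit = sqrt (2 * ln (2 * card G / a))"
  have "card G \<ge> 1" using finG by (simp add: Suc_le_eq card_gt_0_iff)
  then have "2 * card G / a > 1" using a by (simp add: less_divide_eq)
  then have crit_nonneg: "crit \<ge> 0" by (simp add: crit_def)
  have "\<bar>D - \<beta> j - E\<bar> \<le> lam / N.tau2 * (\<Sum>k<p. \<bar>b k - \<beta> k\<bar>)"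
    unfolding D_def E_def by (rule N.desparsified_error[OF tau_pos y_eq])
  also have "\<dots> = lam * (1 / N.tau2) * (\<Sum>k<p. \<bar>b k - \<beta> k\<bar>)" by simp
  also have "\<dots> \<le> lam * (2 * \<theta>) * (24 * lam * s0 / c)"
    using l1 inv_tau2 lam(1) tau_pos theta_pos by (intro mult_mono) (auto intro!: sum_nonneg)
  also have "\<dots> = 192 * t\<^sup>2 * s0 / c * \<theta>" by (simp add: lam_def power2_eq_square)
  \<comment> \<open>Since \<theta> <= 1 / c, one factor sqrt \<theta> is bounded by a constant and
    the other one becomes part of sqrt om.\<close>
  also have "\<dots> \<le> 192 * t\<^sup>2 * s0 / c * (sqrt om / sqrt (c * sig2))"
  proof (intro mult_left_mono)
    have "\<theta>\<^sup>2 * (c * sig2) = om * (\<theta> * c)" by (simp add: om_def power2_eq_square)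
    also have "\<dots> \<le> om * 1"
      using theta_le c om by (intro mult_left_mono) (auto simp: field_simps)
    finally have "sqrt (\<theta>\<^sup>2 * (c * sig2)) \<le> sqrt om" by simp
    then have "\<theta> * sqrt (c * sig2) \<le> sqrt om"
      using theta_pos by (simp add: real_sqrt_mult)
    then show "\<theta> \<le> sqrt om / sqrt (c * sig2)" using c sig2 by (simp add: pos_le_divide_eq)
  qed (use c in auto)
  finally have bias: "\<bar>D - \<beta> j - E\<bar> \<le> 192 * t\<^sup>2 * s0 / c * (sqrt om / sqrt (c * sig2))" .
  have "sqrt n * \<bar>E\<bar> \<le> s * sqrt (2 / sig2) * sqrt om"
  proof -
    have "\<bar>\<Sum>i<n. N.w i * eps \<omega> i\<bar> \<le> s * sqrt (\<Sum>i<n. (N.w i)\<^sup>2)"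
      using noise[folded g_def] unfolding N.w_def .
    also have "(\<Sum>i<n. (N.w i)\<^sup>2) = n * W" using n by (simp add: W_def)
    finally have "\<bar>\<Sum>i<n. N.w i * eps \<omega> i\<bar> \<le> s * (sqrt n * sqrt W)" by (simp add: real_sqrt_mult)
    then have "sqrt n * (\<bar>\<Sum>i<n. N.w i * eps \<omega> i\<bar> / n) \<le> sqrt n * (s * (sqrt n * sqrt W) / n)"
      by (intro mult_left_mono divide_right_mono) auto
    also have "\<dots> = s * sqrt W * (sqrt n * sqrt n / n)" by (simp only: times_divide_eq_right mult_ac)
    also have "\<dots> = s * sqrt W" using n by simp
    \<comment> \<open>Here W <= 1 / tau2 <= 2 \<theta> = 2 om / sig2.\<close>
    also have "\<dots> \<le> s * sqrt (2 / sig2 * om)"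
      using W inv_tau2 s sig2 by (intro mult_left_mono real_sqrt_le_mono) (auto simp: om_def)
    also have "s * sqrt (2 / sig2 * om) = s * sqrt (2 / sig2) * sqrt om"
      by (simp only: real_sqrt_mult mult.assoc)
    finally show ?thesis by (simp add: E_def)
  qed
  moreover have "sqrt n * \<bar>\<beta> j - bt j\<bar> > c0 * sqrt (ln (card G)) * sqrt om"
  proof -
    have "c0 * (sqrt (ln (card G)) / sqrt n) < \<bar>\<beta> j - bt j\<bar> / sqrt om"
      using alt by (simp add: om_def real_sqrt_divide)
    then have "c0 * (sqrt (ln (card G)) / sqrt n) * sqrt om < \<bar>\<beta> j - bt j\<bar>"
      using om by (simp add: pos_less_divide_eq)
    then have "sqrt n * (c0 * (sqrt (ln (card G)) / sqrt n) * sqrt om) < sqrt n * \<bar>\<beta> j - bt j\<bar>"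
      using n by (intro mult_strict_left_mono) auto
    then show ?thesis using n by simp
  qed
  moreover have "sqrt n * \<bar>D - \<beta> j - E\<bar> \<le> sqrt n * (192 * t\<^sup>2 * s0 / c * (sqrt om / sqrt (c * sig2)))"
    by (rule mult_left_mono[OF bias]) simp
  moreover have "sqrt n * (192 * t\<^sup>2 * s0 / c * (sqrt om / sqrt (c * sig2))) =
      192 * sqrt n * t\<^sup>2 * s0 / (c * sqrt (c * sig2)) * sqrt om" by simp
  moreover have "sqrt n * \<bar>\<beta> j - bt j\<bar> \<le> sqrt n * \<bar>D - bt j\<bar> + sqrt n * \<bar>E\<bar> + sqrt n * \<bar>D - \<beta> j - E\<bar>"
    unfolding distrib_left[symmetric] by (intro mult_left_mono) auto
  \<comment> \<open>The distance of the true coefficient from the tested value is at most that of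
    the estimate plus noise plus bias.\<close>
  ultimately have "(c0 * sqrt (ln (card G)) - s * sqrt (2 / sig2) - 192 * sqrt n * t\<^sup>2 * s0 / (c * sqrt (c * sig2))) * sqrt om
     < sqrt n * \<bar>D - bt j\<bar>"
    unfolding left_diff_distrib by linarith
  moreover have "sqrt ((1 + \<delta>) / (1 - \<delta>)) * crit * sqrt om \<le>
    (c0 * sqrt (ln (card G)) - s * sqrt (2 / sig2) - 192 * sqrt n * t\<^sup>2 * s0 / (c * sqrt (c * sig2))) * sqrt om"
    using margin om unfolding crit_def by (intro mult_right_mono) auto
  moreover have "crit * sqrt oh \<le> crit * (sqrt ((1 + \<delta>) / (1 - \<delta>)) * sqrt om)"
    by (rule mult_left_mono[OF sqrt_oh crit_nonneg])
  ultimately have "crit * sqrt oh < sqrt n * \<bar>D - bt j\<bar>" by (simp add: mult_ac)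
  then have "crit < sqrt n * \<bar>D - bt j\<bar> / sqrt oh" using oh_pos by (simp add: pos_less_divide_eq)
  also have "\<dots> \<le> test_stat n p (\<lambda>_. lam) G bt y (X \<omega>) b g vv"
    unfolding test_stat_def D_def oh_def using finG G(2) by (intro Max_ge) auto
  finally have "boot_crit n p (\<lambda>_. lam) G (X \<omega>) g vv a < test_stat n p (\<lambda>_. lam) G bt y (X \<omega>) b g vv"
    unfolding crit_def using vv(1) by (intro boot_crit_less_if[OF finG _ a]) auto
  then show ?thesis
    unfolding rejects_def Let_def d_def[symmetric] b_def[symmetric] vv_def[symmetric]
    by (simp add: d g_def)
qed

lemma (in regression_model) rejects_event:
  assumes "lasso_estimator n p l bhat" "nodewise_lasso n p lj ghat" "variance_estimator n p vhat"
    and "G \<subseteq> {..<p}" "G \<noteq> {}" "0 < a" "a < 1"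
  shows "{\<omega> \<in> space M. rejects n p lj G bt a bhat ghat vhat (data n p X eps \<beta> \<omega>)} \<in> events"
proof -
  have "{d \<in> space (samples n p). rejects n p lj G bt a bhat ghat vhat d} \<in> sets (samples n p)"
    using assms unfolding lasso_estimator_def nodewise_lasso_def variance_estimator_def
    by (intro rejects_measurable) auto
  from measurable_sets[OF data_measurable this, of \<beta>]
  have "data n p X eps \<beta> -` {d \<in> space (samples n p). rejects n p lj G bt a bhat ghat vhat d} \<inter> space M \<in> events" .
  also have "data n p X eps \<beta> -` {d \<in> space (samples n p). rejects n p lj G bt a bhat ghat vhat d} \<inter> space M
      = {\<omega> \<in> space M. rejects n p lj G bt a bhat ghat vhat (data n p X eps \<beta> \<omega>)}"
    using measurable_space[OF data_measurable] by auto
  finally show ?thesis .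
qed

text \<open>Acceptance is possible only on one of three bad events: failed concentration, large
  noise, or an inaccurate variance estimate.\<close>

lemma (in concentrated_row) rejection_probability:
  fixes bhat ghat vhat and G :: "nat set" and bt \<beta> :: "nat \<Rightarrow> real" and a \<delta> t s c0 :: real and s0 :: nat
  assumes lasso: "lasso_estimator n p (2 * t) bhat" and node: "nodewise_lasso n p (\<lambda>_. 2 * t) ghat"
    and var: "variance_estimator n p vhat"
    and G: "G \<subseteq> {..<p}" "j \<in> G" and a: "0 < a" "a < 1"
    and \<beta>: "card {k. k < p \<and> \<beta> k \<noteq> 0} \<le> s0"
    and t: "t > 0" "t \<le> h * V" "32 * t * s0 \<le> c"
    and \<delta>: "0 < \<delta>" "\<delta> \<le> 1 / 2" "t + 8 * t * (sqrt (row_sparsity M p X j) * sqrt (Cd / c)) \<le> \<delta> * c"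
    and sig2: "sig2 > 0" and s: "s > 0" and c0: "c0 > 0"
    and alt: "\<bar>\<beta> j - bt j\<bar> / sqrt (sig2 * \<theta>) > c0 * sqrt (ln (card G) / n)"
    and margin: "sqrt ((1 + \<delta>) / (1 - \<delta>)) * sqrt (2 * ln (2 * card G / a)) \<le>
       c0 * sqrt (ln (card G)) - s * sqrt (2 / sig2) - 192 * sqrt n * t\<^sup>2 * s0 / (c * sqrt (c * sig2))"
  shows "prob {\<omega> \<in> space M. rejects n p (\<lambda>_. 2 * t) G bt a bhat ghat vhat (data n p X eps \<beta> \<omega>)} \<ge>
    1 - 8 * (real p)\<^sup>2 * exp (- (real n * t\<^sup>2 / (2 * V))) - sig2 / s\<^sup>2
      - prob {\<omega> \<in> space M. \<bar>vhat (data n p X eps \<beta> \<omega>) - sig2\<bar> > \<delta> * sig2}"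
proof -
  let ?R = "{\<omega> \<in> space M. rejects n p (\<lambda>_. 2 * t) G bt a bhat ghat vhat (data n p X eps \<beta> \<omega>)}"
  let ?w = "\<lambda>A i. \<Sum>k<p. Theta_hat n p (\<lambda>_. 2 * t) A (\<lambda>j. ghat j A) j k * A i k"
  obtain B where B: "B \<in> events" "prob B \<le> 8 * (real p)\<^sup>2 * exp (- (real n * t\<^sup>2 / (2 * V)))"
    "\<And>\<omega>. \<omega> \<in> space M - B \<Longrightarrow> concentrated t \<omega>"
    using concentration[OF t(1,2)] by blast
  define N where "N = {\<omega> \<in> space M. \<bar>\<Sum>i<n. ?w (X \<omega>) i * eps \<omega> i\<bar> > s * sqrt (\<Sum>i<n. (?w (X \<omega>) i)\<^sup>2)}"
  have w: "(\<lambda>A. ?w A i) \<in> borel_measurable (designs n p)" if "i < n" for i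
    using lasso node var G j that
    unfolding lasso_estimator_def nodewise_lasso_def variance_estimator_def
    by (intro weight_measurable[where vhat = vhat and bhat = bhat and G = G]) auto
  have Nm: "N \<in> events"
  proof -
    have wX: "(\<lambda>\<omega>. ?w (X \<omega>) i) \<in> borel_measurable M" if "i \<in> {..<n}" for i
      using measurable_compose[OF X_measurable w] that by simp
    have eX: "(\<lambda>\<omega>. eps \<omega> i) \<in> borel_measurable M" if "i \<in> {..<n}" for i using that by simp
    have [measurable]: "(\<lambda>\<omega>. \<Sum>i<n. ?w (X \<omega>) i * eps \<omega> i) \<in> borel_measurable M"
      by (rule borel_measurable_sum, rule borel_measurable_times, erule wX, erule eX)
    have [measurable]: "(\<lambda>\<omega>. \<Sum>i<n. (?w (X \<omega>) i)\<^sup>2) \<in> borel_measurable M"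
      by (rule borel_measurable_sum, rule borel_measurable_power, erule wX)
    show ?thesis unfolding N_def by measurable
  qed
  have Np: "prob N \<le> sig2 / s\<^sup>2" unfolding N_def by (rule weighted_noise_tail[OF w s])
  define U where "U = {\<omega> \<in> space M. \<bar>vhat (data n p X eps \<beta> \<omega>) - sig2\<bar> > \<delta> * sig2}"
  have Um: "U \<in> events"
  proof -
    have [measurable]: "(\<lambda>\<omega>. vhat (data n p X eps \<beta> \<omega>)) \<in> borel_measurable M"
      using var unfolding variance_estimator_def by (intro measurable_compose[OF data_measurable]) auto
    show ?thesis unfolding U_def by measurable
  qed
  have "space M - (B \<union> (N \<union> U)) \<subseteq> ?R"
  proof
    fix \<omega> assume \<omega>: "\<omega> \<in> space M - (B \<union> (N \<union> U))"
    have "rejects n p (\<lambda>_. 2 * t) G bt a bhat ghat vhat (data n p X eps \<beta> \<omega>)"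
    proof (rule concentrated_imp_rejects[where lam = "2 * t" and \<beta> = \<beta> and bt = bt and t = t, OF refl lasso node var G a \<beta> t(1,3) \<delta> sig2 s c0 alt margin])
      show "\<omega> \<in> space M" "concentrated t \<omega>" using \<omega> B(3) by auto
      show "\<bar>\<Sum>i<n. ?w (X \<omega>) i * eps \<omega> i\<bar> \<le> s * sqrt (\<Sum>i<n. (?w (X \<omega>) i)\<^sup>2)"
        using \<omega> unfolding N_def by (simp add: not_less)
      show "\<bar>vhat (data n p X eps \<beta> \<omega>) - sig2\<bar> \<le> \<delta> * sig2"
        using \<omega> unfolding U_def by (simp add: not_less)
    qed
    then show "\<omega> \<in> ?R" using \<omega> by simp
  qed
  moreover have "?R \<in> events" using G by (intro rejects_event[OF lasso node var G(1) _ a]) auto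
  ultimately have "prob (space M - (B \<union> (N \<union> U))) \<le> prob ?R" by (rule finite_measure_mono)
  moreover have "prob (space M - (B \<union> (N \<union> U))) = 1 - prob (B \<union> (N \<union> U))"
    using B(1) Nm Um by (intro prob_compl) auto
  moreover have "prob (B \<union> (N \<union> U)) \<le> prob B + (prob N + prob U)"
    using B(1) Nm Um by (intro order_trans[OF measure_Un_le] add_left_mono measure_Un_le) auto
  ultimately show ?thesis using B(2) Np unfolding U_def by linarith
qed

section \<open>Moment conditions in the two regimes\<close>

lemma (in regression_model) regression_rowI:
  assumes c: "0 < c" "c < Min (spectrum (covariance M p X))"
    and diag: "\<And>k. k < p \<Longrightarrow> covariance M p X $$ (k, k) \<le> Cd" and j: "j < p"
  shows "regression_row M n p X eps sig2 c Cd j"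
proof unfold_locales
  fix x
  have quad: "quad_form p (\<lambda>j k. covariance M p X $$ (j, k)) x = quad_form p S x"
    unfolding quad_form_def by (intro sum.cong refl) (simp add: covariance_S)
  have "c * (\<Sum>k<p. (x k)\<^sup>2) \<le> Min (spectrum (covariance M p X)) * (\<Sum>k<p. (x k)\<^sup>2)"
    using c by (intro mult_right_mono sum_nonneg) auto
  also have "\<dots> \<le> quad_form p (\<lambda>j k. covariance M p X $$ (j, k)) x"
    using covariance_carrier p S_sym by (intro Min_spectrum_le_quad_form) (auto simp: covariance_S)
  finally show "c * (\<Sum>k<p. (x k)\<^sup>2) \<le> quad_form p S x" unfolding quad .
next
  show "S k k \<le> Cd" if "k < p" for k using diag[OF that] covariance_S[OF that that] by simp
qed (use c j in auto)

context regression_row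
begin

lemma Cd_pos: "Cd > 0"
  using inverse_theta_le theta_pos by (intro less_le_trans[OF _ inverse_theta_le]) simp

text \<open>The sub-Gaussian assumption concerns vectors of length at most 1, while u has squared
  length at most Cd / c; rescaling inflates the constant by this factor. Products are then
  sub-exponential with the common constant D.\<close>

lemma concentrated_row_sub_gaussian:
  assumes Cx: "Cx > 0" and X: "\<And>i a. i < n \<Longrightarrow> L2_set a {..<p} \<le> 1 \<Longrightarrow>
      (\<integral>\<^sup>+\<omega>. ennreal (exp (\<bar>\<Sum>j<p. a j * X \<omega> i j\<bar>\<^sup>2 / Cx)) \<partial>M) \<le> 2"
    and Ce: "Ce > 0" and eps: "\<And>i. i < n \<Longrightarrow> sub_gaussian M Ce (\<lambda>\<omega>. eps \<omega> i)"
  defines "D \<equiv> max (Cx * (Cd / c)) Ce"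
  shows "concentrated_row M n p X eps sig2 c Cd j (1 / (2 * D)) (64 * D\<^sup>2)"
proof -
  have D: "D > 0" using Ce by (simp add: D_def)
  \<comment> \<open>Because the j-th entry of u is 1; this lets unit vectors pass the same length
    bound as u.\<close>
  have one_le: "1 \<le> Cd / c"
  proof -
    have "1 \<le> (\<Sum>k<p. (u k)\<^sup>2)"
      using member_le_sum[of j "{..<p}" "\<lambda>k. (u k)\<^sup>2"] j R.u_j by simp
    then show ?thesis using sum_u_square_le by simp
  qed
  define r where "r = sqrt (Cd / c)"
  have r: "r > 0" "r\<^sup>2 = Cd / c" using one_le by (auto simp: r_def)
  have lin_mgf: "sub_gaussian M D (\<lambda>\<omega>. lin a \<omega> i)"
    if i: "i < n" and a: "(\<Sum>k<p. (a k)\<^sup>2) \<le> Cd / c" for a i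
  proof -
    have "L2_set (\<lambda>k. a k / r) {..<p} = sqrt ((\<Sum>k<p. (a k)\<^sup>2) / r\<^sup>2)"
      by (simp add: L2_set_def power_divide sum_divide_distrib)
    also have "(\<Sum>k<p. (a k)\<^sup>2) / r\<^sup>2 \<le> 1"
      using a one_le unfolding r(2) by (subst divide_le_eq_1_pos) auto
    then have "sqrt ((\<Sum>k<p. (a k)\<^sup>2) / r\<^sup>2) \<le> 1" by simp
    finally have L2: "L2_set (\<lambda>k. a k / r) {..<p} \<le> 1" .
    have "(\<integral>\<^sup>+\<omega>. ennreal (exp ((lin a \<omega> i)\<^sup>2 / D)) \<partial>M) \<le>
       (\<integral>\<^sup>+\<omega>. ennreal (exp (\<bar>\<Sum>k<p. a k / r * X \<omega> i k\<bar>\<^sup>2 / Cx)) \<partial>M)"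
    proof (intro nn_integral_mono ennreal_leI)
      fix \<omega>
      have "(\<Sum>k<p. a k / r * X \<omega> i k) = lin a \<omega> i / r"
        by (simp add: lin_def sum_divide_distrib)
      then have "\<bar>\<Sum>k<p. a k / r * X \<omega> i k\<bar>\<^sup>2 / Cx = (lin a \<omega> i)\<^sup>2 / (Cx * (Cd / c))"
        by (simp add: power_divide r(2) mult.commute)
      moreover have "(lin a \<omega> i)\<^sup>2 / D \<le> (lin a \<omega> i)\<^sup>2 / (Cx * (Cd / c))"
        using D Cx one_le by (intro divide_left_mono mult_pos_pos) (auto simp: D_def)
      ultimately show "exp ((lin a \<omega> i)\<^sup>2 / D) \<le> exp (\<bar>\<Sum>k<p. a k / r * X \<omega> i k\<bar>\<^sup>2 / Cx)" by simp
    qed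
    also have "\<dots> \<le> 2" by (rule X[OF i L2])
    finally show ?thesis .
  qed
  have X_mgf: "sub_gaussian M D (\<lambda>\<omega>. X \<omega> i k)" if "i < n" "k < p" for i k
    unfolding entry_eq_lin[OF that(2)]
  proof (rule lin_mgf[OF that(1)])
    have "(\<Sum>l<p. (if l = k then 1 else 0 :: real)\<^sup>2) = 1"
      using that by (simp add: if_distrib[of "\<lambda>x. x\<^sup>2"] cong: if_cong)
    then show "(\<Sum>l<p. (if l = k then 1 else 0 :: real)\<^sup>2) \<le> Cd / c" using one_le by simp
  qed
  have u_mgf: "sub_gaussian M D (\<lambda>\<omega>. lin u \<omega> i)" if "i < n" for i
    by (rule lin_mgf[OF that sum_u_square_le])
  have e_mgf: "sub_gaussian M D (\<lambda>\<omega>. eps \<omega> i)" if "i < n" for i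
  proof -
    have "(\<integral>\<^sup>+\<omega>. ennreal (exp ((eps \<omega> i)\<^sup>2 / D)) \<partial>M) \<le> (\<integral>\<^sup>+\<omega>. ennreal (exp ((eps \<omega> i)\<^sup>2 / Ce)) \<partial>M)"
      using Ce D by (intro nn_integral_mono ennreal_leI) (auto intro!: divide_left_mono simp: D_def)
    also have "\<dots> \<le> 2" by (rule eps[OF that])
    finally show ?thesis .
  qed
  have prod: "bernstein_moment M (1 / (2 * D)) (64 * D\<^sup>2) (\<lambda>\<omega>. U \<omega> * W \<omega>)"
    if "U \<in> borel_measurable M" "W \<in> borel_measurable M"
      "sub_gaussian M D U" "sub_gaussian M D W" for U W
    using that D
    by (intro bernstein_moment_sub_exponential[of "\<lambda>\<omega>. U \<omega> * W \<omega>"] sub_exponential_product) auto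
  show ?thesis
  proof unfold_locales
    show "1 / (2 * D) > 0" "64 * D\<^sup>2 > 0" using D by auto
  qed (rule prod; simp add: X_mgf u_mgf e_mgf)+
qed

text \<open>The population residual is an entry minus its fit, hence bounded by 2 K. Its square is
  the worst product: its size 4 K^2 explains 1 / 4 in \<open>h0\<close>, and its moment bound 3 (2
  K)^2 Cd explains 12 Cd in \<open>V0\<close>. The remaining terms of \<open>h0\<close> and
  \<open>V0\<close> come from the products with the errors.\<close>

lemma concentrated_row_bounded:
  assumes K: "K \<ge> 1"
    and X: "\<And>i k. i < n \<Longrightarrow> k < p \<Longrightarrow> AE \<omega> in M. \<bar>X \<omega> i k\<bar> \<le> K"
    and fit: "\<And>i. i < n \<Longrightarrow> AE \<omega> in M. \<bar>pop_fit M n p X j \<omega> i\<bar> \<le> K"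
    and Ce: "Ce > 0" and eps: "\<And>i. i < n \<Longrightarrow> sub_exponential M Ce (\<lambda>\<omega>. eps \<omega> i)"
  defines "h0 \<equiv> min (1 / 4) (1 / (2 * Ce))" and "V0 \<equiv> max (12 * Cd) (64 * Ce\<^sup>2)"
  shows "concentrated_row M n p X eps sig2 c Cd j (h0 / K\<^sup>2) (V0 * K\<^sup>2)"
proof -
  have h0: "h0 > 0" "h0 \<le> 1 / 4" "h0 * (2 * Ce) \<le> 1"
    using Ce by (auto simp: h0_def min_def field_simps)
  have V0: "V0 > 0" "12 * Cd \<le> V0" "64 * Ce\<^sup>2 \<le> V0" using Ce by (auto simp: V0_def less_max_iff_disj)
  have u_bound: "AE \<omega> in M. \<bar>lin u \<omega> i\<bar> \<le> 2 * K" if "i < n" for i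
    using X[OF that j] fit[OF that]
    by eventually_elim (auto simp: pop_fit_eq)
  have X2: "expectation (\<lambda>\<omega>. (X \<omega> i k)\<^sup>2) \<le> Cd" if "i < n" "k < p" for i k
    using entry_product_expectation[OF that(1,2,2)] diag[OF that(2)] by (simp add: power2_eq_square)
  have u2: "expectation (\<lambda>\<omega>. (lin u \<omega> i)\<^sup>2) \<le> Cd" if "i < n" for i
    using lin_u_square_expectation[OF that] inverse_theta_le by simp
  have hK: "h0 / K\<^sup>2 * (K * K) \<le> 1" "h0 / K\<^sup>2 * (K * (2 * K)) \<le> 1" "h0 / K\<^sup>2 * (2 * K * (2 * K)) \<le> 1"
    "h0 / K\<^sup>2 \<ge> 0"
    using h0 K by (auto simp: power2_eq_square)
  have hCe: "h0 / K\<^sup>2 * (2 * Ce * K) \<le> 1"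
  proof -
    have "h0 / K\<^sup>2 * (2 * Ce * K) = h0 * (2 * Ce) / K" using K by (simp add: power2_eq_square)
    also have "\<dots> \<le> 1 / 1" using h0 K Ce by (intro frac_le) auto
    finally show ?thesis by simp
  qed
  have KV: "3 * K\<^sup>2 * Cd \<le> V0 * K\<^sup>2" "3 * (2 * K)\<^sup>2 * Cd \<le> V0 * K\<^sup>2" "64 * Ce\<^sup>2 * K\<^sup>2 \<le> V0 * K\<^sup>2"
  proof -
    have "12 * Cd * K\<^sup>2 \<le> V0 * K\<^sup>2" using V0 by (intro mult_right_mono) auto
    moreover have "0 \<le> Cd * K\<^sup>2" using Cd_pos by simp
    ultimately show "3 * K\<^sup>2 * Cd \<le> V0 * K\<^sup>2" "3 * (2 * K)\<^sup>2 * Cd \<le> V0 * K\<^sup>2"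
      by (auto simp: power_mult_distrib mult_ac)
    show "64 * Ce\<^sup>2 * K\<^sup>2 \<le> V0 * K\<^sup>2" using V0 by (intro mult_right_mono) auto
  qed
  show ?thesis
  proof unfold_locales
    show "h0 / K\<^sup>2 > 0" "V0 * K\<^sup>2 > 0" using h0 V0 K by auto
  next
    fix i k m assume i: "i < n" "k < p" "m < p"
    show "bernstein_moment M (h0 / K\<^sup>2) (V0 * K\<^sup>2) (\<lambda>\<omega>. X \<omega> i k * X \<omega> i m)"
      using i K by (intro order_trans[OF bernstein_moment_bounded[OF X X _ X2] ennreal_leI[OF KV(1)]] hK square_integrable) auto
  next
    fix i k assume i: "i < n" "k < p"
    have "bernstein_moment M (h0 / K\<^sup>2) (V0 * K\<^sup>2) (\<lambda>\<omega>. X \<omega> i k * lin u \<omega> i)"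
      using i K by (intro order_trans[OF bernstein_moment_bounded[OF X u_bound _ u2] ennreal_leI[OF KV(1)]] hK lin_square_integrable) auto
    then show "bernstein_moment M (h0 / K\<^sup>2) (V0 * K\<^sup>2) (\<lambda>\<omega>. lin u \<omega> i * X \<omega> i k)"
      by (simp only: mult.commute[of "X _ i k"])
  next
    fix i assume i: "i < n"
    show "bernstein_moment M (h0 / K\<^sup>2) (V0 * K\<^sup>2) (\<lambda>\<omega>. lin u \<omega> i * lin u \<omega> i)"
      using i K by (intro order_trans[OF bernstein_moment_bounded[OF u_bound u_bound _ u2] ennreal_leI[OF KV(2)]] hK lin_square_integrable) auto
  next
    fix i k assume i: "i < n" "k < p"
    show "bernstein_moment M (h0 / K\<^sup>2) (V0 * K\<^sup>2) (\<lambda>\<omega>. X \<omega> i k * eps \<omega> i)"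
      using i K Ce by (intro order_trans[OF bernstein_moment_bounded_sub_exponential[OF _ X _ Ce eps] ennreal_leI[OF KV(3)]] hK hCe) auto
  qed
qed

end

lemma A1_K0_ge_1: "A1 R M p X \<Longrightarrow> n \<ge> 1 \<Longrightarrow> K0 R n \<ge> 1"
  by (cases R) auto

text \<open>The constants are fixed before n and j. As K0 is 1 in the sub-Gaussian case, both
  regimes fit one scaling in K0.\<close>

lemma uniform_concentrated_rows:
  fixes M :: "nat \<Rightarrow> 'a measure"
  assumes model: "\<And>n. n \<ge> 1 \<Longrightarrow> linear_model (M n) n (p n) (X n) (eps n) (sig2 n)"
    and p: "\<And>n. n \<ge> 1 \<Longrightarrow> p n \<ge> 1"
    and A1: "A1 R M p X" and A2: "A2 M p X" and A3: "A3 R M p X eps sig2"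
  shows "\<exists>c>0. \<exists>Cd>0. \<exists>h0>0. \<exists>V0>0. \<forall>n\<ge>1. \<forall>j<p n.
    concentrated_row (M n) n (p n) (X n) (eps n) (sig2 n) c Cd j (h0 / (K0 R n)\<^sup>2) (V0 * (K0 R n)\<^sup>2)"
proof -
  obtain c Cd where c: "c > 0" "Cd > 0"
    "\<And>n. n \<ge> 1 \<Longrightarrow> c < Min (spectrum (covariance (M n) (p n) (X n)))"
    "\<And>n j. n \<ge> 1 \<Longrightarrow> j < p n \<Longrightarrow> covariance (M n) (p n) (X n) $$ (j, j) \<le> Cd"
    using A2 unfolding A2_def by blast
  have row: "regression_row (M n) n (p n) (X n) (eps n) (sig2 n) c Cd j" if "n \<ge> 1" "j < p n" for n j
  proof -
    interpret regression_model "M n" n "p n" "X n" "eps n" "sig2 n"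
      using model p that by unfold_locales auto
    show ?thesis using c that by (intro regression_rowI) auto
  qed
  show ?thesis
  proof (cases R)
    case Sub_Gaussian
    obtain Cx where Cx: "Cx > 0" "\<And>n i a. n \<ge> 1 \<Longrightarrow> i < n \<Longrightarrow> L2_set a {..<p n} \<le> 1 \<Longrightarrow>
        (\<integral>\<^sup>+\<omega>. ennreal (exp (\<bar>\<Sum>j<p n. a j * X n \<omega> i j\<bar>\<^sup>2 / Cx)) \<partial>M n) \<le> 2"
      using A1 unfolding Sub_Gaussian A1.simps by blast
    obtain Ce where Ce: "Ce > 0" "\<And>n i. n \<ge> 1 \<Longrightarrow> i < n \<Longrightarrow> (\<integral>\<^sup>+\<omega>. ennreal (exp ((eps n \<omega> i)\<^sup>2 / Ce)) \<partial>M n) \<le> 2"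
      using A3 unfolding Sub_Gaussian A3.simps by blast
    define D where "D = max (Cx * (Cd / c)) Ce"
    have "concentrated_row (M n) n (p n) (X n) (eps n) (sig2 n) c Cd j (1 / (2 * D) / (K0 R n)\<^sup>2) (64 * D\<^sup>2 * (K0 R n)\<^sup>2)"
      if "n \<ge> 1" "j < p n" for n j
      using regression_row.concentrated_row_sub_gaussian[OF row[OF that] Cx(1) Cx(2)[OF that(1)] Ce(1) Ce(2)[OF that(1)]]
      by (simp add: D_def Sub_Gaussian)
    moreover have "1 / (2 * D) > 0" "64 * D\<^sup>2 > 0" using Ce(1) by (auto simp: D_def less_max_iff_disj)
    ultimately show ?thesis using c(1,2) by blast
  next
    case (Strongly_Bounded K)
    have K: "K n \<ge> 1" "\<And>i k. i < n \<Longrightarrow> k < p n \<Longrightarrow> AE \<omega> in M n. \<bar>X n \<omega> i k\<bar> \<le> K n"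
      "\<And>i j. i < n \<Longrightarrow> j < p n \<Longrightarrow> AE \<omega> in M n. \<bar>pop_fit (M n) n (p n) (X n) j \<omega> i\<bar> \<le> K n" if "n \<ge> 1" for n
      using A1 that unfolding Strongly_Bounded A1.simps by blast+
    obtain Ce where Ce: "Ce > 0" "\<And>n i. n \<ge> 1 \<Longrightarrow> i < n \<Longrightarrow> (\<integral>\<^sup>+\<omega>. ennreal (exp (\<bar>eps n \<omega> i\<bar> / Ce)) \<partial>M n) \<le> 2"
      using A3 unfolding Strongly_Bounded A3.simps by blast
    define h0 where "h0 = min (1 / 4) (1 / (2 * Ce))"
    define V0 where "V0 = max (12 * Cd) (64 * Ce\<^sup>2)"
    have "concentrated_row (M n) n (p n) (X n) (eps n) (sig2 n) c Cd j (h0 / (K0 R n)\<^sup>2) (V0 * (K0 R n)\<^sup>2)"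
      if "n \<ge> 1" "j < p n" for n j
      using regression_row.concentrated_row_bounded[OF row[OF that] K(1)[OF that(1)] K(2)[OF that(1)]
          K(3)[OF that(1) _ that(2)] Ce(1) Ce(2)[OF that(1)]]
      by (simp add: h0_def V0_def Strongly_Bounded)
    moreover have "h0 > 0" "V0 > 0" using Ce(1) c(2) by (auto simp: h0_def V0_def less_max_iff_disj)
    ultimately show ?thesis using c(1,2) by blast
  qed
qed

lemma A3_variance_bounds:
  assumes "A3 R M p X eps sig2"
  obtains lo hi where "lo > 0" "\<And>n. n \<ge> 1 \<Longrightarrow> lo < sig2 n" "\<And>n. n \<ge> 1 \<Longrightarrow> sig2 n < hi"
proof -
  have "\<exists>c'>0. \<exists>c>0. \<forall>n\<ge>1. c' < sig2 n \<and> sig2 n < c"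
    using assms by (cases R) (simp_all only: A3.simps)
  then show ?thesis using that by blast
qed

section \<open>Asymptotics\<close>

lemma eventually_less_of_square:
  fixes f g :: "nat \<Rightarrow> real"
  assumes le: "eventually (\<lambda>n. (f n)\<^sup>2 \<le> C * g n) sequentially" and g: "g \<longlonglongrightarrow> 0" and r: "r > 0"
  shows "eventually (\<lambda>n. f n < r) sequentially"
proof -
  have "(\<lambda>n. C * g n) \<longlonglongrightarrow> C * 0" by (intro tendsto_mult_left g)
  then have "eventually (\<lambda>n. C * g n < r\<^sup>2) sequentially"
    using r by (intro order_tendstoD) auto
  with le show ?thesis
  proof eventually_elim
    case (elim n)
    then have "(f n)\<^sup>2 < r\<^sup>2" by simp
    then show ?case by (rule power2_less_imp_less) (use r in simp)
  qed
qed

lemma sqrt_ratio_le: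
  fixes \<delta> :: real
  assumes "0 < \<delta>" "\<delta> \<le> 1 / 2"
  shows "sqrt ((1 + \<delta>) / (1 - \<delta>)) \<le> 1 + 2 * \<delta>"
proof -
  have "0 \<le> \<delta> * (2 - 4 * \<delta>)" using assms by (intro mult_nonneg_nonneg) auto
  then have "1 + \<delta> \<le> (1 + 4 * \<delta>) * (1 - \<delta>)" by (simp add: algebra_simps)
  then have "(1 + \<delta>) / (1 - \<delta>) \<le> 1 + 4 * \<delta>" using assms by (simp add: pos_divide_le_eq)
  also have "\<dots> \<le> (1 + 2 * \<delta>)\<^sup>2" by (simp add: power2_sum power_mult_distrib)
  finally show ?thesis using assms by (intro real_le_lsqrt) auto
qed

text \<open>Budget for the surplus e0 x: inflation of the scale takes at most 3 / 4 of it, by 2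
  \<delta> <= e0 / 2 and sqrt 2 <= 3 / 2; the offset 2 sqrt C1 and the bias b <= 1 together take 1 /
  8, and the noise takes 1 / 16.\<close>

lemma bootstrap_margin:
  fixes x k1 b C1 \<delta> e0 :: real
  assumes \<delta>: "0 < \<delta>" "\<delta> \<le> 1 / 2" "4 * \<delta> \<le> e0" and C1: "C1 \<ge> 0"
    and x: "x > 0" "16 * sqrt C1 + 8 \<le> e0 * x" "16 * k1 \<le> e0 * sqrt x" and b: "b \<le> 1"
  shows "sqrt ((1 + \<delta>) / (1 - \<delta>)) * sqrt (2 * x\<^sup>2 + C1) \<le> (sqrt 2 + e0) * x - sqrt x * k1 - b"
proof -
  have "sqrt (2 * x\<^sup>2 + C1) \<le> sqrt (2 * x\<^sup>2) + sqrt C1"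
    using C1 by (intro sqrt_add_le_add_sqrt) auto
  then have s: "sqrt (2 * x\<^sup>2 + C1) \<le> sqrt 2 * x + sqrt C1" using x by (simp add: real_sqrt_mult)
  have "sqrt ((1 + \<delta>) / (1 - \<delta>)) \<le> 1 + 2 * \<delta>" by (rule sqrt_ratio_le[OF \<delta>(1,2)])
  then have "sqrt ((1 + \<delta>) / (1 - \<delta>)) * sqrt (2 * x\<^sup>2 + C1) \<le> (1 + 2 * \<delta>) * (sqrt 2 * x + sqrt C1)"
    using s \<delta> C1 by (intro mult_mono) auto
  also have "\<dots> = sqrt 2 * x + (2 * \<delta>) * (sqrt 2 * x) + (1 + 2 * \<delta>) * sqrt C1" by (simp add: algebra_simps)
  also have "(2 * \<delta>) * (sqrt 2 * x) \<le> (e0 / 2) * (sqrt 2 * x)"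
    using \<delta> x by (intro mult_right_mono) auto
  also have "(e0 / 2) * (sqrt 2 * x) \<le> (e0 / 2) * (3 / 2 * x)"
  proof -
    have "sqrt 2 \<le> (3 / 2 :: real)" by (intro real_le_lsqrt) (auto simp: power2_eq_square)
    then show ?thesis using \<delta> x by (intro mult_left_mono mult_right_mono) auto
  qed
  also have "(1 + 2 * \<delta>) * sqrt C1 \<le> 2 * sqrt C1" using \<delta> C1 by (intro mult_right_mono) auto
  finally have "sqrt ((1 + \<delta>) / (1 - \<delta>)) * sqrt (2 * x\<^sup>2 + C1) \<le> sqrt 2 * x + 3 / 4 * (e0 * x) + 2 * sqrt C1"
    by simp
  moreover have "sqrt x * (16 * k1) \<le> sqrt x * (e0 * sqrt x)" using x by (intro mult_left_mono) auto
  then have "16 * (sqrt x * k1) \<le> e0 * x" using x by (simp add: algebra_simps)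
  moreover have "0 < e0 * x" using \<delta> x by simp
  ultimately show ?thesis using x(2) b unfolding distrib_right by linarith
qed

text \<open>The infimum of reals over an empty set would be an unspecified value. Moving coordinate
  j alone far enough from its tested value needs at most one nonzero entry.\<close>

lemma alternatives_nonempty:
  assumes j: "j \<in> G" and G: "G \<subseteq> {..<p}" and w: "w j > 0" and s0: "s0 \<ge> 1"
  shows "alternatives n p w G bt c \<inter> sparse_vectors p s0 \<noteq> {}"
proof -
  have fin: "finite G" using G finite_subset by blast
  let ?m = "\<bar>c * sqrt (ln (card G) / n)\<bar> + 1"
  define \<beta> where "\<beta> = restrict (\<lambda>k. if k = j then bt j + ?m * sqrt (w j) else 0) {..<p}"
  have "c * sqrt (ln (card G) / n) < ?m" by linarith
  also have "?m = \<bar>\<beta> j - bt j\<bar> / sqrt (w j)"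
  proof -
    have "\<beta> j - bt j = ?m * sqrt (w j)" using j G by (auto simp: \<beta>_def)
    then show ?thesis using w by (simp add: abs_mult)
  qed
  also have "\<dots> \<le> (MAX j\<in>G. \<bar>\<beta> j - bt j\<bar> / sqrt (w j))" using fin j by (intro Max_ge) auto
  finally have "\<beta> \<in> alternatives n p w G bt c" by (simp add: alternatives_def \<beta>_def)
  moreover have "card {k. k < p \<and> \<beta> k \<noteq> 0} \<le> card {j}"
    by (intro card_mono) (auto simp: \<beta>_def split: if_splits)
  then have "\<beta> \<in> sparse_vectors p s0" using s0 by (simp add: sparse_vectors_def \<beta>_def)
  ultimately show ?thesis by blast
qed

lemma tendsto_INF_one:
  fixes P :: "nat \<Rightarrow> 'b \<Rightarrow> real"
  assumes lower: "eventually (\<lambda>n. U n \<noteq> {} \<and> (\<forall>\<beta>\<in>U n. 1 - r n \<le> P n \<beta> \<and> 0 \<le> P n \<beta> \<and> P n \<beta> \<le> 1)) sequentially"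
    and r: "r \<longlonglongrightarrow> 0"
  shows "(\<lambda>n. INF \<beta>\<in>U n. P n \<beta>) \<longlonglongrightarrow> 1"
proof (rule tendsto_sandwich[of "\<lambda>n. 1 - r n" _ _ "\<lambda>_. 1"])
  show "eventually (\<lambda>n. 1 - r n \<le> (INF \<beta>\<in>U n. P n \<beta>)) sequentially"
    using lower by eventually_elim (auto intro!: cINF_greatest)
  show "eventually (\<lambda>n. (INF \<beta>\<in>U n. P n \<beta>) \<le> 1) sequentially"
    using lower
  proof eventually_elim
    case (elim n)
    then obtain \<beta> where \<beta>: "\<beta> \<in> U n" by blast
    have "(INF \<beta>\<in>U n. P n \<beta>) \<le> P n \<beta>"
      using elim \<beta> by (intro cINF_lower bdd_belowI[of _ 0]) auto
    also have "\<dots> \<le> 1" using elim \<beta> by blast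
    finally show ?case .
  qed
  show "(\<lambda>n. 1 - r n) \<longlonglongrightarrow> 1" using tendsto_diff[OF tendsto_const r, of 1] by simp
qed simp

text \<open>The Chebyshev level \<open>sqrt x\<close> diverges, but more slowly than the signal \<open>x = sqrt (ln |G|)\<close>.\<close>

lemma (in concentrated_row) rejection_probability_rate:
  fixes bhat ghat vhat and G :: "nat set" and bt \<beta> :: "nat \<Rightarrow> real" and a \<delta> e0 lo hi \<alpha> V0 K t x :: real and s0 :: nat
  defines "x \<equiv> sqrt (ln (card G))" and "t \<equiv> sqrt (6 * V0) * K * sqrt (ln p / n)"
  assumes lasso: "lasso_estimator n p (2 * t) bhat" and node: "nodewise_lasso n p (\<lambda>_. 2 * t) ghat"
    and var: "variance_estimator n p vhat"
    and G: "G \<subseteq> {..<p}" "j \<in> G" and a: "0 < a" "a < 1"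
    and \<beta>: "card {k. k < p \<and> \<beta> k \<noteq> 0} \<le> s0"
    and V0: "V0 > 0" "V = V0 * K\<^sup>2" and K: "K \<ge> 1" and lnp: "ln p \<ge> 1"
    and t: "t \<le> h * V" "32 * t * s0 \<le> c"
    and \<delta>: "0 < \<delta>" "\<delta> \<le> 1 / 2" "4 * \<delta> \<le> e0" "t + 8 * t * (sqrt (row_sparsity M p X j) * sqrt (Cd / c)) \<le> \<delta> * c"
    and sig2: "lo > 0" "lo < sig2" "sig2 < hi"
    and alt: "\<bar>\<beta> j - bt j\<bar> / sqrt (sig2 * precision M p X $$ (j, j)) > (sqrt 2 + e0) * sqrt (ln (card G) / n)"
    and x: "x > 0" "16 * sqrt (2 * ln (2 / a)) + 8 \<le> e0 * x" "16 * sqrt (2 / lo) \<le> e0 * sqrt x"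
    and bias: "sqrt n * t\<^sup>2 * s0 \<le> c * sqrt (c * lo) / 192"
    and \<alpha>: "1 \<le> \<alpha> * (\<delta> * lo)"
  shows "prob {\<omega> \<in> space M. rejects n p (\<lambda>_. 2 * t) G bt a bhat ghat vhat (data n p X eps \<beta> \<omega>)} \<ge>
    1 - (8 / p + hi / x + prob {\<omega> \<in> space M. \<alpha> * (ln p)\<^sup>2 * \<bar>vhat (data n p X eps \<beta> \<omega>) - sig2\<bar> > 1})"
proof -
  have sig2_pos: "sig2 > 0" using sig2 by simp
  have n0: "real n > 0" using n by simp
  have p0: "real p > 0" using p by simp
  have e0: "e0 > 0" using \<delta> by simp
  have t_pos: "t > 0" using V0 K lnp n0 unfolding t_def by (intro mult_pos_pos) auto
  have t2: "t\<^sup>2 = 6 * V0 * K\<^sup>2 * ln p / n"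
    using V0 lnp n0 unfolding t_def by (simp add: power_mult_distrib)
  have ca: "card G \<ge> 1" using G finite_subset[of G "{..<p}"] by (auto simp: Suc_le_eq card_gt_0_iff)
  have x2: "x\<^sup>2 = ln (card G)" using ca by (simp add: x_def)
  have margin: "sqrt ((1 + \<delta>) / (1 - \<delta>)) * sqrt (2 * ln (2 * card G / a)) \<le>
       (sqrt 2 + e0) * sqrt (ln (card G)) - sqrt x * sqrt (2 / sig2) - 192 * sqrt n * t\<^sup>2 * s0 / (c * sqrt (c * sig2))"
  proof -
    have "ln (2 * card G / a) = ln (card G * (2 / a))" by (simp add: mult.commute)
    also have "\<dots> = ln (card G) + ln (2 / a)" using ca a by (intro ln_mult_pos) auto
    finally have eq: "2 * ln (2 * card G / a) = 2 * x\<^sup>2 + 2 * ln (2 / a)" unfolding x2 by simp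
    have cheb: "sqrt x * sqrt (2 / sig2) \<le> sqrt x * sqrt (2 / lo)"
      using sig2 x(1) by (intro mult_left_mono real_sqrt_le_mono divide_left_mono) auto
    have one: "192 * sqrt n * t\<^sup>2 * s0 / (c * sqrt (c * sig2)) \<le> 1"
    proof -
      have "192 * sqrt n * t\<^sup>2 * s0 \<le> c * sqrt (c * lo)" using bias by (simp add: mult_ac)
      also have "\<dots> \<le> c * sqrt (c * sig2)" using c sig2 by (intro mult_left_mono real_sqrt_le_mono) auto
      finally show ?thesis using c sig2_pos by (simp add: divide_le_eq)
    qed
    have "2 * ln (2 / a) \<ge> 0" using a by (simp add: ln_ge_zero)
    from bootstrap_margin[OF \<delta>(1-3) this x one] cheb show ?thesis
      unfolding x_def[symmetric] eq by linarith
  qed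
  have "1 - 8 * (real p)\<^sup>2 * exp (- (real n * t\<^sup>2 / (2 * V))) - sig2 / (sqrt x)\<^sup>2
      - prob {\<omega> \<in> space M. \<bar>vhat (data n p X eps \<beta> \<omega>) - sig2\<bar> > \<delta> * sig2}
    \<le> prob {\<omega> \<in> space M. rejects n p (\<lambda>_. 2 * t) G bt a bhat ghat vhat (data n p X eps \<beta> \<omega>)}"
  proof (rule rejection_probability[OF lasso node var G a \<beta> t_pos t \<delta>(1,2,4) sig2_pos])
    show "sqrt x > 0" "sqrt 2 + e0 > 0" using x(1) e0 by (auto intro: add_pos_pos)
    show "(sqrt 2 + e0) * sqrt (ln (card G) / n) < \<bar>\<beta> j - bt j\<bar> / sqrt (sig2 * \<theta>)"
      using alt by (simp add: \<theta>_def)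
  qed (rule margin)
  \<comment> \<open>The constant 6 in t makes the exponent 3 ln p, which beats the p^2 of the union
    bound and leaves 8 / p.\<close>
  moreover have "8 * (real p)\<^sup>2 * exp (- (real n * t\<^sup>2 / (2 * V))) = 8 / p"
  proof -
    have "real n * t\<^sup>2 / (2 * V) = 3 * ln p"
      using n0 V0(1) K unfolding t2 V0(2) by simp
    also have "\<dots> = ln (real p ^ 3)" using p0 by (simp add: ln_realpow)
    finally have "exp (- (real n * t\<^sup>2 / (2 * V))) = 1 / real p ^ 3"
      using p0 by (simp add: exp_minus field_simps)
    then show ?thesis using p0 by (simp add: power2_eq_square power3_eq_cube)
  qed
  moreover have "sig2 / (sqrt x)\<^sup>2 \<le> hi / x" using sig2 x(1) by (simp add: divide_right_mono)
  \<comment> \<open>As ln p >= 1 and \<alpha> \<delta> lo >= 1, an error above \<delta> sig2 already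
    violates the much sharper bound of (A4).\<close>
  moreover have "prob {\<omega> \<in> space M. \<bar>vhat (data n p X eps \<beta> \<omega>) - sig2\<bar> > \<delta> * sig2} \<le>
     prob {\<omega> \<in> space M. \<alpha> * (ln p)\<^sup>2 * \<bar>vhat (data n p X eps \<beta> \<omega>) - sig2\<bar> > 1}"
  proof (rule finite_measure_mono)
    have [measurable]: "(\<lambda>\<omega>. vhat (data n p X eps \<beta> \<omega>)) \<in> borel_measurable M"
      using var unfolding variance_estimator_def by (intro measurable_compose[OF data_measurable]) auto
    show "{\<omega> \<in> space M. \<alpha> * (ln p)\<^sup>2 * \<bar>vhat (data n p X eps \<beta> \<omega>) - sig2\<bar> > 1} \<in> events" by measurable
    have \<alpha>0: "\<alpha> > 0"
    proof (rule ccontr)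
      assume "\<not> \<alpha> > 0"
      then have "\<alpha> * (\<delta> * lo) \<le> 0" using \<delta> sig2 by (intro mult_nonpos_nonneg) auto
      then show False using \<alpha> by simp
    qed
    show "{\<omega> \<in> space M. \<bar>vhat (data n p X eps \<beta> \<omega>) - sig2\<bar> > \<delta> * sig2} \<subseteq>
      {\<omega> \<in> space M. \<alpha> * (ln p)\<^sup>2 * \<bar>vhat (data n p X eps \<beta> \<omega>) - sig2\<bar> > 1}"
    proof safe
      fix \<omega> assume *: "\<bar>vhat (data n p X eps \<beta> \<omega>) - sig2\<bar> > \<delta> * sig2"
      have "\<delta> * lo < \<delta> * sig2" using \<delta> sig2 by simp
      with * have "\<delta> * lo < \<bar>vhat (data n p X eps \<beta> \<omega>) - sig2\<bar>" by simp
      then have "\<alpha> * (\<delta> * lo) < \<alpha> * \<bar>vhat (data n p X eps \<beta> \<omega>) - sig2\<bar>"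
        using \<alpha>0 by (intro mult_strict_left_mono) auto
      also have "\<dots> \<le> (ln p)\<^sup>2 * (\<alpha> * \<bar>vhat (data n p X eps \<beta> \<omega>) - sig2\<bar>)"
      proof -
        have "1 \<le> (ln p)\<^sup>2" using lnp by (simp add: one_le_power)
        then have "1 * (\<alpha> * \<bar>vhat (data n p X eps \<beta> \<omega>) - sig2\<bar>) \<le> (ln p)\<^sup>2 * (\<alpha> * \<bar>vhat (data n p X eps \<beta> \<omega>) - sig2\<bar>)"
          using \<alpha>0 by (intro mult_right_mono) auto
        then show ?thesis by simp
      qed
      finally show "1 < \<alpha> * (ln p)\<^sup>2 * \<bar>vhat (data n p X eps \<beta> \<omega>) - sig2\<bar>"
        using \<alpha> by (simp add: mult_ac)
    qed
  qed
  ultimately show ?thesis by linarith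
qed

theorem theorem2p4:
  fixes M :: "nat \<Rightarrow> 'a measure"
    and p s0 :: "nat \<Rightarrow> nat"
    and X :: "nat \<Rightarrow> 'a \<Rightarrow> nat \<Rightarrow> nat \<Rightarrow> real"
    and eps :: "nat \<Rightarrow> 'a \<Rightarrow> nat \<Rightarrow> real"
    and sig2 :: "nat \<Rightarrow> real"
    and R :: regime
  assumes model: "\<And>n. n \<ge> 1 \<Longrightarrow> linear_model (M n) n (p n) (X n) (eps n) (sig2 n)"
    and dims: "\<And>n. n \<ge> 1 \<Longrightarrow> p n \<ge> 1 \<and> s0 n \<ge> 1"
    and "A1 R M p X"
    and "A2 M p X"
    and "A3 R M p X eps sig2"
    and "A5 M p X"
    and "(\<lambda>n. MAX j\<in>{..<p n}. (K0 R n)\<^sup>2 * (real (row_sparsity (M n) (p n) (X n) j))\<^sup>2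
            * ln (real (p n) * real n) ^ 3 * (ln (real n))\<^sup>2 / real n) \<longlonglongrightarrow> 0"
    and "(\<lambda>n. K0 R n ^ 4 * (real (s0 n))\<^sup>2 * ln (real (p n)) ^ 3 / real n) \<longlonglongrightarrow> 0"
  shows "\<exists>(l :: nat \<Rightarrow> real) (lj :: nat \<Rightarrow> nat \<Rightarrow> real).
    same_order (\<lambda>n. {0}) (\<lambda>n _. l n) (\<lambda>n. K0 R n * sqrt (ln (real (p n)) / real n)) \<and>
    same_order (\<lambda>n. {..<p n}) lj (\<lambda>n. K0 R n * sqrt (ln (real (p n)) / real n)) \<and>
    (\<forall>bhat ghat vhat (G :: nat \<Rightarrow> nat set) (bt :: nat \<Rightarrow> nat \<Rightarrow> real) a \<epsilon>\<^sub>0 U.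
       (\<forall>n\<ge>1. lasso_estimator n (p n) (l n) (bhat n)) \<and>
       (\<forall>n\<ge>1. nodewise_lasso n (p n) (lj n) (ghat n)) \<and>
       (\<forall>n\<ge>1. variance_estimator n (p n) (vhat n)) \<and>
       (\<forall>n\<ge>1. G n \<subseteq> {..<p n}) \<and> filterlim (\<lambda>n. card (G n)) at_top sequentially \<and>
       0 < a \<and> a < 1 \<and> \<epsilon>\<^sub>0 > 0 \<and>
       U = (\<lambda>n. alternatives n (p n) (\<lambda>j. sig2 n * precision (M n) (p n) (X n) $$ (j, j))
                   (G n) (bt n) (sqrt 2 + \<epsilon>\<^sub>0) \<inter> sparse_vectors (p n) (s0 n)) \<and>
       A4 M p X eps sig2 lj vhat U
       \<longrightarrow> (\<lambda>n. INF \<beta>\<in>U n. measure (M n)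
              {\<omega> \<in> space (M n).
                 rejects n (p n) (lj n) (G n) (bt n) a (bhat n) (ghat n) (vhat n)
                   (data n (p n) (X n) (eps n) \<beta> \<omega>)}) \<longlonglongrightarrow> 1)"
proof -
  obtain c Cd h0 V0 where const: "c > 0" "Cd > 0" "h0 > 0" "V0 > 0"
    and row: "\<And>n j. n \<ge> 1 \<Longrightarrow> j < p n \<Longrightarrow>
      concentrated_row (M n) n (p n) (X n) (eps n) (sig2 n) c Cd j (h0 / (K0 R n)\<^sup>2) (V0 * (K0 R n)\<^sup>2)"
  proof -
    have "\<exists>c>0. \<exists>Cd>0. \<exists>h0>0. \<exists>V0>0. \<forall>n\<ge>1. \<forall>j<p n.
      concentrated_row (M n) n (p n) (X n) (eps n) (sig2 n) c Cd j (h0 / (K0 R n)\<^sup>2) (V0 * (K0 R n)\<^sup>2)"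
      by (rule uniform_concentrated_rows[OF model _ assms(3-5)]) (use dims in auto)
    then show ?thesis using that by (elim exE conjE) blast
  qed
  obtain lo hi where sig: "lo > 0" "\<And>n. n \<ge> 1 \<Longrightarrow> lo < sig2 n" "\<And>n. n \<ge> 1 \<Longrightarrow> sig2 n < hi"
    using A3_variance_bounds[OF assms(5)] by blast
  have K: "K0 R n \<ge> 1" if "n \<ge> 1" for n using A1_K0_ge_1[OF assms(3) that] .
  define t where "t n = sqrt (6 * V0) * K0 R n * sqrt (ln (real (p n)) / real n)" for n
  define H where "H n = K0 R n ^ 4 * (real (s0 n))\<^sup>2 * ln (real (p n)) ^ 3 / real n" for n
  have H: "H \<longlonglongrightarrow> 0" unfolding H_def by fact
  show ?thesis
  proof (intro exI[of _ "\<lambda>n. 2 * t n"] exI[of _ "\<lambda>n j. 2 * t n"] conjI allI impI)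
    have order: "same_order J (\<lambda>n j. 2 * t n) (\<lambda>n. K0 R n * sqrt (ln (real (p n)) / real n))" for J
      unfolding same_order_def
      using const by (intro exI[of _ "2 * sqrt (6 * V0)"] conjI) (auto simp: t_def)
    show "same_order (\<lambda>n. {0}) (\<lambda>n _. 2 * t n) (\<lambda>n. K0 R n * sqrt (ln (real (p n)) / real n))"
      "same_order (\<lambda>n. {..<p n}) (\<lambda>n j. 2 * t n) (\<lambda>n. K0 R n * sqrt (ln (real (p n)) / real n))"
      by (rule order)+
  next
    fix bhat ghat vhat and G :: "nat \<Rightarrow> nat set" and bt :: "nat \<Rightarrow> nat \<Rightarrow> real" and a \<epsilon>\<^sub>0 :: real and U
    assume asm: "(\<forall>n\<ge>1. lasso_estimator n (p n) (2 * t n) (bhat n)) \<and>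
       (\<forall>n\<ge>1. nodewise_lasso n (p n) (\<lambda>j. 2 * t n) (ghat n)) \<and>
       (\<forall>n\<ge>1. variance_estimator n (p n) (vhat n)) \<and>
       (\<forall>n\<ge>1. G n \<subseteq> {..<p n}) \<and> filterlim (\<lambda>n. card (G n)) at_top sequentially \<and>
       0 < a \<and> a < 1 \<and> \<epsilon>\<^sub>0 > 0 \<and>
       U = (\<lambda>n. alternatives n (p n) (\<lambda>j. sig2 n * precision (M n) (p n) (X n) $$ (j, j))
                   (G n) (bt n) (sqrt 2 + \<epsilon>\<^sub>0) \<inter> sparse_vectors (p n) (s0 n)) \<and>
       A4 M p X eps sig2 (\<lambda>n j. 2 * t n) vhat U"
    then have lasso: "\<And>n. n \<ge> 1 \<Longrightarrow> lasso_estimator n (p n) (2 * t n) (bhat n)"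
      and node: "\<And>n. n \<ge> 1 \<Longrightarrow> nodewise_lasso n (p n) (\<lambda>_. 2 * t n) (ghat n)"
      and var: "\<And>n. n \<ge> 1 \<Longrightarrow> variance_estimator n (p n) (vhat n)"
      and G: "\<And>n. n \<ge> 1 \<Longrightarrow> G n \<subseteq> {..<p n}" and card_G: "filterlim (\<lambda>n. card (G n)) at_top sequentially"
      and a: "0 < a" "a < 1" and \<epsilon>\<^sub>0: "\<epsilon>\<^sub>0 > 0"
      and U: "U = (\<lambda>n. alternatives n (p n) (\<lambda>j. sig2 n * precision (M n) (p n) (X n) $$ (j, j))
                   (G n) (bt n) (sqrt 2 + \<epsilon>\<^sub>0) \<inter> sparse_vectors (p n) (s0 n))"
      and A4: "A4 M p X eps sig2 (\<lambda>n j. 2 * t n) vhat U"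
      by blast+
    define sp where "sp n = (MAX j\<in>{..<p n}. 2 * t n * sqrt (real (row_sparsity (M n) (p n) (X n) j)))" for n
    obtain \<alpha> where \<alpha>: "\<And>n. n \<ge> 1 \<Longrightarrow> \<alpha> n > 0" "filterlim \<alpha> at_top sequentially"
      "(\<lambda>n. \<alpha> n * (ln (real (p n)))\<^sup>2 * sp n) \<longlonglongrightarrow> 0"
      "(\<lambda>n. SUP \<beta>\<in>U n. measure (M n) {\<omega> \<in> space (M n).
          \<alpha> n * (ln (real (p n)))\<^sup>2 * \<bar>vhat n (data n (p n) (X n) (eps n) \<beta> \<omega>) - sig2 n\<bar> > 1}) \<longlonglongrightarrow> 0"
      using A4 unfolding A4_def sp_def by blast
    define bad where "bad n \<beta> = measure (M n) {\<omega> \<in> space (M n).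
          \<alpha> n * (ln (real (p n)))\<^sup>2 * \<bar>vhat n (data n (p n) (X n) (eps n) \<beta> \<omega>) - sig2 n\<bar> > 1}" for n \<beta>
    define x where "x n = sqrt (ln (real (card (G n))))" for n
    \<comment> \<open>Common relative accuracy for tau_j^2 and the variance estimate: 1 / 2 keeps
      the expansions valid, and a quarter of the surplus fits the budget of
      \<open>bootstrap_margin\<close>.\<close>
    define \<delta> where "\<delta> = min (1 / 2) (\<epsilon>\<^sub>0 / 4)"
    have \<delta>: "0 < \<delta>" "\<delta> \<le> 1 / 2" "4 * \<delta> \<le> \<epsilon>\<^sub>0" using \<epsilon>\<^sub>0 by (auto simp: \<delta>_def min_def)
    have ev1: "eventually (\<lambda>n. n \<ge> 1) sequentially" by (rule eventually_ge_at_top)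
    \<comment> \<open>The divergence of p is inherited from |G| <= p; it makes ln p >= 1 eventually
      and 8 / p negligible.\<close>
    have p_top: "filterlim (\<lambda>n. real (p n)) at_top sequentially"
    proof (rule filterlim_at_top_mono)
      show "filterlim (\<lambda>n. real (card (G n))) at_top sequentially"
        by (rule filterlim_compose[OF filterlim_real_sequentially card_G])
      show "eventually (\<lambda>n. real (card (G n)) \<le> real (p n)) sequentially"
        using ev1
      proof eventually_elim
        case (elim n)
        have "card (G n) \<le> card {..<p n}" using G[OF elim] by (intro card_mono) auto
        then show ?case by simp
      qed
    qed
    have x_top: "filterlim x at_top sequentially"
      unfolding x_def
      by (intro filterlim_compose[OF sqrt_at_top] filterlim_compose[OF ln_at_top]
          filterlim_compose[OF filterlim_real_sequentially card_G])
    have sqrt_x_top: "filterlim (\<lambda>n. sqrt (x n)) at_top sequentially"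
      by (rule filterlim_compose[OF sqrt_at_top x_top])
    have ln_p: "eventually (\<lambda>n. ln (real (p n)) \<ge> 1) sequentially"
      using filterlim_compose[OF ln_at_top p_top] unfolding filterlim_at_top by blast
    have t2: "(t n)\<^sup>2 = 6 * V0 * ((K0 R n)\<^sup>2 * ln (real (p n)) / n)" if "ln (real (p n)) \<ge> 1" for n
      using const that by (simp add: t_def power_mult_distrib)
    have t_small: "eventually (\<lambda>n. t n < r) sequentially"
      and ts_small: "eventually (\<lambda>n. t n * s0 n < r) sequentially"
      and tts_small: "eventually (\<lambda>n. sqrt n * (t n)\<^sup>2 * s0 n < r) sequentially" if r: "r > 0" for r
    proof -
      \<comment> \<open>With k = K0^2, m = s0^2 and y = ln p, all at least 1, the three squares are
        of order k y / n, k m y / n and k^2 m y^2 / n, each dominated by H = k^2 m y^3 / n. The last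
        one is the bias and accounts for K0^4 and s0^2.\<close>
      have *: "(t n)\<^sup>2 \<le> 6 * V0 * H n \<and> (t n * s0 n)\<^sup>2 \<le> 6 * V0 * H n \<and>
          (sqrt n * (t n)\<^sup>2 * s0 n)\<^sup>2 \<le> 36 * V0\<^sup>2 * H n"
        if n: "n \<ge> 1" and ln: "ln (real (p n)) \<ge> 1" for n
      proof -
        define k where "k = (K0 R n)\<^sup>2"
        define y where "y = ln (real (p n))"
        define m where "m = (real (s0 n))\<^sup>2"
        have k: "k \<ge> 1" using K[OF n] by (simp add: k_def one_le_power)
        have m: "m \<ge> 1" using dims[OF n] by (simp add: m_def one_le_power)
        have y: "y \<ge> 1" using ln by (simp add: y_def)
        have y3: "y \<le> y ^ 3" "y\<^sup>2 \<le> y ^ 3" using y power_increasing[of 1 3 y] power_increasing[of 2 3 y] by auto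
        have kk: "k \<le> k\<^sup>2" using k power_increasing[of 1 2 k] by simp
        have Heq: "H n = k\<^sup>2 * m * y ^ 3 / n"
          by (simp add: H_def k_def m_def y_def power_mult[symmetric])
        have t2': "(t n)\<^sup>2 = 6 * V0 * (k * y / n)" using t2[OF ln] by (simp add: k_def y_def)
        have "k * 1 * y \<le> k\<^sup>2 * m * y ^ 3" using k m y y3 kk by (intro mult_mono) auto
        then have a: "k * y / n \<le> H n" unfolding Heq by (simp add: divide_right_mono)
        have "k * m * y \<le> k\<^sup>2 * m * y ^ 3" using k m y y3 kk by (intro mult_mono) auto
        then have b: "k * m * y / n \<le> H n" unfolding Heq by (simp add: divide_right_mono)
        have "k\<^sup>2 * m * y\<^sup>2 \<le> k\<^sup>2 * m * y ^ 3" using k m y y3 by (intro mult_mono) auto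
        then have c: "k\<^sup>2 * m * y\<^sup>2 / n \<le> H n" unfolding Heq by (simp add: divide_right_mono)
        have "(t n)\<^sup>2 \<le> 6 * V0 * H n" unfolding t2' using a const by (intro mult_left_mono) auto
        moreover have "(t n * s0 n)\<^sup>2 = 6 * V0 * (k * m * y / n)"
          unfolding power_mult_distrib t2' by (simp add: m_def mult_ac)
        then have "(t n * s0 n)\<^sup>2 \<le> 6 * V0 * H n"
          using mult_left_mono[OF b, of "6 * V0"] const by simp
        moreover have "(sqrt n * (t n)\<^sup>2 * s0 n)\<^sup>2 = 36 * V0\<^sup>2 * (k\<^sup>2 * m * y\<^sup>2 / n)"
          unfolding t2' using n by (simp add: power_mult_distrib power_divide m_def power2_eq_square[of "real n"])
        then have "(sqrt n * (t n)\<^sup>2 * s0 n)\<^sup>2 \<le> 36 * V0\<^sup>2 * H n"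
          using mult_left_mono[OF c, of "36 * V0\<^sup>2"] const by simp
        ultimately show ?thesis by blast
      qed
      have ev: "eventually (\<lambda>n. (t n)\<^sup>2 \<le> 6 * V0 * H n \<and> (t n * s0 n)\<^sup>2 \<le> 6 * V0 * H n \<and>
          (sqrt n * (t n)\<^sup>2 * s0 n)\<^sup>2 \<le> 36 * V0\<^sup>2 * H n) sequentially"
        using ev1 ln_p by eventually_elim (rule *)
      show "eventually (\<lambda>n. t n < r) sequentially"
        using ev by (intro eventually_less_of_square[OF _ H r, of _ "6 * V0"]) (auto elim: eventually_mono)
      show "eventually (\<lambda>n. t n * s0 n < r) sequentially"
        using ev by (intro eventually_less_of_square[OF _ H r, of _ "6 * V0"]) (auto elim: eventually_mono)
      show "eventually (\<lambda>n. sqrt n * (t n)\<^sup>2 * s0 n < r) sequentially"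
        using ev by (intro eventually_less_of_square[OF _ H r, of _ "36 * V0\<^sup>2"]) (auto elim: eventually_mono)
    qed
    \<comment> \<open>The remainder is uniform in \<beta>: failed concentration, Chebyshev at level
      sqrt x, and the worst failure probability of the variance estimator.\<close>
    define r where "r n = 8 / real (p n) + hi / x n + (SUP \<beta>\<in>U n. bad n \<beta>)" for n
    let ?P = "\<lambda>n \<beta>. measure (M n)
              {\<omega> \<in> space (M n).
                 rejects n (p n) (\<lambda>j. 2 * t n) (G n) (bt n) a (bhat n) (ghat n) (vhat n)
                   (data n (p n) (X n) (eps n) \<beta> \<omega>)}"
    show "(\<lambda>n. INF \<beta>\<in>U n. ?P n \<beta>) \<longlonglongrightarrow> 1"
    proof (rule tendsto_INF_one)
      have "(\<lambda>n. 8 / real (p n) + hi / x n + (SUP \<beta>\<in>U n. bad n \<beta>)) \<longlonglongrightarrow> 0 + 0 + 0"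
        using \<alpha>(4) unfolding bad_def
        by (intro tendsto_add tendsto_divide_0[OF tendsto_const] filterlim_at_top_imp_at_infinity p_top x_top)
      then show "r \<longlonglongrightarrow> 0" unfolding r_def by simp
    next
      \<comment> \<open>Half of \<delta> c is reserved for t and half for the sparsity term, which
        is 4 sqrt (Cd / c) times 2 t sqrt s_j; the summand 1 keeps the denominator positive.\<close>
      define \<rho> where "\<rho> = \<delta> * c / (2 * (4 * sqrt (Cd / c) + 1))"
      have C0: "sqrt (Cd / c) \<ge> 0" using const by simp
      have C1: "4 * sqrt (Cd / c) + 1 > 0" using C0 by linarith
      then have \<rho>: "\<rho> > 0" unfolding \<rho>_def using \<delta> const by (intro divide_pos_pos mult_pos_pos) auto
      have e1: "eventually (\<lambda>n. \<alpha> n * (ln (real (p n)))\<^sup>2 * sp n < \<rho>) sequentially"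
        using \<rho> by (intro order_tendstoD(2)[OF \<alpha>(3)])
      have e2: "eventually (\<lambda>n. \<alpha> n \<ge> max 1 (1 / (\<delta> * lo))) sequentially"
        using \<alpha>(2) unfolding filterlim_at_top by blast
      have e3: "eventually (\<lambda>n. x n \<ge> max 1 ((16 * sqrt (2 * ln (2 / a)) + 8) / \<epsilon>\<^sub>0)) sequentially"
        using x_top unfolding filterlim_at_top by blast
      have e4: "eventually (\<lambda>n. sqrt (x n) \<ge> 16 * sqrt (2 / lo) / \<epsilon>\<^sub>0) sequentially"
        using sqrt_x_top unfolding filterlim_at_top by blast
      have e5: "eventually (\<lambda>n. card (G n) \<ge> 1) sequentially"
        using card_G unfolding filterlim_at_top by blast
      have e6: "eventually (\<lambda>n. t n < h0 * V0) sequentially" "eventually (\<lambda>n. t n < \<delta> * c / 2) sequentially"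
        "eventually (\<lambda>n. t n * s0 n < c / 32) sequentially"
        "eventually (\<lambda>n. sqrt n * (t n)\<^sup>2 * s0 n < c * sqrt (c * lo) / 192) sequentially"
        by ((rule t_small ts_small tts_small, use const \<delta> sig in simp)+)
      show "eventually (\<lambda>n. U n \<noteq> {} \<and>
          (\<forall>\<beta>\<in>U n. 1 - r n \<le> ?P n \<beta> \<and> 0 \<le> ?P n \<beta> \<and> ?P n \<beta> \<le> 1)) sequentially"
        using ev1 ln_p e1 e2 e3 e4 e5 e6
      proof eventually_elim
        case (elim n)
        have n: "n \<ge> 1" by fact
        interpret P: prob_space "M n" using model[OF n] by (simp add: linear_model_def)
        have finG: "finite (G n)" "G n \<noteq> {}" using elim(7) by (auto intro: card_ge_0_finite)
        have t0: "t n \<ge> 0" using const K[OF n] elim(2) unfolding t_def by (intro mult_nonneg_nonneg) auto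
        have theta: "sig2 n * precision (M n) (p n) (X n) $$ (j, j) > 0" if "j \<in> G n" for j
        proof -
          interpret concentrated_row "M n" n "p n" "X n" "eps n" "sig2 n" c Cd j "h0 / (K0 R n)\<^sup>2" "V0 * (K0 R n)\<^sup>2"
            using row n that G by auto
          show ?thesis using theta_pos sig(1) sig(2)[OF n] by (simp add: \<theta>_def)
        qed
        have "U n \<noteq> {}"
        proof -
          obtain j where "j \<in> G n" using finG by auto
          then show ?thesis unfolding U using theta G[OF n] dims[OF n] by (intro alternatives_nonempty) auto
        qed
        moreover have "1 - r n \<le> ?P n \<beta>" if \<beta>: "\<beta> \<in> U n" for \<beta>
        proof -
          have "(MAX j\<in>G n. \<bar>\<beta> j - bt n j\<bar> / sqrt (sig2 n * precision (M n) (p n) (X n) $$ (j, j)))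
             > (sqrt 2 + \<epsilon>\<^sub>0) * sqrt (ln (card (G n)) / n)"
            using \<beta> unfolding U alternatives_def by auto
          \<comment> \<open>This j depends on \<beta>, which is harmless because the row estimates
            hold for every j with the same constants.\<close>
          then obtain j where jG: "j \<in> G n" and
            alt: "\<bar>\<beta> j - bt n j\<bar> / sqrt (sig2 n * precision (M n) (p n) (X n) $$ (j, j)) > (sqrt 2 + \<epsilon>\<^sub>0) * sqrt (ln (card (G n)) / n)"
            using finG by (auto simp: Max_gr_iff)
          have jp: "j < p n" using jG G[OF n] by auto
          interpret concentrated_row "M n" n "p n" "X n" "eps n" "sig2 n" c Cd j "h0 / (K0 R n)\<^sup>2" "V0 * (K0 R n)\<^sup>2"
            by (rule row[OF n jp])
          have K1: "K0 R n \<ge> 1" by (rule K[OF n])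
          have "2 * t n * sqrt (real (row_sparsity (M n) (p n) (X n) j)) \<le> sp n"
            unfolding sp_def using jp by (intro Max_ge) auto
          \<comment> \<open>Dropping the factor \<alpha> (ln p)^2 >= 1 from (A4) needs sp >=
            0.\<close>
          moreover have "sp n \<le> \<rho>"
          proof -
            have "0 \<le> sp n" using calculation t0 by (intro order_trans[OF _ calculation]) simp
            moreover have "1 \<le> \<alpha> n * (ln (real (p n)))\<^sup>2"
              using elim(2,4) mult_mono[of 1 "\<alpha> n" 1 "(ln (real (p n)))\<^sup>2"] by (simp add: one_le_power)
            ultimately have "1 * sp n \<le> \<alpha> n * (ln (real (p n)))\<^sup>2 * sp n" by (intro mult_right_mono) auto
            then show ?thesis using elim(3) by simp
          qed
          ultimately have "4 * sqrt (Cd / c) * (2 * t n * sqrt (real (row_sparsity (M n) (p n) (X n) j))) \<le> 4 * sqrt (Cd / c) * \<rho>"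
            using C0 by (intro mult_left_mono) auto
          also have "\<dots> \<le> (4 * sqrt (Cd / c) + 1) * \<rho>" using \<rho> by (intro mult_right_mono) auto
          also have "\<dots> = \<delta> * c / 2"
          proof -
            have "y * (d / (2 * y)) = d / 2" if "y > 0" for y d :: real using that by simp
            from this[OF C1] show ?thesis unfolding \<rho>_def .
          qed
          finally have sparse: "t n + 8 * t n * (sqrt (row_sparsity (M n) (p n) (X n) j) * sqrt (Cd / c)) \<le> \<delta> * c"
            using elim(9) by (simp add: mult_ac)
          have "1 - (8 / p n + hi / x n + bad n \<beta>) \<le> ?P n \<beta>"
            unfolding bad_def x_def t_def
          proof (rule rejection_probability_rate[where \<beta> = \<beta> and bt = "bt n" and K = "K0 R n",
                OF _ _ var[OF n] G[OF n] jG a _ const(4) refl K1 elim(2) _ _ \<delta> _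
                sig(1) sig(2)[OF n] sig(3)[OF n] alt], unfold t_def[symmetric] x_def[symmetric])
            show "lasso_estimator n (p n) (2 * t n) (bhat n)" "nodewise_lasso n (p n) (\<lambda>_. 2 * t n) (ghat n)"
              using lasso node n by auto
            show "card {k. k < p n \<and> \<beta> k \<noteq> 0} \<le> s0 n" using \<beta> unfolding U sparse_vectors_def by auto
            show "t n \<le> h0 / (K0 R n)\<^sup>2 * (V0 * (K0 R n)\<^sup>2)" using elim(8) K1 by simp
            show "32 * t n * s0 n \<le> c" using elim(10) by simp
            show "t n + 8 * t n * (sqrt (row_sparsity (M n) (p n) (X n) j) * sqrt (Cd / c)) \<le> \<delta> * c" by (rule sparse)
            show "0 < x n" using elim(5) by simp
            show "16 * sqrt (2 * ln (2 / a)) + 8 \<le> \<epsilon>\<^sub>0 * x n" using elim(5) \<epsilon>\<^sub>0 by (simp add: pos_divide_le_eq mult.commute)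
            show "16 * sqrt (2 / lo) \<le> \<epsilon>\<^sub>0 * sqrt (x n)" using elim(6) \<epsilon>\<^sub>0 by (simp add: pos_divide_le_eq mult.commute)
            show "sqrt n * (t n)\<^sup>2 * s0 n \<le> c * sqrt (c * lo) / 192" using elim(11) by simp
            show "1 \<le> \<alpha> n * (\<delta> * lo)" using elim(4) \<delta> sig(1) by (simp add: pos_divide_le_eq)
          qed
          \<comment> \<open>Probabilities are at most 1, so the supremum of reals is a genuine upper
            bound.\<close>
          moreover have "bad n \<beta> \<le> (SUP \<beta>\<in>U n. bad n \<beta>)"
            using \<beta> by (intro cSUP_upper bdd_aboveI2[of _ _ 1]) (auto simp: bad_def)
          ultimately show ?thesis unfolding r_def by linarith
        qed
        ultimately show ?case by simp
      qed
    qed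
  qed
qed

end
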